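(* Let $\rho>2$ and let $$H(u):=\int_{B(0,\rho)}\Big((a(x)\nabla u)\cdot\nabla u+b(x)W(u)+G(x,u)\Big)dx,\qquad u\in H^1(B(0,\rho))\cap L^\infty(B(0,\rho)),$$ where $W(u)=-\int_0^uf(s)\,ds$ is as in the context, $a\in W^{1,\infty}(B(0,\rho);\mathbb R^{n\times n})$ takes values in symmetric matrices, $b\in L^\infty(B(0,\rho))$, $G(x,u)$ is a Carathéodory function, and for some $\lambda>0$ $$\lambda\le b(x)\le\lambda^{-1}\quad\text{and}\quad\lambda|\xi|^2\le(a(x)\xi)\cdot\xi\le\lambda^{-1}|\xi|^2\qquad\forall x\in B(0,\rho),\ \forall\xi\in\mathbb R^n.$$ Let $u$ be a minimizer of $H$ with prescribed boundary data on $\partial B(0,\rho)$ with $\|u-\frac12\|_{L^\infty(B(0,\rho))}\le1$. Let $\beta\in(0,1)$, and for $R>0$ let $\mu_{\beta,R}:=|\{|u|>\beta\}\cap B(0,R)|$. If $\mu_{\beta,1}>0$, there exist $C,C'>0$ depending on $n$, $W$, $\|a\|_{W^{1,\infty}(B(0,\rho);\mathbb R^{n\times n})}$, $\lambda$, $\beta$ and $\mu_{\beta,1}$, such that $$\mu_{\beta,R}\ge CR^n$$ for all $R\in[1,\rho]$ satisfying $R\le C'\|G\|^{-1}_{L^\infty(B(0,\rho)\times(-\frac12,\frac32))}$.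
   Context: $n\ge2$; $B(x,r)$ is the open ball in $\mathbb R^n$ of radius $r$ centered at $x$; $|\cdot|$ of a set is Lebesgue measure. The function $f$ satisfies: $f\in C^{1,\gamma}_{loc}(\mathbb R)$ for some $\gamma\in(0,1]$, $f(0)=f(1)=0$, $f'(0)<0$, $f'(1)<0$, and $W(u)=-\int_0^uf(s)\,ds$ satisfies $W(0)=W(1)=0$, $W(u)>0$ for all $u\neq0,1$, and $\liminf_{|u|\to\infty}W(u)>0$. If $\|G\|_{L^\infty}=0$ the last condition on $R$ is void. *)

theory Defs
  imports "HOL-Analysis.Analysis" "HOL-Probability.Essential_Supremum"
begin

definition partial_deriv :: "'n \<Rightarrow> (real^'n::finite \<Rightarrow> real) \<Rightarrow> real^'n \<Rightarrow> real" where
  "partial_deriv i \<phi> x = frechet_derivative \<phi> (at x) (axis i 1)"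

primrec Ck_fun :: "nat \<Rightarrow> (real^'n::finite \<Rightarrow> real) \<Rightarrow> bool" where
  "Ck_fun 0 \<phi> \<longleftrightarrow> continuous_on UNIV \<phi>"
| "Ck_fun (Suc k) \<phi> \<longleftrightarrow>
     (\<forall>x. \<phi> differentiable (at x)) \<and> (\<forall>i. Ck_fun k (partial_deriv i \<phi>))"

text \<open>The space \<open>C\<^sub>c\<^sup>\<infinity>(\<Omega>)\<close>, its elements being extended by zero to the whole space.\<close>

definition test_fun :: "(real^'n::finite) set \<Rightarrow> (real^'n \<Rightarrow> real) \<Rightarrow> bool" where
  "test_fun \<Omega> \<phi> \<longleftrightarrow> (\<forall>k. Ck_fun k \<phi>) \<and>
     compact (closure {x. \<phi> x \<noteq> 0}) \<and> closure {x. \<phi> x \<noteq> 0} \<subseteq> \<Omega>"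

definition loc_integrable :: "'a::euclidean_space set \<Rightarrow> ('a \<Rightarrow> 'b::euclidean_space) \<Rightarrow> bool" where
  "loc_integrable \<Omega> u \<longleftrightarrow> (\<forall>K. compact K \<and> K \<subseteq> \<Omega> \<longrightarrow> integrable (lebesgue_on K) u)"

definition is_weak_partial ::
  "(real^'n::finite) set \<Rightarrow> 'n \<Rightarrow> (real^'n \<Rightarrow> 'b::euclidean_space) \<Rightarrow> (real^'n \<Rightarrow> 'b) \<Rightarrow> bool" where
  "is_weak_partial \<Omega> i u g \<longleftrightarrow> loc_integrable \<Omega> u \<and> loc_integrable \<Omega> g \<and>
     (\<forall>\<phi>. test_fun \<Omega> \<phi> \<longrightarrow>
        (\<integral>x. partial_deriv i \<phi> x *\<^sub>R u x \<partial>lebesgue_on \<Omega>) =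
        - (\<integral>x. \<phi> x *\<^sub>R g x \<partial>lebesgue_on \<Omega>))"

text \<open>On an open set the weak derivative, if it exists, is determined up to a null set, so
  nothing below depends on the representative that is selected here.\<close>

definition weak_partial ::
  "(real^'n::finite) set \<Rightarrow> 'n \<Rightarrow> (real^'n \<Rightarrow> 'b::euclidean_space) \<Rightarrow> real^'n \<Rightarrow> 'b" where
  "weak_partial \<Omega> i u = (SOME g. is_weak_partial \<Omega> i u g)"

definition weak_grad :: "(real^'n::finite) set \<Rightarrow> (real^'n \<Rightarrow> real) \<Rightarrow> real^'n \<Rightarrow> real^'n" where
  "weak_grad \<Omega> u x = (\<chi> i. weak_partial \<Omega> i u x)"

definition in_L2 :: "'a::euclidean_space set \<Rightarrow> ('a \<Rightarrow> 'b::euclidean_space) \<Rightarrow> bool" where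
  "in_L2 \<Omega> u \<longleftrightarrow> u \<in> borel_measurable (lebesgue_on \<Omega>) \<and>
     integrable (lebesgue_on \<Omega>) (\<lambda>x. (norm (u x))\<^sup>2)"

definition Linf_norm :: "'a::euclidean_space set \<Rightarrow> ('a \<Rightarrow> 'b::euclidean_space) \<Rightarrow> ereal" where
  "Linf_norm \<Omega> u = esssup (lebesgue_on \<Omega>) (\<lambda>x. ereal (norm (u x)))"

definition in_Linf :: "'a::euclidean_space set \<Rightarrow> ('a \<Rightarrow> 'b::euclidean_space) \<Rightarrow> bool" where
  "in_Linf \<Omega> u \<longleftrightarrow> u \<in> borel_measurable (lebesgue_on \<Omega>) \<and> Linf_norm \<Omega> u < \<infinity>"

definition in_H1 :: "(real^'n::finite) set \<Rightarrow> (real^'n \<Rightarrow> real) \<Rightarrow> bool" where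
  "in_H1 \<Omega> u \<longleftrightarrow> in_L2 \<Omega> u \<and> (\<forall>i. \<exists>g. is_weak_partial \<Omega> i u g \<and> in_L2 \<Omega> g)"

text \<open>The closure of \<open>C\<^sub>c\<^sup>\<infinity>(\<Omega>)\<close> in \<open>H\<^sup>1(\<Omega>)\<close>.\<close>

definition in_H10 :: "(real^'n::finite) set \<Rightarrow> (real^'n \<Rightarrow> real) \<Rightarrow> bool" where
  "in_H10 \<Omega> u \<longleftrightarrow> in_H1 \<Omega> u \<and>
     (\<exists>\<phi>. (\<forall>k::nat. test_fun \<Omega> (\<phi> k)) \<and>
        (\<lambda>k. \<integral>x. (\<phi> k x - u x)\<^sup>2 \<partial>lebesgue_on \<Omega>) \<longlonglongrightarrow> 0 \<and>
        (\<forall>i. (\<lambda>k. \<integral>x. (partial_deriv i (\<phi> k) x - weak_partial \<Omega> i u x)\<^sup>2 \<partial>lebesgue_on \<Omega>)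
                \<longlonglongrightarrow> 0))"

definition in_W1inf :: "(real^'n::finite) set \<Rightarrow> (real^'n \<Rightarrow> 'b::euclidean_space) \<Rightarrow> bool" where
  "in_W1inf \<Omega> a \<longleftrightarrow> in_Linf \<Omega> a \<and> (\<forall>i. \<exists>g. is_weak_partial \<Omega> i a g \<and> in_Linf \<Omega> g)"

text \<open>The usual norm, the sum of the \<open>L\<^sup>\<infinity>\<close> norms of all weak derivatives of order at most one.
  For matrix-valued functions the pointwise norm is the Frobenius norm.\<close>

definition W1inf_norm :: "(real^'n::finite) set \<Rightarrow> (real^'n \<Rightarrow> 'b::euclidean_space) \<Rightarrow> ereal" where
  "W1inf_norm \<Omega> a = Linf_norm \<Omega> a + (\<Sum>i\<in>UNIV. Linf_norm \<Omega> (weak_partial \<Omega> i a))"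

definition caratheodory :: "'a::euclidean_space set \<Rightarrow> ('a \<Rightarrow> real \<Rightarrow> real) \<Rightarrow> bool" where
  "caratheodory \<Omega> G \<longleftrightarrow> (\<forall>s. (\<lambda>x. G x s) \<in> borel_measurable (lebesgue_on \<Omega>)) \<and>
     (AE x in lebesgue_on \<Omega>. continuous_on UNIV (G x))"

definition C1_holder_loc :: "real \<Rightarrow> (real \<Rightarrow> real) \<Rightarrow> bool" where
  "C1_holder_loc \<gamma> f \<longleftrightarrow> (\<forall>x. f differentiable (at x)) \<and>
     (\<forall>K. compact K \<longrightarrow>
        (\<exists>L. \<forall>x\<in>K. \<forall>y\<in>K. \<bar>deriv f x - deriv f y\<bar> \<le> L * \<bar>x - y\<bar> powr \<gamma>))"

text \<open>The interval integral is oriented: for negative \<open>u\<close> it is minus the integral over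
  the interval from \<open>u\<close> to \<open>0\<close>.\<close>

definition potential :: "(real \<Rightarrow> real) \<Rightarrow> real \<Rightarrow> real" where
  "potential f u = - (LBINT s=ereal 0..ereal u. f s)"

definition energy_density ::
  "(real^'n::finite) set \<Rightarrow> (real \<Rightarrow> real) \<Rightarrow> (real^'n \<Rightarrow> real^'n^'n) \<Rightarrow> (real^'n \<Rightarrow> real) \<Rightarrow>
   (real^'n \<Rightarrow> real \<Rightarrow> real) \<Rightarrow> (real^'n \<Rightarrow> real) \<Rightarrow> real^'n \<Rightarrow> real" where
  "energy_density \<Omega> f a b G u x =
     (a x *v weak_grad \<Omega> u x) \<bullet> weak_grad \<Omega> u x + b x * potential f (u x) + G x (u x)"

definition energy ::
  "(real^'n::finite) set \<Rightarrow> (real \<Rightarrow> real) \<Rightarrow> (real^'n \<Rightarrow> real^'n^'n) \<Rightarrow> (real^'n \<Rightarrow> real) \<Rightarrow>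
   (real^'n \<Rightarrow> real \<Rightarrow> real) \<Rightarrow> (real^'n \<Rightarrow> real) \<Rightarrow> real" where
  "energy \<Omega> f a b G u = (\<integral>x. energy_density \<Omega> f a b G u x \<partial>lebesgue_on \<Omega>)"

text \<open>A general Caratheodory function \<open>G\<close> need not give \<open>G(x, u(x))\<close> a finite integral for
  every bounded \<open>u\<close>. Since the Bochner integral of a non-integrable function is \<open>0\<close> by
  convention, the functional has to be restricted explicitly to those \<open>u\<close> for which
  it is defined.\<close>

definition admissible ::
  "(real^'n::finite) set \<Rightarrow> (real \<Rightarrow> real) \<Rightarrow> (real^'n \<Rightarrow> real^'n^'n) \<Rightarrow> (real^'n \<Rightarrow> real) \<Rightarrow>
   (real^'n \<Rightarrow> real \<Rightarrow> real) \<Rightarrow> (real^'n \<Rightarrow> real) \<Rightarrow> bool" where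
  "admissible \<Omega> f a b G u \<longleftrightarrow> in_H1 \<Omega> u \<and> in_Linf \<Omega> u \<and>
     integrable (lebesgue_on \<Omega>) (energy_density \<Omega> f a b G u)"

text \<open>Two functions have the same boundary data if their difference lies in \<open>H\<^sub>0\<^sup>1(\<Omega>)\<close>.\<close>

definition is_minimizer ::
  "(real^'n::finite) set \<Rightarrow> (real \<Rightarrow> real) \<Rightarrow> (real^'n \<Rightarrow> real^'n^'n) \<Rightarrow> (real^'n \<Rightarrow> real) \<Rightarrow>
   (real^'n \<Rightarrow> real \<Rightarrow> real) \<Rightarrow> (real^'n \<Rightarrow> real) \<Rightarrow> bool" where
  "is_minimizer \<Omega> f a b G u \<longleftrightarrow> admissible \<Omega> f a b G u \<and>
     (\<forall>v. admissible \<Omega> f a b G v \<and> in_H10 \<Omega> (\<lambda>x. v x - u x) \<longrightarrow>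
        energy \<Omega> f a b G u \<le> energy \<Omega> f a b G v)"

definition superlevel_measure :: "(real^'n::finite \<Rightarrow> real) \<Rightarrow> real \<Rightarrow> real \<Rightarrow> real" where
  "superlevel_measure u \<beta> R = measure lebesgue ({x. \<bar>u x\<bar> > \<beta>} \<inter> ball 0 R)"

end

theory Submission
  imports Defs
begin

text \<open>Let \<open>\<Phi> R\<close> be the integral of \<open>u\<^sup>2\<close>, \<open>E R\<close> the energy of \<open>u\<close> without \<open>G\<close>, and \<open>V R\<close> the measure of
  \<open>{\<bar>u\<bar> > \<beta>}\<close>, all on the ball of radius \<open>R\<close>; then \<open>\<Phi> \<le> C (V + E)\<close> because \<open>W\<close> is quadratic
  at \<open>0\<close>. Comparing \<open>u\<close> with \<open>(1 - \<zeta>\<^sup>2) u\<close> for a cutoff \<open>\<zeta>\<close> yields a Caccioppoli inequality that bounds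
  \<open>E (R - 1)\<close> by the integral of \<open>u\<^sup>2\<close> over an annulus, hence both by the increment of \<open>\<Phi>\<close> and by
  \<open>C R\<^sup>n\<^sup>-\<^sup>1\<close>, up to an error \<open>\<parallel>G\<parallel> R\<^sup>n\<close>. Comparing a truncation of \<open>u\<close> with its averaged
  translates yields \<open>V (R - 2) \<le> C r (E (R - 1) + \<Phi> R - \<Phi> (R - 2))\<close> as soon as the ball of radius \<open>r\<close>
  has measure at least \<open>C \<Phi> R\<close>. With \<open>r\<close> a small multiple of \<open>R\<close>, these estimates force \<open>\<Phi>\<close> to grow by
  at least a multiple of \<open>R\<^sup>n\<^sup>-\<^sup>1\<close> per step as long as \<open>\<Phi> R\<close> is small compared with \<open>R\<^sup>n\<close>, so
  \<open>\<Phi> R \<ge> c R\<^sup>n\<close>; since \<open>E\<close> is of lower order, the growth is due to \<open>V\<close>.\<close>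

section \<open>Smooth functions\<close>

text \<open>The obstacle is that \<open>V\<close> alone satisfies no closed recursion: the
  Caccioppoli inequality bounds the energy only through \<open>\<Phi>\<close> on a shell. The
  iteration therefore runs on the single monotone quantity \<open>\<Phi>\<close>, and
  \<open>V\<close> is recovered at the end. The competitor is \<open>u\<close> times a factor in
  [0, 1]; since [-1/2, 3/2] contains 0, its values stay in that interval, so the bounds on
  \<open>G\<close> and on \<open>W\<close> apply to it as they do to \<open>u\<close>. Comparing
  with translates costs a factor \<open>r\<close> instead of a power of the measure. This is
  harmless: with \<open>r\<close> proportional to \<open>R\<close>, a bound of
  \<open>\<Phi> (R - 2)\<close> by \<open>K * r\<close> times the increment still forces an
  increment of order R^(n-1), the order of a surface. The condition on \<open>R\<close> makes the
  error \<open>M * R ^ n\<close> a small multiple of the same order. Boundary data are encoded by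
  the closure of test functions, which is why mollification is developed in detail: it places
  competitors in that closure and lets the translation argument run on smooth functions. All cutoffs
  have transition layers of a fixed width, so that no constant depends on the radius.\<close>

lemma partial_deriv_eq:
  assumes "(\<phi> has_derivative D) (at x)"
  shows "partial_deriv i \<phi> x = D (axis i 1)"
  unfolding partial_deriv_def using frechet_derivative_at[OF assms] by simp

lemma has_derivative_sum_partial_deriv:
  fixes \<phi> :: "real^'n::finite \<Rightarrow> real"
  assumes "\<phi> differentiable (at x)"
  shows "(\<phi> has_derivative (\<lambda>h. \<Sum>i\<in>UNIV. h $ i * partial_deriv i \<phi> x)) (at x)"
proof -
  have D: "(\<phi> has_derivative frechet_derivative \<phi> (at x)) (at x)"
    using assms frechet_derivative_works by blast
  then have L: "linear (frechet_derivative \<phi> (at x))"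
    using has_derivative_linear by blast
  have "frechet_derivative \<phi> (at x) h = (\<Sum>i\<in>UNIV. h $ i * partial_deriv i \<phi> x)" for h
  proof -
    have "h = (\<Sum>i\<in>UNIV. h $ i *\<^sub>R axis i 1)"
      by (simp add: vec_eq_iff axis_def if_distrib cong: if_cong)
    then have "frechet_derivative \<phi> (at x) h =
        frechet_derivative \<phi> (at x) (\<Sum>i\<in>UNIV. h $ i *\<^sub>R axis i 1)"
      by (rule arg_cong)
    also have "\<dots> = (\<Sum>i\<in>UNIV. h $ i * frechet_derivative \<phi> (at x) (axis i 1))"
      by (simp add: linear_sum[OF L] linear_cmul[OF L])
    finally show ?thesis by (simp add: partial_deriv_def)
  qed
  then have "frechet_derivative \<phi> (at x) = (\<lambda>h. \<Sum>i\<in>UNIV. h $ i * partial_deriv i \<phi> x)" ..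
  with D show ?thesis by simp
qed

definition smooth :: "(real^'n::finite \<Rightarrow> real) \<Rightarrow> bool" where
  "smooth \<phi> \<longleftrightarrow> (\<forall>k. Ck_fun k \<phi>)"

text \<open>Membership in a class of differentiable functions closed under
  \<open>partial_deriv\<close> gives \<open>Ck_fun k\<close> by induction on \<open>k\<close>.
  Smoothness of a concrete family is thus reduced to one computation of its partial derivatives,
  provided that the class is large enough to contain them.\<close>

lemma smooth_coinduct:
  assumes "P \<phi>"
    and step: "\<And>\<phi>. P \<phi> \<Longrightarrow> (\<forall>x. \<phi> differentiable (at x)) \<and> (\<forall>i. P (partial_deriv i \<phi>))"
  shows "smooth \<phi>"
proof -
  have "Ck_fun k \<phi>" if "P \<phi>" for k \<phi>
    using that
  proof (induction k arbitrary: \<phi>)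
    case 0
    then show ?case using step[of \<phi>]
      by (auto simp: continuous_on_eq_continuous_at differentiable_imp_continuous_within)
  next
    case (Suc k)
    then show ?case using step[of \<phi>] by auto
  qed
  then show ?thesis using assms(1) by (auto simp: smooth_def)
qed

lemma smooth_differentiable: "smooth \<phi> \<Longrightarrow> \<phi> differentiable (at x)"
  unfolding smooth_def by (metis Ck_fun.simps(2))

lemma smooth_partial_deriv: "smooth \<phi> \<Longrightarrow> smooth (partial_deriv i \<phi>)"
  unfolding smooth_def by (metis Ck_fun.simps(2))

lemma smooth_continuous_on: "smooth \<phi> \<Longrightarrow> continuous_on S \<phi>"
  unfolding smooth_def by (metis Ck_fun.simps(1) continuous_on_subset subset_UNIV)

lemma smooth_borel_measurable: "smooth \<phi> \<Longrightarrow> \<phi> \<in> borel_measurable borel"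
  by (simp add: borel_measurable_continuous_onI smooth_continuous_on)

lemma smooth_has_derivative:
  "smooth \<phi> \<Longrightarrow> (\<phi> has_derivative (\<lambda>h. \<Sum>i\<in>UNIV. h $ i * partial_deriv i \<phi> x)) (at x)"
  by (simp add: has_derivative_sum_partial_deriv smooth_differentiable)

lemma Ck_fun_SucD: "Ck_fun (Suc k) \<phi> \<Longrightarrow> Ck_fun k \<phi>"
proof (induction k arbitrary: \<phi>)
  case 0
  then show ?case
    by (auto simp: continuous_on_eq_continuous_at differentiable_imp_continuous_within)
next
  case (Suc k)
  then show ?case by (metis Ck_fun.simps(2))
qed

lemma partial_deriv_add:
  assumes "\<phi> differentiable (at x)" "\<psi> differentiable (at x)"
  shows "partial_deriv i (\<lambda>x. \<phi> x + \<psi> x) x = partial_deriv i \<phi> x + partial_deriv i \<psi> x"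
proof -
  have "((\<lambda>x. \<phi> x + \<psi> x) has_derivative
     (\<lambda>h. frechet_derivative \<phi> (at x) h + frechet_derivative \<psi> (at x) h)) (at x)"
    by (intro has_derivative_add) (use assms frechet_derivative_works in blast)+
  from partial_deriv_eq[OF this] show ?thesis
    by (simp add: partial_deriv_def)
qed

lemma partial_deriv_mult:
  fixes \<phi> \<psi> :: "real^'n::finite \<Rightarrow> real"
  assumes "\<phi> differentiable (at x)" "\<psi> differentiable (at x)"
  shows "partial_deriv i (\<lambda>x. \<phi> x * \<psi> x) x = \<phi> x * partial_deriv i \<psi> x + partial_deriv i \<phi> x * \<psi> x"
proof -
  have "((\<lambda>x. \<phi> x * \<psi> x) has_derivative
     (\<lambda>h. \<phi> x * frechet_derivative \<psi> (at x) h + frechet_derivative \<phi> (at x) h * \<psi> x)) (at x)"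
    by (intro has_derivative_mult) (use assms frechet_derivative_works in blast)+
  from partial_deriv_eq[OF this] show ?thesis
    by (simp add: partial_deriv_def)
qed

lemma partial_deriv_const[simp]: "partial_deriv i (\<lambda>x. c) = (\<lambda>x. 0)"
  by (simp add: partial_deriv_def fun_eq_iff)

lemma smooth_const: "smooth (\<lambda>x. c)"
  by (rule smooth_coinduct[where P = "\<lambda>\<phi>. \<exists>c. \<phi> = (\<lambda>x. c)"]) auto

lemma Ck_fun_add: "Ck_fun k \<phi> \<Longrightarrow> Ck_fun k \<psi> \<Longrightarrow> Ck_fun k (\<lambda>x. \<phi> x + \<psi> x)"
proof (induction k arbitrary: \<phi> \<psi>)
  case 0
  then show ?case by (auto intro: continuous_intros)
next
  case (Suc k)
  then have "partial_deriv i (\<lambda>x. \<phi> x + \<psi> x) = (\<lambda>x. partial_deriv i \<phi> x + partial_deriv i \<psi> x)" for i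
    by (auto simp: partial_deriv_add)
  with Suc show ?case by (auto intro: differentiable_add)
qed

lemma Ck_fun_mult: "Ck_fun k \<phi> \<Longrightarrow> Ck_fun k \<psi> \<Longrightarrow> Ck_fun k (\<lambda>x. \<phi> x * \<psi> x)"
proof (induction k arbitrary: \<phi> \<psi>)
  case 0
  then show ?case by (auto intro: continuous_intros)
next
  case (Suc k)
  then have "partial_deriv i (\<lambda>x. \<phi> x * \<psi> x) =
      (\<lambda>x. \<phi> x * partial_deriv i \<psi> x + partial_deriv i \<phi> x * \<psi> x)" for i
    by (auto simp: partial_deriv_mult)
  moreover have "Ck_fun k (\<lambda>x. \<phi> x * partial_deriv i \<psi> x + partial_deriv i \<phi> x * \<psi> x)" for i
    using Suc Ck_fun_SucD by (intro Ck_fun_add Suc.IH) auto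
  ultimately show ?case using Suc.prems by (auto intro: differentiable_mult)
qed

lemma smooth_add: "smooth \<phi> \<Longrightarrow> smooth \<psi> \<Longrightarrow> smooth (\<lambda>x. \<phi> x + \<psi> x)"
  and smooth_mult: "smooth \<phi> \<Longrightarrow> smooth \<psi> \<Longrightarrow> smooth (\<lambda>x. \<phi> x * \<psi> x)"
  by (simp_all add: smooth_def Ck_fun_add Ck_fun_mult)

lemma partial_deriv_affine:
  fixes \<phi> :: "real^'n::finite \<Rightarrow> real"
  assumes "smooth \<phi>"
  shows "partial_deriv i (\<lambda>x. b * \<phi> (c *\<^sub>R x + d)) x = b * c * partial_deriv i \<phi> (c *\<^sub>R x + d)"
    and "(\<lambda>x. b * \<phi> (c *\<^sub>R x + d)) differentiable (at x)"
proof -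
  have "((\<lambda>x. c *\<^sub>R x + d) has_derivative (\<lambda>h. c *\<^sub>R h)) (at x)"
    by (auto intro!: derivative_eq_intros)
  from has_derivative_compose[OF this smooth_has_derivative[OF assms, of "c *\<^sub>R x + d"]]
  have D: "((\<lambda>x. b * \<phi> (c *\<^sub>R x + d)) has_derivative
      (\<lambda>h. b * (\<Sum>i\<in>UNIV. (c *\<^sub>R h) $ i * partial_deriv i \<phi> (c *\<^sub>R x + d)))) (at x)"
    by (rule has_derivative_mult_right)
  show "partial_deriv i (\<lambda>x. b * \<phi> (c *\<^sub>R x + d)) x = b * c * partial_deriv i \<phi> (c *\<^sub>R x + d)"
    unfolding partial_deriv_eq[OF D]
    by (simp add: axis_def if_distrib if_distribR cong: if_cong)
  show "(\<lambda>x. b * \<phi> (c *\<^sub>R x + d)) differentiable (at x)"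
    using D by (auto simp: differentiable_def)
qed

lemma smooth_affine:
  fixes \<phi> :: "real^'n::finite \<Rightarrow> real"
  assumes "smooth \<phi>"
  shows "smooth (\<lambda>x. b * \<phi> (c *\<^sub>R x + d))"
proof (rule smooth_coinduct[where P = "\<lambda>\<psi>. \<exists>\<phi> b. smooth \<phi> \<and> \<psi> = (\<lambda>x. b * \<phi> (c *\<^sub>R x + d))"])
  fix \<psi> :: "real^'n \<Rightarrow> real"
  assume "\<exists>\<phi> b. smooth \<phi> \<and> \<psi> = (\<lambda>x. b * \<phi> (c *\<^sub>R x + d))"
  then obtain \<phi> b where \<phi>: "smooth \<phi>" "\<psi> = (\<lambda>x. b * \<phi> (c *\<^sub>R x + d))" by auto
  \<comment> \<open>The new factor \<open>b * c\<close> is the reason why the class lets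
    \<open>b\<close> vary.\<close>
  have "partial_deriv i \<psi> = (\<lambda>x. (b * c) * partial_deriv i \<phi> (c *\<^sub>R x + d))" for i
    using partial_deriv_affine(1)[OF \<phi>(1)] by (auto simp: \<phi>(2))
  then show "(\<forall>x. \<psi> differentiable at x) \<and>
      (\<forall>i. \<exists>\<phi> b. smooth \<phi> \<and> partial_deriv i \<psi> = (\<lambda>x. b * \<phi> (c *\<^sub>R x + d)))"
    using partial_deriv_affine(2)[OF \<phi>(1)] smooth_partial_deriv[OF \<phi>(1)] \<phi>(2) by metis
qed (use assms in blast)

lemma partial_deriv_eq_0_open:
  fixes \<phi> :: "real^'n::finite \<Rightarrow> real"
  assumes "open S" "x \<in> S" "\<And>y. y \<in> S \<Longrightarrow> \<phi> y = c"
  shows "partial_deriv i \<phi> x = 0"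
proof -
  have "(\<phi> has_derivative (\<lambda>h. 0)) (at x)"
    by (rule has_derivative_transform_within_open[OF has_derivative_const[of c] assms(1,2)])
      (use assms(3) in auto)
  from partial_deriv_eq[OF this] show ?thesis by simp
qed

subsection \<open>Mollifiers\<close>

text \<open>The derivatives of the flat function exp(-1/t) are polynomials in 1/t times exp(-1/t).
  The exponent \<open>j\<close> makes the family closed under differentiation up to linear
  combinations.\<close>

definition exp_inv :: "nat \<Rightarrow> real \<Rightarrow> real" where
  "exp_inv j t = (if t > 0 then exp (- inverse t) * inverse t ^ j else 0)"

lemma exp_inv_lim: "(exp_inv j \<longlongrightarrow> 0) (at 0)"
proof -
  have "((\<lambda>t. (inverse t)^j / exp (inverse t)) \<longlongrightarrow> (0::real)) (at_right 0)"
    using filterlim_compose[OF tendsto_power_div_exp_0 filterlim_inverse_at_top_right] .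
  then have "(exp_inv j \<longlongrightarrow> 0) (at_right 0)"
    by (rule Lim_transform_eventually)
      (auto simp: eventually_at_filter exp_inv_def exp_minus field_simps)
  moreover have "(exp_inv j \<longlongrightarrow> 0) (at_left 0)"
    by (rule Lim_transform_eventually[OF tendsto_const])
      (auto simp: eventually_at_filter exp_inv_def)
  ultimately show ?thesis by (simp add: filterlim_at_split)
qed

lemma exp_inv_deriv:
  "(exp_inv j has_field_derivative (exp_inv (j+2) t - real j * exp_inv (j+1) t)) (at t)"
proof -
  consider "t > 0" | "t < 0" | "t = 0" by linarith
  then show ?thesis
  proof cases
    case 1
    have "((\<lambda>t. exp (- inverse t) * inverse t ^ j) has_field_derivative
       (exp_inv (j+2) t - real j * exp_inv (j+1) t)) (at t)"
    proof (cases j)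
      case (Suc i)
      have "inverse t ^ i = inverse t * inverse t ^ (i - Suc 0) \<or> i = 0"
        by (cases i) auto
      with 1 Suc show ?thesis
        by (auto intro!: derivative_eq_intros simp: exp_inv_def power2_eq_square algebra_simps)
    qed (use 1 in \<open>auto intro!: derivative_eq_intros simp: exp_inv_def power2_eq_square algebra_simps\<close>)
    then show ?thesis
      by (rule has_field_derivative_transform_within_open[where S = "{0<..}"])
        (use 1 in \<open>auto simp: exp_inv_def\<close>)
  next
    case 2
    have "((\<lambda>t. 0) has_field_derivative (exp_inv (j+2) t - real j * exp_inv (j+1) t)) (at t)"
      using 2 by (auto simp: exp_inv_def)
    then show ?thesis
      by (rule has_field_derivative_transform_within_open[where S = "{..<0}"])
        (use 2 in \<open>auto simp: exp_inv_def\<close>)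
  next
    case 3
    \<comment> \<open>The difference quotient at 0 is exactly \<open>exp_inv (j+1)\<close>, so the
      derivative there is the limit already computed.\<close>
    have "((\<lambda>h. (exp_inv j (0 + h) - exp_inv j 0) / h) \<longlongrightarrow> 0) (at 0)"
      by (rule Lim_transform_eventually[OF exp_inv_lim[of "j+1"]])
        (auto simp: eventually_at_filter exp_inv_def field_simps)
    then show ?thesis
      using 3 by (simp add: DERIV_def exp_inv_def)
  qed
qed

text \<open>These are linear combinations of products of two flat functions, one starting at -1 and
  one ending at 1, so all members vanish outside (-1, 1). The scalar \<open>c\<close> absorbs the
  coefficients of \<open>exp_inv_deriv\<close> and the sign from the reflection
  \<open>1 - t\<close>.\<close>

inductive_set bump_class :: "(real \<Rightarrow> real) set" where
  base: "(\<lambda>t. c * (exp_inv j (1 + t) * exp_inv l (1 - t))) \<in> bump_class"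
| add: "f \<in> bump_class \<Longrightarrow> g \<in> bump_class \<Longrightarrow> (\<lambda>t. f t + g t) \<in> bump_class"

lemma bump_class_deriv:
  "f \<in> bump_class \<Longrightarrow> \<exists>f'\<in>bump_class. \<forall>t. (f has_field_derivative f' t) (at t)"
proof (induction rule: bump_class.induct)
  case (base c j l)
  let ?E = "\<lambda>c j l t. c * (exp_inv j (1 + t) * exp_inv l (1 - t))"
  let ?f = "\<lambda>t. (?E c (j+2) l t + ?E (- c * real j) (j+1) l t) +
      (?E (-c) j (l+2) t + ?E (c * real l) j (l+1) t)"
  have "?f \<in> bump_class"
    by (intro bump_class.intros)
  moreover have "(?E c j l has_field_derivative ?f t) (at t)" for t
  proof -
    have 1: "((\<lambda>t. exp_inv j (1 + t)) has_field_derivative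
        (exp_inv (j+2) (1+t) - real j * exp_inv (j+1) (1+t)) * 1) (at t)"
      by (rule DERIV_chain2[OF exp_inv_deriv]) (auto intro!: derivative_eq_intros)
    have 2: "((\<lambda>t. exp_inv l (1 - t)) has_field_derivative
        (exp_inv (l+2) (1-t) - real l * exp_inv (l+1) (1-t)) * (-1)) (at t)"
      by (rule DERIV_chain2[OF exp_inv_deriv]) (auto intro!: derivative_eq_intros)
    show ?thesis
      by (rule DERIV_cong[OF DERIV_cmult[OF DERIV_mult[OF 1 2]]]) (simp add: algebra_simps)
  qed
  ultimately show ?case by (intro bexI[where x = ?f]) auto
next
  case (add f g)
  then obtain f' g' where "f' \<in> bump_class" "\<forall>t. (f has_field_derivative f' t) (at t)"
    "g' \<in> bump_class" "\<forall>t. (g has_field_derivative g' t) (at t)" by auto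
  then show ?case
    by (intro bexI[where x = "\<lambda>t. f' t + g' t"]) (auto intro: bump_class.add DERIV_add)
qed

text \<open>A partial derivative of a product of one-variable functions replaces a single factor by
  its derivative, so products with factors in \<open>bump_class\<close> form a class suited to
  \<open>smooth_coinduct\<close>. In this way no composition with a norm has to be
  differentiated.\<close>

lemma smooth_prod_bump_class:
  fixes f :: "'n::finite \<Rightarrow> real \<Rightarrow> real"
  assumes "\<And>i. f i \<in> bump_class"
  shows "smooth (\<lambda>x::real^'n. \<Prod>i\<in>UNIV. f i (x $ i))"
proof (rule smooth_coinduct[where
      P = "\<lambda>\<psi>. \<exists>f. (\<forall>i. f i \<in> bump_class) \<and> \<psi> = (\<lambda>x::real^'n. \<Prod>i\<in>UNIV. f i (x $ i))"])
  fix \<psi> :: "real^'n \<Rightarrow> real"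
  assume "\<exists>f. (\<forall>i. f i \<in> bump_class) \<and> \<psi> = (\<lambda>x::real^'n. \<Prod>i\<in>UNIV. f i (x $ i))"
  then obtain f where f: "\<And>i. f i \<in> bump_class" "\<psi> = (\<lambda>x::real^'n. \<Prod>i\<in>UNIV. f i (x $ i))"
    by auto
  have "\<exists>f'. \<forall>i. f' i \<in> bump_class \<and> (\<forall>t. (f i has_field_derivative f' i t) (at t))"
    using bump_class_deriv[OF f(1)] by metis
  then obtain f' where f': "\<And>i. f' i \<in> bump_class"
      "\<And>i t. (f i has_field_derivative f' i t) (at t)" by blast
  have D: "(\<psi> has_derivative (\<lambda>h. \<Sum>i\<in>UNIV. h $ i * f' i (x $ i) * (\<Prod>j\<in>UNIV - {i}. f j (x $ j)))) (at x)"
    for x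
  proof -
    have "((\<lambda>x. f i (x $ i)) has_derivative (\<lambda>h. h $ i * f' i (x $ i))) (at x)" for i
    proof -
      have "((\<lambda>x::real^'n. x $ i) has_derivative (\<lambda>h. h $ i)) (at x)"
        by (intro bounded_linear_imp_has_derivative bounded_linear_vec_nth)
      from has_derivative_compose[OF this f'(2)[of i "x $ i", unfolded has_field_derivative_def]]
      show ?thesis by (simp add: mult.commute)
    qed
    then show ?thesis unfolding f(2) by (intro has_derivative_prod)
  qed
  have P: "partial_deriv i \<psi> = (\<lambda>x. \<Prod>j\<in>UNIV. (f(i := f' i)) j (x $ j))" for i
  proof
    fix x
    have "partial_deriv i \<psi> x = f' i (x $ i) * (\<Prod>j\<in>UNIV - {i}. f j (x $ j))"
      unfolding partial_deriv_eq[OF D]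
      by (simp add: axis_def if_distrib if_distribR cong: if_cong)
    also have "\<dots> = (\<Prod>j\<in>UNIV. (f(i := f' i)) j (x $ j))"
      by (subst (2) prod.remove[of _ i]) (auto intro!: prod.cong)
    finally show "partial_deriv i \<psi> x = (\<Prod>j\<in>UNIV. (f(i := f' i)) j (x $ j))" .
  qed
  show "(\<forall>x. \<psi> differentiable at x) \<and>
      (\<forall>i. \<exists>f. (\<forall>i. f i \<in> bump_class) \<and> partial_deriv i \<psi> = (\<lambda>x::real^'n. \<Prod>i\<in>UNIV. f i (x $ i)))"
  proof (intro conjI allI)
    show "\<psi> differentiable at x" for x
      using D unfolding differentiable_def by blast
    show "\<exists>f. (\<forall>i. f i \<in> bump_class) \<and> partial_deriv i \<psi> = (\<lambda>x::real^'n. \<Prod>i\<in>UNIV. f i (x $ i))" for i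
      by (rule exI[where x = "f(i := f' i)"]) (use f(1) f'(1) P in auto)
  qed
qed (use assms in auto)

lemma test_fun_smooth: "test_fun \<Omega> \<phi> \<Longrightarrow> smooth \<phi>"
  by (simp add: test_fun_def smooth_def)

lemma test_funI:
  assumes "smooth \<phi>" "compact K" "K \<subseteq> \<Omega>" "\<And>x. x \<notin> K \<Longrightarrow> \<phi> x = 0"
  shows "test_fun \<Omega> \<phi>"
proof -
  have "closure {x. \<phi> x \<noteq> 0} \<subseteq> K"
    using assms by (intro closure_minimal) (auto simp: compact_imp_closed)
  moreover from this have "compact (closure {x. \<phi> x \<noteq> 0})"
    using assms(2) by (metis closed_closure compact_Int_closed inf.absorb2)
  ultimately show ?thesis using assms by (auto simp: test_fun_def smooth_def)
qed

lemma test_fun_support: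
  assumes "test_fun \<Omega> \<phi>"
  shows "\<exists>K. compact K \<and> K \<subseteq> \<Omega> \<and> (\<forall>x. x \<notin> K \<longrightarrow> \<phi> x = 0 \<and> (\<forall>i. partial_deriv i \<phi> x = 0))"
proof (intro exI conjI allI impI)
  let ?K = "closure {x. \<phi> x \<noteq> 0}"
  show "compact ?K" "?K \<subseteq> \<Omega>" using assms by (auto simp: test_fun_def)
  show 0: "\<phi> x = 0" if "x \<notin> ?K" for x
    using that closure_subset[of "{x. \<phi> x \<noteq> 0}"] by blast
  show "partial_deriv i \<phi> x = 0" if "x \<notin> ?K" for i x
  proof (rule partial_deriv_eq_0_open)
    show "open (- ?K)" by (rule open_Compl[OF closed_closure])
    show "x \<in> - ?K" using that by (simp only: Compl_iff not_False_eq_True)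
    show "\<phi> y = 0" if "y \<in> - ?K" for y using that 0 by (simp only: Compl_iff)
  qed
qed

lemma test_fun_partial_deriv: "test_fun \<Omega> \<phi> \<Longrightarrow> test_fun \<Omega> (partial_deriv i \<phi>)"
  using test_fun_support[of \<Omega> \<phi>] test_fun_smooth[of \<Omega> \<phi>] smooth_partial_deriv[of \<phi> i] test_funI
  by metis

lemma test_fun_mult_smooth:
  assumes "test_fun \<Omega> \<phi>" "smooth \<psi>"
  shows "test_fun \<Omega> (\<lambda>x. \<psi> x * \<phi> x)"
proof -
  obtain K where "compact K" "K \<subseteq> \<Omega>" "\<And>x. x \<notin> K \<Longrightarrow> \<phi> x = 0"
    using test_fun_support[OF assms(1)] by blast
  then show ?thesis
    using assms by (intro test_funI[of _ K]) (auto intro: smooth_mult test_fun_smooth)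
qed

lemma test_fun_ball:
  assumes "test_fun \<Omega> \<phi>"
  shows "\<exists>r>0. \<forall>x. norm x > r \<longrightarrow> \<phi> x = 0"
proof -
  obtain K where K: "compact K" "\<And>x. x \<notin> K \<Longrightarrow> \<phi> x = 0"
    using test_fun_support[OF assms(1)] by blast
  then obtain r where "r > 0" "\<forall>x\<in>K. norm x \<le> r"
    by (meson bounded_pos compact_imp_bounded)
  with K(2) show ?thesis by (metis not_less)
qed

lemma test_fun_bounded:
  assumes "test_fun \<Omega> \<phi>"
  shows "\<exists>B>0. \<forall>x. \<bar>\<phi> x\<bar> \<le> B"
proof -
  obtain K where K: "compact K" "\<And>x. x \<notin> K \<Longrightarrow> \<phi> x = 0"
    using test_fun_support[OF assms(1)] by blast
  have "compact (\<phi> ` K)"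
    using K(1) assms by (intro compact_continuous_image) (auto intro: smooth_continuous_on test_fun_smooth)
  then obtain B where "B > 0" "\<forall>y\<in>\<phi> ` K. norm y \<le> B"
    by (meson bounded_pos compact_imp_bounded)
  moreover from this have "\<bar>\<phi> x\<bar> \<le> B" for x
    using K(2)[of x] by (cases "x \<in> K") auto
  ultimately show ?thesis by blast
qed

lemma integrable_continuous_compact_support:
  fixes f :: "'a::euclidean_space \<Rightarrow> real"
  assumes "continuous_on UNIV f" "compact K" "\<And>x. x \<notin> K \<Longrightarrow> f x = 0"
  shows "integrable lborel f"
proof -
  have "(\<lambda>x. indicator K x *\<^sub>R f x) = f"
    using assms(3) by (auto simp: indicator_def fun_eq_iff)
  moreover have "integrable lborel (\<lambda>x. indicator K x *\<^sub>R f x)"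
    using assms by (intro borel_integrable_compact) (auto intro: continuous_on_subset)
  ultimately show ?thesis by simp
qed

lemma test_fun_integrable: "test_fun \<Omega> \<phi> \<Longrightarrow> integrable lborel \<phi>"
  using test_fun_support[of \<Omega> \<phi>] test_fun_smooth[of \<Omega> \<phi>] smooth_continuous_on[of \<phi>]
    integrable_continuous_compact_support[of \<phi>] by metis

lemma ex_mollifier:
  assumes "\<epsilon> > (0::real)"
  shows "\<exists>K::real^'n::finite \<Rightarrow> real. smooth K \<and> (\<forall>x. 0 \<le> K x) \<and> (\<forall>x. norm x \<ge> \<epsilon> \<longrightarrow> K x = 0) \<and>
    (\<integral>x. K x \<partial>lborel) = 1"
proof -
  \<comment> \<open>\<open>b\<close> is supported in a cube. With this scaling, \<open>k x\<close>
    nonzero forces every coordinate of \<open>x\<close> below \<epsilon> / n, hence their sum and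
    the Euclidean norm below \<epsilon>.\<close>
  define c where "c = real CARD('n) / \<epsilon>"
  have c: "c > 0" using assms by (simp add: c_def)
  define b where "b x = (\<Prod>i\<in>UNIV. exp_inv 0 (1 + x $ i) * exp_inv 0 (1 - x $ i))" for x :: "real^'n"
  define k where "k x = b (c *\<^sub>R x)" for x
  have b: "smooth b" unfolding b_def
    using smooth_prod_bump_class[where f = "\<lambda>i::'n. \<lambda>t. 1 * (exp_inv 0 (1 + t) * exp_inv 0 (1 - t))"]
      bump_class.base[of 1 0 0] by simp
  have k: "smooth k"
    using smooth_affine[OF b, of 1 c 0] by (simp add: k_def[abs_def])
  have k0: "k x \<ge> 0" for x
    by (auto simp: k_def b_def exp_inv_def intro!: prod_nonneg)
  have zero: "k x = 0" if "norm x \<ge> \<epsilon>" for x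
  proof (rule ccontr)
    assume "k x \<noteq> 0"
    then have "\<bar>c * x $ i\<bar> < 1" for i
      by (auto simp: k_def b_def exp_inv_def split: if_splits) (smt (verit))
    then have "\<bar>x $ i\<bar> < \<epsilon> / real CARD('n)" for i
      using c assms by (simp add: c_def abs_mult field_simps)
    then have "(\<Sum>i\<in>UNIV. \<bar>x $ i\<bar>) < (\<Sum>i\<in>(UNIV::'n set). \<epsilon> / real CARD('n))"
      by (intro sum_strict_mono) auto
    then show False using norm_le_l1_cart[of x] that by simp
  qed
  have int: "integrable lborel k"
    by (rule integrable_continuous_compact_support[of _ "cball 0 \<epsilon>"])
      (use zero k in \<open>auto intro: smooth_continuous_on\<close>)
  \<comment> \<open>A vanishing integral would make the open set where \<open>k\<close> is nonzero
    negligible, although it contains the origin.\<close>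
  have "(\<integral>x. k x \<partial>lborel) \<noteq> 0"
  proof
    assume "(\<integral>x. k x \<partial>lborel) = 0"
    then have "AE x in lborel. k x = 0"
      using integral_nonneg_eq_0_iff_AE[OF int] k0 by simp
    moreover have "{x. k x \<noteq> 0} \<in> sets borel"
      using smooth_borel_measurable[OF k] by measurable
    ultimately have "{x. k x \<noteq> 0} \<in> null_sets lborel"
      by (subst (asm) AE_iff_null) auto
    then have "negligible {x. k x \<noteq> 0}"
      by (simp add: negligible_iff_null_sets null_sets_completionI)
    moreover have "open {x. k x \<noteq> 0}"
      using smooth_continuous_on[OF k, of UNIV]
      by (simp add: continuous_on_open_vimage[of UNIV, simplified] open_Collect_neq)
    moreover have "k 0 \<noteq> 0" by (simp add: k_def b_def exp_inv_def)
    ultimately show False using open_not_negligible[of "{x. k x \<noteq> 0}"] by blast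
  qed
  then have pos: "(\<integral>x. k x \<partial>lborel) > 0"
    using Bochner_Integration.integral_nonneg[of lborel k] k0 by (simp add: order_less_le)
  show ?thesis
  proof (intro exI[where x = "\<lambda>x. inverse (\<integral>x. k x \<partial>lborel) * k (1 *\<^sub>R x + 0)"] conjI)
    show "smooth (\<lambda>x. inverse (integral\<^sup>L lborel k) * k (1 *\<^sub>R x + 0))"
      by (rule smooth_affine[OF k])
  qed (use pos k0 zero in auto)
qed

text \<open>One kernel is fixed for each \<epsilon>, so that quantities computed from it, such as
  the integral of its absolute partial derivatives, depend only on \<epsilon> and the dimension. The
  gradients of the cutoffs are bounded by them.\<close>

definition mollifier :: "real \<Rightarrow> real^'n::finite \<Rightarrow> real" where
  "mollifier \<epsilon> = (SOME K. smooth K \<and> (\<forall>x. 0 \<le> K x) \<and> (\<forall>x. norm x \<ge> \<epsilon> \<longrightarrow> K x = 0) \<and>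
    (\<integral>x. K x \<partial>lborel) = 1)"

lemma mollifier:
  assumes "\<epsilon> > 0"
  shows smooth_mollifier: "smooth (mollifier \<epsilon>)"
    and mollifier_nonneg: "0 \<le> mollifier \<epsilon> x"
    and mollifier_eq_0: "norm x \<ge> \<epsilon> \<Longrightarrow> mollifier \<epsilon> x = 0"
    and integral_mollifier: "(\<integral>x. mollifier \<epsilon> x \<partial>lborel) = 1"
  using someI_ex[OF ex_mollifier[OF assms]] unfolding mollifier_def[symmetric] by auto

lemma test_fun_mollifier: "\<epsilon> > 0 \<Longrightarrow> test_fun UNIV (mollifier \<epsilon>)"
  by (rule test_funI[of _ "cball 0 \<epsilon>"]) (auto simp: smooth_mollifier mollifier_eq_0)

subsection \<open>Convolution\<close>

definition conv :: "(real^'n::finite \<Rightarrow> real) \<Rightarrow> (real^'n \<Rightarrow> real) \<Rightarrow> real^'n \<Rightarrow> real" where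
  "conv f \<phi> x = (\<integral>y. f y * \<phi> (x - y) \<partial>lborel)"

lemma integrable_mult_bounded:
  fixes f g :: "'a \<Rightarrow> real"
  assumes "integrable M f" "g \<in> borel_measurable M" "AE x in M. \<bar>g x\<bar> \<le> B"
  shows "integrable M (\<lambda>x. f x * g x)" "integrable M (\<lambda>x. g x * f x)"
proof -
  have "integrable M (\<lambda>x. B * f x)" using assms by auto
  then show "integrable M (\<lambda>x. f x * g x)"
    by (rule Bochner_Integration.integrable_bound)
      (use assms in \<open>auto simp: abs_mult elim!: eventually_mono intro: mult_mono\<close>,
       metis abs_ge_zero abs_ge_self mult.commute mult_right_mono order_trans)
  then show "integrable M (\<lambda>x. g x * f x)" by (simp add: mult.commute)
qed

lemma conv_integrand_integrable:
  assumes "integrable lborel f" "test_fun \<Omega> \<phi>"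
  shows "integrable lborel (\<lambda>y. f y * \<phi> (x - y))"
proof -
  have [measurable]: "\<phi> \<in> borel_measurable borel"
    using assms smooth_borel_measurable test_fun_smooth by blast
  obtain B where "\<And>x. \<bar>\<phi> x\<bar> \<le> B" using test_fun_bounded[OF assms(2)] by blast
  then show ?thesis
    by (intro integrable_mult_bounded[OF assms(1), where B = B]) auto
qed

lemma uniformly_continuous_compact_support:
  fixes f :: "'a::euclidean_space \<Rightarrow> real"
  assumes "continuous_on UNIV f" "\<And>x. norm x > r \<Longrightarrow> f x = 0" "e > 0"
  obtains d where "d > 0" "\<And>x y. norm (x - y) < d \<Longrightarrow> \<bar>f x - f y\<bar> < e"
proof -
  have "uniformly_continuous_on (cball 0 (r+1)) f"
    by (intro compact_uniformly_continuous) (auto intro: continuous_on_subset assms(1))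
  then obtain d where d: "d > 0" "\<And>x y. x \<in> cball 0 (r+1) \<Longrightarrow> y \<in> cball 0 (r+1) \<Longrightarrow>
      dist x y < d \<Longrightarrow> dist (f x) (f y) < e"
    unfolding uniformly_continuous_on_def using assms(3) by metis
  show ?thesis
  proof
    \<comment> \<open>The bound 1 matters when one of the points leaves
      \<open>cball 0 (r+1)\<close>: both then lie outside the ball of radius \<open>r\<close>, where
      \<open>f\<close> vanishes.\<close>
    show "min d 1 > 0" using d by simp
    fix x y :: 'a assume xy: "norm (x - y) < min d 1"
    show "\<bar>f x - f y\<bar> < e"
    proof (cases "norm x \<le> r + 1 \<and> norm y \<le> r + 1")
      case True
      then show ?thesis using d(2)[of x y] xy by (auto simp: dist_norm)
    next
      case False
      then have "norm x > r" "norm y > r"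
        using xy norm_triangle_ineq2[of x y] norm_triangle_ineq2[of y x]
        by (auto simp: norm_minus_commute)
      then show ?thesis using assms by simp
    qed
  qed
qed

text \<open>The partial derivatives are uniformly continuous by compactness of the support, so the
  first-order remainder is small uniformly in \<open>x\<close>. This uniformity is what permits
  differentiation under a convolution integral.\<close>

lemma test_fun_taylor:
  fixes \<phi> :: "real^'n::finite \<Rightarrow> real"
  assumes "test_fun \<Omega> \<phi>" "e > 0"
  shows "\<exists>d>0. \<forall>x h. norm h < d \<longrightarrow>
      \<bar>\<phi> (x + h) - \<phi> x - (\<Sum>i\<in>UNIV. h $ i * partial_deriv i \<phi> x)\<bar> \<le> e * norm h"
proof -
  define e' where "e' = e / real CARD('n)"
  have "\<exists>d>0. \<forall>x y. norm (x - y) < d \<longrightarrow> \<bar>partial_deriv i \<phi> x - partial_deriv i \<phi> y\<bar> < e'" for i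
  proof -
    have T: "test_fun \<Omega> (partial_deriv i \<phi>)" using assms test_fun_partial_deriv by blast
    obtain r where "\<And>x. norm x > r \<Longrightarrow> partial_deriv i \<phi> x = 0"
        using test_fun_ball[OF T] by metis
    then show ?thesis
      using uniformly_continuous_compact_support[of "partial_deriv i \<phi>" r e']
        smooth_continuous_on[OF test_fun_smooth[OF T]] assms(2) unfolding e'_def
      by (metis divide_pos_pos of_nat_0_less_iff zero_less_card_finite)
  qed
  then obtain D where D: "\<And>i. D i > 0"
    "\<And>i x y. norm (x - y) < D i \<Longrightarrow> \<bar>partial_deriv i \<phi> x - partial_deriv i \<phi> y\<bar> < e'"
    by metis
  define d where "d = Min (range D)"
  have d: "d > 0" using D(1) by (simp add: d_def)
  have d': "\<bar>partial_deriv i \<phi> x - partial_deriv i \<phi> y\<bar> < e'" if "norm (x - y) < d" for i x y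
    using that by (intro D(2)) (auto simp: d_def)
  show ?thesis
  proof (intro exI conjI allI impI)
    fix x h :: "real^'n" assume h: "norm h < d"
    let ?D = "\<lambda>y h. \<Sum>i\<in>UNIV. h $ i * partial_deriv i \<phi> y"
    have "norm (\<phi> (x + h) - \<phi> x - ?D x (x + h - x)) \<le> norm (x + h - x) * e"
    proof (rule differentiable_bound_linearization[where S = "ball x d"])
      fix t :: real assume t: "t \<in> {0..1}"
      have "norm (t *\<^sub>R h) \<le> norm h"
        using t by (auto intro: mult_left_le_one_le)
      then show "x + t *\<^sub>R (x + h - x) \<in> ball x d"
        using h by (simp add: dist_norm)
    next
      fix y assume y: "y \<in> ball x d"
      show "(\<phi> has_derivative ?D y) (at y within ball x d)"
        by (rule has_derivative_at_withinI[OF smooth_has_derivative[OF test_fun_smooth[OF assms(1)]]])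
      show "onorm (?D y - ?D x) \<le> e"
      proof (rule onorm_bound)
        fix k :: "real^'n"
        have "norm ((?D y - ?D x) k) = \<bar>\<Sum>i\<in>UNIV. k $ i * (partial_deriv i \<phi> y - partial_deriv i \<phi> x)\<bar>"
          by (simp add: sum_subtractf right_diff_distrib)
        also have "\<dots> \<le> (\<Sum>i\<in>(UNIV::'n set). norm k * e')"
          by (rule order_trans[OF sum_abs], rule sum_mono)
            (use less_imp_le[OF d'[of y x]] y component_le_norm_cart[of k] in
              \<open>auto simp: abs_mult dist_norm norm_minus_commute intro!: mult_mono\<close>)
        also have "\<dots> = e * norm k" by (simp add: e'_def)
        finally show "norm ((?D y - ?D x) k) \<le> e * norm k" .
      qed (use assms in simp)
    qed (use d in auto)
    then show "\<bar>\<phi> (x + h) - \<phi> x - (\<Sum>i\<in>UNIV. h $ i * partial_deriv i \<phi> x)\<bar> \<le> e * norm h"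
      by (simp add: mult.commute)
  qed (rule d)
qed

lemma conv_has_derivative:
  fixes \<phi> :: "real^'n::finite \<Rightarrow> real"
  assumes f: "integrable lborel f" and \<phi>: "test_fun \<Omega> \<phi>"
  shows "(conv f \<phi> has_derivative (\<lambda>h. \<Sum>i\<in>UNIV. h $ i * conv f (partial_deriv i \<phi>) x)) (at x)"
  unfolding has_derivative_at_alt
proof (intro conjI allI impI)
  show "bounded_linear (\<lambda>h. \<Sum>i\<in>UNIV. h $ i * conv f (partial_deriv i \<phi>) x)"
    by (intro bounded_linear_sum bounded_linear_mult_const bounded_linear_vec_nth)
  fix e :: real assume e: "e > 0"
  define A where "A = (\<integral>y. \<bar>f y\<bar> \<partial>lborel)"
  have A: "A \<ge> 0" by (simp add: A_def)
  \<comment> \<open>After integration against the absolute value of \<open>f\<close>, whose integral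
    is \<open>A\<close>, the tolerance \<open>e / (A + 1)\<close> becomes at most \<open>e\<close>;
    the added 1 covers \<open>A = 0\<close>.\<close>
  obtain d where d: "d > 0" "\<And>x h. norm h < d \<Longrightarrow>
      \<bar>\<phi> (x + h) - \<phi> x - (\<Sum>i\<in>UNIV. h $ i * partial_deriv i \<phi> x)\<bar> \<le> (e / (A + 1)) * norm h"
    using test_fun_taylor[OF \<phi>, of "e / (A + 1)"] e A by auto
  have I: "integrable lborel (\<lambda>y. f y * \<phi> (x - y))"
      "integrable lborel (\<lambda>y. f y * partial_deriv i \<phi> (x - y))" for x i
    by (rule conv_integrand_integrable[OF f \<phi>]) (rule conv_integrand_integrable[OF f test_fun_partial_deriv[OF \<phi>]])
  show "\<exists>d>0. \<forall>y. norm (y - x) < d \<longrightarrow>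
      norm (conv f \<phi> y - conv f \<phi> x - (\<Sum>i\<in>UNIV. (y - x) $ i * conv f (partial_deriv i \<phi>) x))
      \<le> e * norm (y - x)"
  proof (intro exI conjI allI impI)
    fix y assume y: "norm (y - x) < d"
    let ?r = "\<lambda>w. \<phi> (y - w) - \<phi> (x - w) - (\<Sum>i\<in>UNIV. (y - x) $ i * partial_deriv i \<phi> (x - w))"
    have Ir: "integrable lborel (\<lambda>w. f w * \<phi> (y - w) - f w * \<phi> (x - w) -
        (\<Sum>i\<in>UNIV. (y - x) $ i * (f w * partial_deriv i \<phi> (x - w))))"
      using I by auto
    have "conv f \<phi> y - conv f \<phi> x - (\<Sum>i\<in>UNIV. (y - x) $ i * conv f (partial_deriv i \<phi>) x)
      = (\<integral>w. f w * \<phi> (y - w) - f w * \<phi> (x - w) -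
        (\<Sum>i\<in>UNIV. (y - x) $ i * (f w * partial_deriv i \<phi> (x - w))) \<partial>lborel)"
      unfolding conv_def using I by (simp add: Bochner_Integration.integral_sum)
    also have "norm \<dots> \<le> (\<integral>w. \<bar>f w\<bar> * ((e / (A + 1)) * norm (y - x)) \<partial>lborel)"
    proof (rule order_trans[OF integral_norm_bound])
      show "(\<integral>w. norm (f w * \<phi> (y - w) - f w * \<phi> (x - w) -
        (\<Sum>i\<in>UNIV. (y - x) $ i * (f w * partial_deriv i \<phi> (x - w)))) \<partial>lborel)
        \<le> (\<integral>w. \<bar>f w\<bar> * ((e / (A + 1)) * norm (y - x)) \<partial>lborel)"
      proof (rule integral_mono[OF integrable_norm[OF Ir]])
        show "integrable lborel (\<lambda>w. \<bar>f w\<bar> * ((e / (A + 1)) * norm (y - x)))"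
          by (intro integrable_mult_left integrable_abs f)
        fix w
        have "f w * \<phi> (y - w) - f w * \<phi> (x - w) -
          (\<Sum>i\<in>UNIV. (y - x) $ i * (f w * partial_deriv i \<phi> (x - w))) = f w * ?r w"
          by (simp add: right_diff_distrib sum_distrib_left mult_ac)
        moreover have "\<bar>?r w\<bar> \<le> (e / (A + 1)) * norm (y - x)"
          using d(2)[OF y, of "x - w"] by (simp add: algebra_simps)
        ultimately show "norm (f w * \<phi> (y - w) - f w * \<phi> (x - w) -
          (\<Sum>i\<in>UNIV. (y - x) $ i * (f w * partial_deriv i \<phi> (x - w))))
          \<le> \<bar>f w\<bar> * ((e / (A + 1)) * norm (y - x))"
          by (simp only: real_norm_def abs_mult) (intro mult_left_mono, auto)
      qed
    qed
    also have "\<dots> = A / (A + 1) * (e * norm (y - x))"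
      by (simp add: A_def mult_ac)
    also have "\<dots> \<le> 1 * (e * norm (y - x))"
      using A e by (intro mult_right_mono) auto
    finally show "norm (conv f \<phi> y - conv f \<phi> x - (\<Sum>i\<in>UNIV. (y - x) $ i * conv f (partial_deriv i \<phi>) x))
      \<le> e * norm (y - x)" by simp
  qed (rule d(1))
qed

lemma partial_deriv_conv:
  assumes "integrable lborel f" "test_fun \<Omega> \<phi>"
  shows "partial_deriv i (conv f \<phi>) = conv f (partial_deriv i \<phi>)"
  using partial_deriv_eq[OF conv_has_derivative[OF assms]]
  by (auto simp: fun_eq_iff axis_def if_distrib if_distribR cong: if_cong)

lemma smooth_conv:
  assumes "integrable lborel f" "test_fun \<Omega> \<phi>"
  shows "smooth (conv f \<phi>)"
proof (rule smooth_coinduct[where P = "\<lambda>\<psi>. \<exists>\<phi>. test_fun \<Omega> \<phi> \<and> \<psi> = conv f \<phi>"])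
  fix \<psi> assume "\<exists>\<phi>. test_fun \<Omega> \<phi> \<and> \<psi> = conv f \<phi>"
  then obtain \<phi> where \<phi>: "test_fun \<Omega> \<phi>" "\<psi> = conv f \<phi>" by auto
  have "\<psi> differentiable (at x)" for x
    using conv_has_derivative[OF assms(1) \<phi>(1)] \<phi>(2) differentiable_def by blast
  moreover have "partial_deriv i \<psi> = conv f (partial_deriv i \<phi>)" for i
    using partial_deriv_conv[OF assms(1) \<phi>(1)] \<phi>(2) by blast
  ultimately show "(\<forall>x. \<psi> differentiable at x) \<and>
      (\<forall>i. \<exists>\<phi>. test_fun \<Omega> \<phi> \<and> partial_deriv i \<psi> = conv f \<phi>)"
    using test_fun_partial_deriv[OF \<phi>(1)] by blast
qed (use assms in blast)

lemma conv_eq_0: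
  assumes "\<And>y. f y \<noteq> 0 \<Longrightarrow> \<phi> (x - y) = 0"
  shows "conv f \<phi> x = 0"
proof -
  have "(\<lambda>y. f y * \<phi> (x - y)) = (\<lambda>y. 0)" using assms by fastforce
  then show ?thesis by (simp add: conv_def)
qed

lemma distr_lborel_minus:
  fixes x :: "'a::euclidean_space"
  shows "distr lborel borel (\<lambda>y. x - y) = lborel" "distr lborel borel (\<lambda>y. y - x) = lborel"
proof -
  show "distr lborel borel (\<lambda>y. x - y) = lborel"
    by (subst (2) lborel_affine[of "-1" x]) (auto simp: density_1)
  show "distr lborel borel (\<lambda>y. y - x) = lborel"
    by (subst (2) lborel_affine[of 1 "-x"]) (auto simp: density_1)
qed

lemma lborel_integral_reflect:
  fixes f :: "'a::euclidean_space \<Rightarrow> real"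
  assumes [measurable]: "f \<in> borel_measurable borel"
  shows "(\<integral>y. f (x - y) \<partial>lborel) = (\<integral>y. f y \<partial>lborel)"
    and "integrable lborel (\<lambda>y. f (x - y)) \<longleftrightarrow> integrable lborel f"
  using integral_distr[of "\<lambda>y. x - y" lborel borel f] integrable_distr_eq[of "\<lambda>y. x - y" lborel borel f]
  by (simp_all add: distr_lborel_minus)

lemma integral_mollifier_reflect:
  "\<epsilon> > 0 \<Longrightarrow> (\<integral>y. mollifier \<epsilon> (x - y) \<partial>lborel) = 1"
  using lborel_integral_reflect(1)[of "mollifier \<epsilon>"] integral_mollifier
    smooth_borel_measurable[OF smooth_mollifier] by metis

lemma integrable_mollifier_reflect:
  "\<epsilon> > 0 \<Longrightarrow> integrable lborel (\<lambda>y. mollifier \<epsilon> (x - y))"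
  using lborel_integral_reflect(2)[of "mollifier \<epsilon>"] test_fun_integrable[OF test_fun_mollifier]
    smooth_borel_measurable[OF smooth_mollifier] by metis

subsection \<open>Smooth cutoff functions\<close>

lemma indicator_bounded_integrable:
  fixes A :: "'a::euclidean_space set"
  assumes "A \<in> sets borel" "bounded A"
  shows "integrable lborel (indicator A :: 'a \<Rightarrow> real)"
  using assms emeasure_bounded_finite[of A] by (simp add: integrable_indicator_iff)

text \<open>Mollified indicators serve as cutoffs. The derivative falls on the kernel, so the
  gradient bound does not involve \<open>A\<close>; cutoffs of balls of arbitrary radius thus share
  one bound.\<close>

lemma conv_indicator_mollifier:
  fixes A :: "(real^'n::finite) set"
  assumes A: "A \<in> sets borel" "bounded A" and \<epsilon>: "\<epsilon> > 0"
  defines "\<phi> \<equiv> conv (indicator A) (mollifier \<epsilon>)"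
  shows "smooth \<phi>" "\<And>x. 0 \<le> \<phi> x" "\<And>x. \<phi> x \<le> 1"
    "\<And>x. ball x \<epsilon> \<subseteq> A \<Longrightarrow> \<phi> x = 1" "\<And>x. ball x \<epsilon> \<inter> A = {} \<Longrightarrow> \<phi> x = 0"
    "\<And>i x. \<bar>partial_deriv i \<phi> x\<bar> \<le> (\<integral>y. \<bar>partial_deriv i (mollifier \<epsilon>) y\<bar> \<partial>lborel)"
proof -
  have I: "integrable lborel (indicator A :: real^'n \<Rightarrow> real)"
    using indicator_bounded_integrable A by blast
  note T = test_fun_mollifier[OF \<epsilon>]
  show "smooth \<phi>" unfolding \<phi>_def by (rule smooth_conv[OF I T])
  show "0 \<le> \<phi> x" for x
    unfolding \<phi>_def conv_def by (intro Bochner_Integration.integral_nonneg) (auto simp: mollifier_nonneg \<epsilon>)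
  have le: "\<phi> x \<le> (\<integral>y. mollifier \<epsilon> (x - y) \<partial>lborel)" for x
    unfolding \<phi>_def conv_def
    by (intro integral_mono conv_integrand_integrable[OF I T] integrable_mollifier_reflect \<epsilon>)
      (auto simp: indicator_def mollifier_nonneg \<epsilon>)
  then show "\<phi> x \<le> 1" for x by (simp add: integral_mollifier_reflect \<epsilon>)
  show "\<phi> x = 1" if "ball x \<epsilon> \<subseteq> A" for x
  proof -
    have "indicator A y * mollifier \<epsilon> (x - y) = mollifier \<epsilon> (x - y)" for y
      using that mollifier_eq_0[OF \<epsilon>, of "x - y"] by (cases "y \<in> ball x \<epsilon>") (auto simp: dist_norm)
    then have "\<phi> x = (\<integral>y. mollifier \<epsilon> (x - y) \<partial>lborel)"
      by (simp only: \<phi>_def conv_def)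
    then show ?thesis by (simp add: integral_mollifier_reflect \<epsilon>)
  qed
  show "\<phi> x = 0" if "ball x \<epsilon> \<inter> A = {}" for x
    unfolding \<phi>_def
  proof (intro conv_eq_0 mollifier_eq_0[OF \<epsilon>])
    fix y assume "indicator A y \<noteq> (0::real)"
    then have "y \<notin> ball x \<epsilon>" using that by (auto simp: indicator_def split: if_splits)
    then show "\<epsilon> \<le> norm (x - y)" by (simp add: dist_norm)
  qed
  show "\<bar>partial_deriv i \<phi> x\<bar> \<le> (\<integral>y. \<bar>partial_deriv i (mollifier \<epsilon>) y\<bar> \<partial>lborel)" for i x
  proof -
    let ?k = "partial_deriv i (mollifier \<epsilon> :: real^'n \<Rightarrow> real)"
    have Tk: "test_fun UNIV ?k" by (rule test_fun_partial_deriv[OF T])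
    have [measurable]: "?k \<in> borel_measurable borel"
      using Tk smooth_borel_measurable test_fun_smooth by blast
    have *: "(\<integral>y. \<bar>?k (x - y)\<bar> \<partial>lborel) = (\<integral>y. \<bar>?k y\<bar> \<partial>lborel)"
      by (rule lborel_integral_reflect(1)[of "\<lambda>y. \<bar>?k y\<bar>"]) auto
    have Ia: "integrable lborel (\<lambda>y. \<bar>?k (x - y)\<bar>)"
      using test_fun_integrable[OF Tk] lborel_integral_reflect(2)[of ?k x] by (intro integrable_abs) simp
      have "\<bar>partial_deriv i \<phi> x\<bar> = \<bar>\<integral>y. indicator A y * ?k (x - y) \<partial>lborel\<bar>"
        by (simp add: \<phi>_def partial_deriv_conv[OF I T] conv_def)
      also have "\<dots> \<le> (\<integral>y. \<bar>indicator A y * ?k (x - y)\<bar> \<partial>lborel)"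
        by (rule integral_abs_bound)
      also have "\<dots> \<le> (\<integral>y. \<bar>?k (x - y)\<bar> \<partial>lborel)"
        by (intro integral_mono integrable_abs conv_integrand_integrable[OF I Tk] Ia)
          (auto simp: indicator_def)
      finally show ?thesis using * by simp
  qed
qed

subsection \<open>Mollification in \<open>L\<^sup>2\<close>\<close>

lemma integrable_power2_diff:
  fixes f g :: "'a \<Rightarrow> real"
  assumes [measurable]: "f \<in> borel_measurable M" "g \<in> borel_measurable M"
    and "integrable M (\<lambda>x. (f x)\<^sup>2)" "integrable M (\<lambda>x. (g x)\<^sup>2)"
  shows "integrable M (\<lambda>x. (f x - g x)\<^sup>2)" "integrable M (\<lambda>x. (f x + g x)\<^sup>2)"
    "integrable M (\<lambda>x. f x * g x)"
proof -
  have *: "integrable M (\<lambda>x. 2 * (f x)\<^sup>2 + 2 * (g x)\<^sup>2)" using assms by auto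
  show "integrable M (\<lambda>x. (f x - g x)\<^sup>2)"
    by (rule Bochner_Integration.integrable_bound[OF *])
      (auto intro!: AE_I2, smt (verit, best) power2_diff power2_sum zero_le_power2)
  show "integrable M (\<lambda>x. (f x + g x)\<^sup>2)"
    by (rule Bochner_Integration.integrable_bound[OF *])
      (auto intro!: AE_I2, smt (verit, best) power2_diff power2_sum zero_le_power2)
  show "integrable M (\<lambda>x. f x * g x)"
  proof (rule Bochner_Integration.integrable_bound[OF *])
    have "\<bar>f x * g x\<bar> \<le> 2 * (f x)\<^sup>2 + 2 * (g x)\<^sup>2" for x
      using zero_le_power2[of "f x - g x"] zero_le_power2[of "f x + g x"]
        zero_le_power2[of "f x"] zero_le_power2[of "g x"]
      unfolding power2_diff power2_sum by (simp only: abs_le_iff) argo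
    then show "AE x in M. norm (f x * g x) \<le> norm (2 * (f x)\<^sup>2 + 2 * (g x)\<^sup>2)"
      by (auto intro!: AE_I2 order_trans[OF _ abs_ge_self])
  qed simp
qed

lemma integrable_of_power2_bounded_support:
  fixes f :: "'a::euclidean_space \<Rightarrow> real"
  assumes [measurable]: "f \<in> borel_measurable borel"
    and f: "integrable lborel (\<lambda>x. (f x)\<^sup>2)" and 0: "\<And>x. norm x > r \<Longrightarrow> f x = 0"
  shows "integrable lborel f"
proof -
  have I: "integrable lborel (\<lambda>x. (f x)\<^sup>2 + indicator (cball 0 r) x)"
    by (intro Bochner_Integration.integrable_add f indicator_bounded_integrable) auto
  show ?thesis
  proof (rule Bochner_Integration.integrable_bound[OF I])
    have "\<bar>f x\<bar> \<le> (f x)\<^sup>2 + indicator (cball 0 r) x" for x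
    proof (cases "norm x > r")
      case False
      have "0 \<le> (\<bar>f x\<bar> - 1)\<^sup>2" by simp
      then have "\<bar>f x\<bar> \<le> (f x)\<^sup>2 + 1" unfolding power2_diff by (simp; linarith)
      with False show ?thesis by simp
    qed (use 0 in auto)
    then show "AE x in lborel. norm (f x) \<le> norm ((f x)\<^sup>2 + indicator (cball 0 r) x)"
      by (auto intro!: AE_I2 order_trans[OF _ abs_ge_self])
  qed auto
qed

text \<open>Tonelli's theorem and translation invariance: the inner integral of the kernel is 1. The
  lemma is applied to the square of a function.\<close>

lemma conv_mollifier_nonneg_integral:
  fixes g :: "real^'n::finite \<Rightarrow> real"
  assumes g: "integrable lborel g" "\<And>x. g x \<ge> 0" and \<epsilon>: "\<epsilon> > 0"
    and [measurable]: "g \<in> borel_measurable borel"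
  shows "integrable lborel (conv g (mollifier \<epsilon>))"
    "(\<integral>x. conv g (mollifier \<epsilon>) x \<partial>lborel) = (\<integral>x. g x \<partial>lborel)"
proof -
  let ?K = "mollifier \<epsilon> :: real^'n \<Rightarrow> real"
  note T = test_fun_mollifier[OF \<epsilon>]
  have [measurable]: "?K \<in> borel_measurable borel"
    by (rule smooth_borel_measurable[OF smooth_mollifier[OF \<epsilon>]])
  have nn: "conv g ?K x \<ge> 0" for x
    unfolding conv_def by (intro Bochner_Integration.integral_nonneg) (auto simp: g mollifier_nonneg \<epsilon>)
  have m: "conv g ?K \<in> borel_measurable borel"
    by (rule smooth_borel_measurable[OF smooth_conv[OF g(1) T]])
  have "(\<integral>\<^sup>+x. ennreal (conv g ?K x) \<partial>lborel) = (\<integral>\<^sup>+x. \<integral>\<^sup>+y. ennreal (g y * ?K (x - y)) \<partial>lborel \<partial>lborel)"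
    unfolding conv_def
    by (intro nn_integral_cong nn_integral_eq_integral[symmetric] conv_integrand_integrable[OF g(1) T])
      (auto simp: g mollifier_nonneg \<epsilon>)
  also have "\<dots> = (\<integral>\<^sup>+y. \<integral>\<^sup>+x. ennreal (g y * ?K (x - y)) \<partial>lborel \<partial>lborel)"
    by (rule lborel_pair.Fubini') measurable
  also have "\<dots> = (\<integral>\<^sup>+y. ennreal (g y) \<partial>lborel)"
  proof (intro nn_integral_cong)
    fix y
    have "(\<integral>\<^sup>+x. ennreal (?K (x - y)) \<partial>lborel) = (\<integral>\<^sup>+x. ennreal (?K x) \<partial>distr lborel borel (\<lambda>x. x - y))"
      by (subst nn_integral_distr) auto
    also have "\<dots> = ennreal (\<integral>x. ?K x \<partial>lborel)"
      unfolding distr_lborel_minus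
      by (intro nn_integral_eq_integral test_fun_integrable[OF T]) (auto simp: mollifier_nonneg \<epsilon>)
    finally have "(\<integral>\<^sup>+x. ennreal (?K (x - y)) \<partial>lborel) = 1" by (simp add: integral_mollifier \<epsilon>)
    then show "(\<integral>\<^sup>+x. ennreal (g y * ?K (x - y)) \<partial>lborel) = ennreal (g y)"
      by (simp add: ennreal_mult g mollifier_nonneg \<epsilon> nn_integral_cmult)
  qed
  also have "\<dots> = ennreal (\<integral>y. g y \<partial>lborel)"
    by (intro nn_integral_eq_integral g) (auto simp: g)
  finally have *: "(\<integral>\<^sup>+x. ennreal (conv g ?K x) \<partial>lborel) = ennreal (\<integral>y. g y \<partial>lborel)" .
  show "integrable lborel (conv g ?K)"
    using m nn * by (intro integrableI_nonneg) auto
  show "(\<integral>x. conv g ?K x \<partial>lborel) = (\<integral>x. g x \<partial>lborel)"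
    using * m nn g by (subst integral_eq_nn_integral) auto
qed

lemma conv_diff:
  assumes "integrable lborel f" "integrable lborel g" "test_fun \<Omega> \<phi>"
  shows "conv (\<lambda>x. f x - g x) \<phi> x = conv f \<phi> x - conv g \<phi> x"
  unfolding conv_def
  using conv_integrand_integrable[OF assms(1,3)] conv_integrand_integrable[OF assms(2,3)]
  by (simp add: left_diff_distrib)

text \<open>Jensen's inequality for the probability density
  \<open>mollifier \<epsilon> (x - y)\<close> in \<open>y\<close>, followed by preservation of mass
  for the square of \<open>f\<close>.\<close>

lemma conv_mollifier_contraction:
  fixes f :: "real^'n::finite \<Rightarrow> real"
  assumes f: "integrable lborel f" "integrable lborel (\<lambda>x. (f x)\<^sup>2)" and \<epsilon>: "\<epsilon> > 0"
    and [measurable]: "f \<in> borel_measurable borel"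
  shows "integrable lborel (\<lambda>x. (conv f (mollifier \<epsilon>) x)\<^sup>2)"
    "(\<integral>x. (conv f (mollifier \<epsilon>) x)\<^sup>2 \<partial>lborel) \<le> (\<integral>x. (f x)\<^sup>2 \<partial>lborel)"
proof -
  let ?K = "mollifier \<epsilon> :: real^'n \<Rightarrow> real"
  note T = test_fun_mollifier[OF \<epsilon>]
  have [measurable]: "?K \<in> borel_measurable borel"
    by (rule smooth_borel_measurable[OF smooth_mollifier[OF \<epsilon>]])
  have [measurable]: "conv f ?K \<in> borel_measurable borel"
    by (rule smooth_borel_measurable[OF smooth_conv[OF f(1) T]])
  have le: "(conv f ?K x)\<^sup>2 \<le> conv (\<lambda>x. (f x)\<^sup>2) ?K x" for x
  proof -
    define c where "c = conv f ?K x"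
    have I: "integrable lborel (\<lambda>y. (f y)\<^sup>2 * ?K (x - y))" "integrable lborel (\<lambda>y. f y * ?K (x - y))"
      "integrable lborel (\<lambda>y. ?K (x - y))"
      by (intro conv_integrand_integrable[OF f(1) T] conv_integrand_integrable[OF f(2) T]
          integrable_mollifier_reflect \<epsilon>)+
    \<comment> \<open>Jensen's inequality in elementary form: the weighted variance of
      \<open>f\<close> about its weighted mean \<open>c\<close> is nonnegative.\<close>
    have "0 \<le> (\<integral>y. (f y - c)\<^sup>2 * ?K (x - y) \<partial>lborel)"
      by (intro Bochner_Integration.integral_nonneg) (auto simp: mollifier_nonneg \<epsilon>)
    also have "\<dots> = (\<integral>y. (f y)\<^sup>2 * ?K (x - y) - (2 * c) * (f y * ?K (x - y)) + c\<^sup>2 * ?K (x - y) \<partial>lborel)"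
      by (intro Bochner_Integration.integral_cong) (auto simp: power2_diff algebra_simps)
    also have "\<dots> = conv (\<lambda>x. (f x)\<^sup>2) ?K x - 2 * c * c + c\<^sup>2"
    proof -
      have "conv (\<lambda>x. (f x)\<^sup>2) ?K x = (\<integral>y. (f y)\<^sup>2 * ?K (x - y) \<partial>lborel)"
        and "c = (\<integral>y. f y * ?K (x - y) \<partial>lborel)" by (simp_all add: conv_def c_def)
      then show ?thesis
        using I by (simp add: integral_mollifier_reflect \<epsilon>)
    qed
    finally show ?thesis by (simp add: c_def power2_eq_square)
  qed
  note J = conv_mollifier_nonneg_integral[OF f(2) _ \<epsilon>]
  show I: "integrable lborel (\<lambda>x. (conv f ?K x)\<^sup>2)"
    by (rule Bochner_Integration.integrable_bound[OF J(1)]) (use le in \<open>auto intro: order_trans[OF _ abs_ge_self]\<close>)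
  have "(\<integral>x. (conv f ?K x)\<^sup>2 \<partial>lborel) \<le> (\<integral>x. conv (\<lambda>x. (f x)\<^sup>2) ?K x \<partial>lborel)"
    by (intro integral_mono I J le) auto
  also have "\<dots> = (\<integral>x. (f x)\<^sup>2 \<partial>lborel)" by (rule J) auto
  finally show "(\<integral>x. (conv f ?K x)\<^sup>2 \<partial>lborel) \<le> (\<integral>x. (f x)\<^sup>2 \<partial>lborel)" .
qed

text \<open>By definition, \<open>measurable_on\<close> supplies continuous functions converging to
  \<open>f\<close> off a negligible set. Clamping them to [-M, M] and multiplying by a continuous
  cutoff leaves the limit unchanged and provides a dominating function.\<close>

lemma L2_approx_continuous_bounded:
  fixes f :: "'a::euclidean_space \<Rightarrow> real"
  assumes [measurable]: "f \<in> borel_measurable borel"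
    and 0: "\<And>x. norm x > r \<Longrightarrow> f x = 0" and M: "\<And>x. \<bar>f x\<bar> \<le> M" and e: "e > 0"
  shows "\<exists>g. continuous_on UNIV g \<and> (\<forall>x. norm x > r + 1 \<longrightarrow> g x = 0) \<and> (\<integral>x. (f x - g x)\<^sup>2 \<partial>lborel) < e"
proof -
  have "f measurable_on UNIV"
    by (intro lebesgue_measurable_imp_measurable_on_real) (auto intro: measurable_completion)
  then obtain N g where N: "negligible N" and g: "\<And>n. continuous_on UNIV (g n)"
    "\<And>x. x \<notin> N \<Longrightarrow> (\<lambda>n. g n x) \<longlonglongrightarrow> f x"
    unfolding measurable_on_def by auto
  define c where "c x = max 0 (min 1 (r + 1 - norm x))" for x :: 'a
  define h where "h n x = c x * max (- M) (min M (g n x))" for n x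
  have M0: "M \<ge> 0" using M[of 0] by linarith
  have hc: "continuous_on UNIV (h n)" for n
    unfolding h_def c_def by (intro continuous_intros g(1))
  have h0: "h n x = 0" if "norm x > r + 1" for n x
    using that by (simp add: h_def c_def)
  have hlim: "(\<lambda>n. h n x) \<longlonglongrightarrow> f x" if "x \<notin> N" for x
  proof -
    have "(\<lambda>n. h n x) \<longlonglongrightarrow> c x * max (- M) (min M (f x))"
      unfolding h_def by (intro tendsto_intros g(2) that)
    moreover have "c x * max (- M) (min M (f x)) = f x"
      using M[of x] 0[of x] by (cases "norm x > r") (auto simp: c_def abs_le_iff max_def min_def)
    ultimately show ?thesis by simp
  qed
  have [measurable]: "h n \<in> borel_measurable borel" for n
    by (rule borel_measurable_continuous_onI[OF hc])
  have hM: "\<bar>h n x\<bar> \<le> M" for n x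
  proof -
    have "\<bar>h n x\<bar> \<le> 1 * M"
      unfolding h_def abs_mult using M0 by (intro mult_mono) (auto simp: c_def)
    then show ?thesis by simp
  qed
  have "(\<lambda>n. \<integral>x. (f x - h n x)\<^sup>2 \<partial>lborel) \<longlonglongrightarrow> (\<integral>x. 0 \<partial>(lborel :: 'a measure))"
  proof (rule integral_dominated_convergence)
    show "integrable lborel (\<lambda>x::'a. (2 * M)\<^sup>2 * indicator (cball 0 (r + 1)) x)"
      by (intro integrable_mult_right indicator_bounded_integrable) auto
    have "AE x in lebesgue. x \<notin> N" using N by (simp add: negligible_iff_null_sets AE_not_in)
    then have N': "AE x in lborel. x \<notin> N" by (simp add: AE_completion_iff)
    then show "AE x in lborel. (\<lambda>n. (f x - h n x)\<^sup>2) \<longlonglongrightarrow> 0"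
    proof eventually_elim
      case (elim x)
      have "(\<lambda>n. (f x - h n x)\<^sup>2) \<longlonglongrightarrow> (f x - f x)\<^sup>2"
        by (intro tendsto_intros hlim elim)
      then show ?case by simp
    qed
    show "AE x in lborel. norm ((f x - h n x)\<^sup>2) \<le> (2 * M)\<^sup>2 * indicator (cball 0 (r + 1)) x" for n
    proof (intro AE_I2)
      fix x
      have "\<bar>f x - h n x\<bar> \<le> 2 * M" using M[of x] hM[of n x] by linarith
      from power_mono[OF this, of 2] have "(f x - h n x)\<^sup>2 \<le> (2 * M)\<^sup>2" by simp
      then show "norm ((f x - h n x)\<^sup>2) \<le> (2 * M)\<^sup>2 * indicator (cball 0 (r + 1)) x"
        using 0[of x] h0[of x n] by (cases "norm x > r + 1") auto
    qed
  qed auto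
  then have "\<forall>\<^sub>F n in sequentially. (\<integral>x. (f x - h n x)\<^sup>2 \<partial>lborel) < e"
    using e by (auto dest: order_tendstoD(2))
  then obtain n where "(\<integral>x. (f x - h n x)\<^sup>2 \<partial>lborel) < e"
    by (auto simp: eventually_sequentially)
  with hc h0 show ?thesis by blast
qed

lemma power2_sum_le: "(x + y)\<^sup>2 \<le> 2 * x\<^sup>2 + 2 * (y::real)\<^sup>2"
  using zero_le_power2[of "x - y"] unfolding power2_diff power2_sum by linarith

text \<open>Replacing large values of \<open>f\<close> by 0 costs little by dominated convergence
  and reduces the claim to bounded functions.\<close>

lemma L2_approx_continuous:
  fixes f :: "'a::euclidean_space \<Rightarrow> real"
  assumes [measurable]: "f \<in> borel_measurable borel"
    and 0: "\<And>x. norm x > r \<Longrightarrow> f x = 0" and f: "integrable lborel (\<lambda>x. (f x)\<^sup>2)" and e: "e > 0"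
  shows "\<exists>g. continuous_on UNIV g \<and> (\<forall>x. norm x > r + 1 \<longrightarrow> g x = 0) \<and> (\<integral>x. (f x - g x)\<^sup>2 \<partial>lborel) < e"
proof -
  define t where "t n x = (if \<bar>f x\<bar> \<le> real n then f x else 0)" for n x
  have [measurable]: "t n \<in> borel_measurable borel" for n
    unfolding t_def by measurable
  have "(\<lambda>n. \<integral>x. (f x - t n x)\<^sup>2 \<partial>lborel) \<longlonglongrightarrow> (\<integral>x. 0 \<partial>(lborel :: 'a measure))"
  proof (rule integral_dominated_convergence[OF _ _ f])
    show "AE x in lborel. (\<lambda>n. (f x - t n x)\<^sup>2) \<longlonglongrightarrow> 0"
    proof (intro AE_I2 tendsto_eventually)
      fix x
      obtain m :: nat where "\<bar>f x\<bar> \<le> real m" using real_arch_simple by blast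
      then show "\<forall>\<^sub>F n in sequentially. (f x - t n x)\<^sup>2 = 0"
        unfolding eventually_sequentially t_def by (intro exI[where x = m]) auto
    qed
  qed (auto simp: t_def)
  from order_tendstoD(2)[OF this, of "e / 4"]
  have "\<forall>\<^sub>F n in sequentially. (\<integral>x. (f x - t n x)\<^sup>2 \<partial>lborel) < e / 4"
    using e by simp
  then obtain n where n: "(\<integral>x. (f x - t n x)\<^sup>2 \<partial>lborel) < e / 4"
    by (auto simp: eventually_sequentially)
  obtain g where g: "continuous_on UNIV g" "\<forall>x. norm x > r + 1 \<longrightarrow> g x = 0"
      "(\<integral>x. (t n x - g x)\<^sup>2 \<partial>lborel) < e / 4"
  proof -
    have "\<bar>t n x\<bar> \<le> real n" "norm x > r \<Longrightarrow> t n x = 0" "e / 4 > 0" for x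
      using 0 e by (auto simp: t_def)
    from L2_approx_continuous_bounded[of "t n" r, OF _ this(2,1,3)] that show ?thesis by auto
  qed
  have [measurable]: "g \<in> borel_measurable borel"
    by (rule borel_measurable_continuous_onI[OF g(1)])
  have It: "integrable lborel (\<lambda>x. (t n x)\<^sup>2)"
    by (rule Bochner_Integration.integrable_bound[OF f]) (auto simp: t_def)
  have Ig: "integrable lborel (\<lambda>x. (g x)\<^sup>2)"
    by (rule integrable_continuous_compact_support[of _ "cball 0 (r + 1)"])
      (use g in \<open>auto intro!: continuous_intros\<close>)
  note I = integrable_power2_diff(1)[of f lborel "t n"] integrable_power2_diff(1)[of "t n" lborel g]
    integrable_power2_diff(1)[of f lborel g]
  have "(\<integral>x. (f x - g x)\<^sup>2 \<partial>lborel) \<le> (\<integral>x. 2 * (f x - t n x)\<^sup>2 + 2 * (t n x - g x)\<^sup>2 \<partial>lborel)"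
  proof (intro integral_mono)
    show "(f x - g x)\<^sup>2 \<le> 2 * (f x - t n x)\<^sup>2 + 2 * (t n x - g x)\<^sup>2" for x
      using power2_sum_le[of "f x - t n x" "t n x - g x"] by simp
  qed (use I It Ig f in auto)
  also have "\<dots> = 2 * (\<integral>x. (f x - t n x)\<^sup>2 \<partial>lborel) + 2 * (\<integral>x. (t n x - g x)\<^sup>2 \<partial>lborel)"
    using I It Ig f by auto
  also have "\<dots> < e" using n g(3) by linarith
  finally show ?thesis using g by blast
qed

lemma conv_mollifier_uniform:
  fixes g :: "real^'n::finite \<Rightarrow> real"
  assumes g: "integrable lborel g" and \<epsilon>: "\<epsilon> > 0" and d: "\<And>y. norm (x - y) < \<epsilon> \<Longrightarrow> \<bar>g y - g x\<bar> \<le> \<delta>"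
  shows "\<bar>conv g (mollifier \<epsilon>) x - g x\<bar> \<le> \<delta>"
proof -
  let ?K = "mollifier \<epsilon> :: real^'n \<Rightarrow> real"
  note T = test_fun_mollifier[OF \<epsilon>]
  note I = conv_integrand_integrable[OF g T, of x] integrable_mollifier_reflect[OF \<epsilon>, of x]
  have I': "integrable lborel (\<lambda>y. (g y - g x) * ?K (x - y))"
    using I by (simp add: left_diff_distrib)
  have "conv g ?K x - g x = (\<integral>y. (g y - g x) * ?K (x - y) \<partial>lborel)"
    using I by (simp add: left_diff_distrib conv_def integral_mollifier_reflect \<epsilon>)
  also have "\<bar>\<dots>\<bar> \<le> (\<integral>y. \<bar>(g y - g x) * ?K (x - y)\<bar> \<partial>lborel)"
    by (rule integral_abs_bound)
  also have "\<dots> \<le> (\<integral>y. \<delta> * ?K (x - y) \<partial>lborel)"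
  proof (intro integral_mono)
    show "\<bar>(g y - g x) * ?K (x - y)\<bar> \<le> \<delta> * ?K (x - y)" for y
      using d[of y] mollifier_eq_0[OF \<epsilon>, of "x - y"] mollifier_nonneg[OF \<epsilon>, of "x - y"]
      by (cases "norm (x - y) < \<epsilon>") (auto simp: abs_mult intro: mult_right_mono)
  qed (use I I' in auto)
  also have "\<dots> = \<delta>" by (simp add: integral_mollifier_reflect \<epsilon>)
  finally show ?thesis .
qed

text \<open>Split \<open>f\<close> into a continuous \<open>g\<close> and a remainder small in the
  mean square. Mollification does not enlarge the remainder, at any scale, and moves
  \<open>g\<close> little by uniform continuity on a bounded set.\<close>

lemma conv_mollifier_L2_tendsto:
  fixes f :: "real^'n::finite \<Rightarrow> real"
  assumes [measurable]: "f \<in> borel_measurable borel"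
    and 0: "\<And>x. norm x > r \<Longrightarrow> f x = 0" and f: "integrable lborel (\<lambda>x. (f x)\<^sup>2)"
    and \<epsilon>: "\<And>j. \<epsilon> j > 0" "\<epsilon> \<longlonglongrightarrow> 0"
  shows "(\<lambda>j::nat. \<integral>x. (conv f (mollifier (\<epsilon> j)) x - f x)\<^sup>2 \<partial>lborel) \<longlonglongrightarrow> 0"
proof (rule order_tendstoI)
  fix e :: real assume e: "e > 0"
  obtain g where g: "continuous_on UNIV g" "\<And>x. norm x > r + 1 \<Longrightarrow> g x = 0"
    "(\<integral>x. (f x - g x)\<^sup>2 \<partial>lborel) < e / 16"
    using L2_approx_continuous[of f r "e / 16"] 0 f e by auto
  have [measurable]: "g \<in> borel_measurable borel"
    by (rule borel_measurable_continuous_onI[OF g(1)])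
  have If: "integrable lborel f"
    by (rule integrable_of_power2_bounded_support[OF _ f 0]) auto
  have Ig: "integrable lborel g" "integrable lborel (\<lambda>x. (g x)\<^sup>2)"
    by (rule integrable_continuous_compact_support[of _ "cball 0 (r + 1)"];
      use g in \<open>auto intro!: continuous_intros\<close>)+
  define m where "m = measure lborel (cball (0::real^'n) (r + 2))"
  have m: "m \<ge> 0" by (simp add: m_def)
  \<comment> \<open>The shares of \<open>e\<close> are 2/16 and 4/16 from \<open>f - g\<close>, and
    at most 4/8 from \<open>g\<close>, whose contribution is at most
    \<open>4 * \<delta>\<^sup>2 * m\<close>.\<close>
  define \<delta> where "\<delta> = sqrt (e / (8 * (m + 1)))"
  have \<delta>: "\<delta> > 0" using e m by (simp add: \<delta>_def)
  obtain d where d: "d > 0" "\<And>x y. norm (x - y) < d \<Longrightarrow> \<bar>g x - g y\<bar> < \<delta>"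
    using uniformly_continuous_compact_support[OF g(1,2) \<delta>] by blast
  \<comment> \<open>The bound 1 keeps the mollified \<open>g\<close> supported within radius
    \<open>r + 2\<close>, the ball whose volume is \<open>m\<close>.\<close>
  have "\<forall>\<^sub>F j in sequentially. \<epsilon> j < min d 1"
    using \<epsilon>(2) d by (intro order_tendstoD) auto
  then show "\<forall>\<^sub>F j in sequentially. (\<integral>x. (conv f (mollifier (\<epsilon> j)) x - f x)\<^sup>2 \<partial>lborel) < e"
  proof eventually_elim
    case (elim j)
    let ?K = "mollifier (\<epsilon> j) :: real^'n \<Rightarrow> real"
    note \<epsilon>j = \<epsilon>(1)[of j]
    note T = test_fun_mollifier[OF \<epsilon>j]
    let ?h = "\<lambda>x. f x - g x"
    have Ih: "integrable lborel ?h" using If Ig by auto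
    have Ih2: "integrable lborel (\<lambda>x. (?h x)\<^sup>2)"
      by (rule integrable_power2_diff) (use f Ig in auto)
    have [measurable]: "conv f ?K \<in> borel_measurable borel" "conv g ?K \<in> borel_measurable borel"
      "conv ?h ?K \<in> borel_measurable borel"
      by (intro smooth_borel_measurable smooth_conv[OF _ T] If Ig Ih)+
    note A = conv_mollifier_contraction[OF Ih Ih2 \<epsilon>j]
    have B: "(conv g ?K x - g x)\<^sup>2 \<le> \<delta>\<^sup>2 * indicator (cball 0 (r + 2)) x" for x
    proof (cases "norm x > r + 2")
      case True
      have "conv g ?K x = 0"
      proof (rule conv_eq_0)
        fix y assume "g y \<noteq> 0"
        then have "norm y \<le> r + 1" using g(2)[of y] by force
        then have "norm (x - y) \<ge> \<epsilon> j" using True elim norm_triangle_ineq2[of x y] by auto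
        then show "?K (x - y) = 0" by (rule mollifier_eq_0[OF \<epsilon>j])
      qed
      then show ?thesis using True g(2) by simp
    next
      case False
      have "\<bar>conv g ?K x - g x\<bar> \<le> \<delta>"
      proof (rule conv_mollifier_uniform[OF Ig(1) \<epsilon>j])
        show "\<bar>g y - g x\<bar> \<le> \<delta>" if "norm (x - y) < \<epsilon> j" for y
          using d(2)[of x y] that elim by (simp add: abs_minus_commute)
      qed
      from power_mono[OF this, of 2] have "(conv g ?K x - g x)\<^sup>2 \<le> \<delta>\<^sup>2" by simp
      then show ?thesis using False by simp
    qed
    have Iind: "integrable lborel (\<lambda>x::real^'n. \<delta>\<^sup>2 * indicator (cball 0 (r + 2)) x)"
      by (intro integrable_mult_right indicator_bounded_integrable) auto
    have IB: "integrable lborel (\<lambda>x. (conv g ?K x - g x)\<^sup>2)"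
      by (rule Bochner_Integration.integrable_bound[OF Iind]) (use B in auto)
    have Iall: "integrable lborel (\<lambda>x. 2 * (conv ?h ?K x)\<^sup>2 + (4 * (conv g ?K x - g x)\<^sup>2 + 4 * (?h x)\<^sup>2))"
      using A(1) IB Ih2 by auto
    have le: "(conv f ?K x - f x)\<^sup>2 \<le> 2 * (conv ?h ?K x)\<^sup>2 + (4 * (conv g ?K x - g x)\<^sup>2 + 4 * (?h x)\<^sup>2)" for x
    proof -
      have "conv f ?K x - f x = conv ?h ?K x + ((conv g ?K x - g x) + (- ?h x))"
        using conv_diff[OF If Ig(1) T, of x] by simp
      then have "(conv f ?K x - f x)\<^sup>2 \<le> 2 * (conv ?h ?K x)\<^sup>2 + 2 * ((conv g ?K x - g x) + (- ?h x))\<^sup>2"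
        using power2_sum_le by metis
      moreover have "((conv g ?K x - g x) + (- ?h x))\<^sup>2 \<le> 2 * (conv g ?K x - g x)\<^sup>2 + 2 * (- ?h x)\<^sup>2"
        by (rule power2_sum_le)
      ultimately show ?thesis unfolding power2_minus by linarith
    qed
    have "(\<integral>x. (conv f ?K x - f x)\<^sup>2 \<partial>lborel) \<le>
        (\<integral>x. 2 * (conv ?h ?K x)\<^sup>2 + (4 * (conv g ?K x - g x)\<^sup>2 + 4 * (?h x)\<^sup>2) \<partial>lborel)"
      by (rule integral_mono_AE'[OF Iall]) (use le in auto)
    also have "\<dots> = 2 * (\<integral>x. (conv ?h ?K x)\<^sup>2 \<partial>lborel) + (4 * (\<integral>x. (conv g ?K x - g x)\<^sup>2 \<partial>lborel)
        + 4 * (\<integral>x. (?h x)\<^sup>2 \<partial>lborel))"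
      using A(1) IB Ih2 by simp
    also have "(\<integral>x. (conv ?h ?K x)\<^sup>2 \<partial>lborel) \<le> (\<integral>x. (?h x)\<^sup>2 \<partial>lborel)"
      by (rule A(2)) auto
    also have "(\<integral>x. (conv g ?K x - g x)\<^sup>2 \<partial>lborel) \<le> (\<integral>x. \<delta>\<^sup>2 * indicator (cball 0 (r + 2)) x \<partial>(lborel :: (real^'n) measure))"
      by (intro integral_mono IB Iind B)
    also have "\<dots> = \<delta>\<^sup>2 * m" by (simp add: m_def)
    also have "\<dots> \<le> e / 8"
      using e m by (simp add: \<delta>_def field_simps)
    finally show ?case using g(3) e by linarith
  qed
next
  fix e :: real assume "e < 0"
  then show "\<forall>\<^sub>F j in sequentially. e < (\<integral>x. (conv f (mollifier (\<epsilon> j)) x - f x)\<^sup>2 \<partial>lborel)"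
    by (intro always_eventually allI) (auto intro: less_le_trans Bochner_Integration.integral_nonneg)
qed

section \<open>Weak derivatives\<close>

lemma lebesgue_on_reduce:
  fixes h :: "'a::euclidean_space \<Rightarrow> real"
  assumes "\<Omega> \<in> sets lebesgue" "K \<in> sets lebesgue" "K \<subseteq> \<Omega>" "\<And>x. x \<in> \<Omega> \<Longrightarrow> x \<notin> K \<Longrightarrow> h x = 0"
  shows "integrable (lebesgue_on \<Omega>) h \<longleftrightarrow> integrable (lebesgue_on K) h"
    and "(\<integral>x. h x \<partial>lebesgue_on \<Omega>) = (\<integral>x. h x \<partial>lebesgue_on K)"
proof -
  have "(\<lambda>x. indicator \<Omega> x *\<^sub>R h x) = (\<lambda>x. indicator K x *\<^sub>R h x)"
    using assms(3,4) by (auto simp: fun_eq_iff indicator_def)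
  then show "integrable (lebesgue_on \<Omega>) h \<longleftrightarrow> integrable (lebesgue_on K) h"
    "(\<integral>x. h x \<partial>lebesgue_on \<Omega>) = (\<integral>x. h x \<partial>lebesgue_on K)"
    using assms(1,2) by (simp_all add: integrable_restrict_space integral_restrict_space)
qed

lemma integrable_lebesgue_on_subset:
  fixes h :: "'a::euclidean_space \<Rightarrow> real"
  assumes "integrable (lebesgue_on \<Omega>) h" "\<Omega> \<in> sets lebesgue" "K \<in> sets lebesgue" "K \<subseteq> \<Omega>"
  shows "integrable (lebesgue_on K) h"
proof -
  have "integrable lebesgue (\<lambda>x. indicator K x *\<^sub>R (indicator \<Omega> x *\<^sub>R h x))"
    using assms by (intro integrable_mult_indicator[OF assms(3)]) (simp add: integrable_restrict_space)
  moreover have "(\<lambda>x. indicator K x *\<^sub>R (indicator \<Omega> x *\<^sub>R h x)) = (\<lambda>x. indicator K x *\<^sub>R h x)"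
    using assms(4) by (auto simp: indicator_def fun_eq_iff)
  ultimately have "integrable lebesgue (\<lambda>x. indicator K x *\<^sub>R h x)" by metis
  then show ?thesis using assms(3) by (simp add: integrable_restrict_space)
qed

lemma compact_sets_lebesgue: "compact K \<Longrightarrow> K \<in> sets lebesgue"
  using compact_imp_closed by fastforce

lemma AE_lebesgue_on_iff:
  "\<Omega> \<in> sets lebesgue \<Longrightarrow> (AE x in lebesgue_on \<Omega>. P x) \<longleftrightarrow> (AE x in lebesgue. x \<in> \<Omega> \<longrightarrow> P x)"
  by (simp add: AE_restrict_space_iff)

lemma borel_measurable_lebesgue_on_borel:
  "f \<in> borel_measurable borel \<Longrightarrow> f \<in> borel_measurable (lebesgue_on K)"
  by (intro measurable_restrict_space1 measurable_completion) simp

lemma finite_measure_lebesgue_on: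
  assumes "bounded K" "K \<in> sets lebesgue"
  shows "finite_measure (lebesgue_on K)"
  using assms by (meson bounded_set_imp_lmeasurable finite_measure_lebesgue_on)

lemma test_fun_mult_integrable:
  fixes g :: "real^'n::finite \<Rightarrow> real"
  assumes \<phi>: "test_fun \<Omega> \<phi>" and g: "loc_integrable \<Omega> g" and \<Omega>: "\<Omega> \<in> sets lebesgue"
  shows "integrable (lebesgue_on \<Omega>) (\<lambda>x. \<phi> x * g x)"
proof -
  obtain K where K: "compact K" "K \<subseteq> \<Omega>" "\<And>x. x \<notin> K \<Longrightarrow> \<phi> x = 0"
    using test_fun_support[OF \<phi>] by blast
  obtain B where B: "\<And>x. \<bar>\<phi> x\<bar> \<le> B" using test_fun_bounded[OF \<phi>] by blast
  have "integrable (lebesgue_on K) g" using g K by (auto simp: loc_integrable_def)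
  then have "integrable (lebesgue_on K) (\<lambda>x. \<phi> x * g x)"
    by (rule integrable_mult_bounded(2)[where B = B])
      (use B \<phi> in \<open>auto intro: borel_measurable_lebesgue_on_borel smooth_borel_measurable test_fun_smooth\<close>)
  then show ?thesis
    using lebesgue_on_reduce(1)[of \<Omega> K "\<lambda>x. \<phi> x * g x"] K \<Omega> compact_sets_lebesgue[of K] by simp
qed

section \<open>The fundamental lemma of the calculus of variations\<close>

lemma compact_nbhd:
  fixes K \<Omega> :: "'a::euclidean_space set"
  assumes "compact K" "open \<Omega>" "K \<subseteq> \<Omega>"
  obtains \<delta> where "\<delta> > 0" "compact (\<Union>x\<in>K. cball x \<delta>)" "(\<Union>x\<in>K. cball x \<delta>) \<subseteq> \<Omega>"
proof -
  obtain e where e: "e > 0" "(\<Union>x\<in>K. cball x e) \<subseteq> \<Omega>"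
    by (rule compact_subset_open_imp_cball_epsilon_subset[OF assms]) metis
  have "(\<Union>x\<in>K. cball x e) = {x + y |x y. x \<in> K \<and> y \<in> cball 0 e}"
  proof (intro equalityI subsetI)
    fix z assume "z \<in> (\<Union>x\<in>K. cball x e)"
    then obtain x where "x \<in> K" "dist x z \<le> e" by auto
    then show "z \<in> {x + y |x y. x \<in> K \<and> y \<in> cball 0 e}"
      by (intro CollectI exI[of _ x] exI[of _ "z - x"]) (auto simp: dist_norm norm_minus_commute)
  next
    fix z assume "z \<in> {x + y |x y. x \<in> K \<and> y \<in> cball 0 e}"
    then obtain x y where "x \<in> K" "norm y \<le> e" "z = x + y" by auto
    then show "z \<in> (\<Union>x\<in>K. cball x e)"
      by (intro UN_I[of x]) (auto simp: dist_norm)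
  qed
  then have "compact (\<Union>x\<in>K. cball x e)"
    using compact_sums[OF assms(1) compact_cball[of 0 e]] by simp
  with e that show ?thesis by blast
qed

text \<open>Cutoffs that equal 1 on \<open>K\<close> and have supports shrinking to \<open>K\<close>
  are test functions converging pointwise to the indicator of \<open>K\<close>; dominated
  convergence passes to the limit.\<close>

lemma integral_compact_eq_0:
  fixes f :: "real^'n::finite \<Rightarrow> real"
  assumes \<Omega>: "open \<Omega>" and f: "loc_integrable \<Omega> f"
    and 0: "\<And>\<phi>. test_fun \<Omega> \<phi> \<Longrightarrow> (\<integral>x. \<phi> x * f x \<partial>lebesgue_on \<Omega>) = 0"
    and K: "compact K" "K \<subseteq> \<Omega>"
  shows "(\<integral>x. f x \<partial>lebesgue_on K) = 0"
proof -
  obtain \<delta> where \<delta>: "\<delta> > 0" and L: "compact (\<Union>x\<in>K. cball x \<delta>)" "(\<Union>x\<in>K. cball x \<delta>) \<subseteq> \<Omega>"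
    using compact_nbhd[OF K(1) \<Omega> K(2)] by blast
  define L where "L = (\<Union>x\<in>K. cball x \<delta>)"
  \<comment> \<open>Mollifying the indicator of the \<open>e j\<close>-neighbourhood at scale
    \<open>e j\<close> yields 1 on \<open>K\<close> and 0 from distance \<open>2 * e j\<close> on.
    The factor 2 in the denominator keeps that distance below \<delta>, so that \<open>L\<close>
    contains all supports.\<close>
  define e where "e j = \<delta> / (2 * real (Suc j))" for j
  have e: "e j > 0" "e j \<le> \<delta> / 2" for j using \<delta> by (auto simp: e_def field_simps)
  have elim: "e \<longlonglongrightarrow> 0" unfolding e_def by real_asymp
  define A where "A j = (\<Union>x\<in>K. ball x (e j))" for j
  have Am: "A j \<in> sets borel" "bounded (A j)" for j
  proof -
    show "A j \<in> sets borel" unfolding A_def by (intro borel_open open_UN ballI open_ball)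
    have "A j \<subseteq> L" unfolding A_def L_def using e[of j] \<delta> by fastforce
    then show "bounded (A j)" using L bounded_subset compact_imp_bounded L_def by blast
  qed
  define \<phi> where "\<phi> j = conv (indicator (A j)) (mollifier (e j))" for j
  have \<phi>: "smooth (\<phi> j)" "0 \<le> \<phi> j x" "\<phi> j x \<le> 1" "ball x (e j) \<subseteq> A j \<Longrightarrow> \<phi> j x = 1"
    "ball x (e j) \<inter> A j = {} \<Longrightarrow> \<phi> j x = 0" for j x
    unfolding \<phi>_def by (rule conv_indicator_mollifier[OF Am[of j] e(1)[of j]]; assumption)+
  have \<phi>K: "\<phi> j x = 1" if "x \<in> K" for j x
    by (rule \<phi>(4)) (use that in \<open>auto simp: A_def\<close>)
  have \<phi>0: "\<phi> j x = 0" if "\<And>y. y \<in> K \<Longrightarrow> dist y x \<ge> 2 * e j" for j x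
  proof (rule \<phi>(5), rule ccontr)
    assume "ball x (e j) \<inter> A j \<noteq> {}"
    then obtain y z where "dist x z < e j" "y \<in> K" "dist y z < e j" by (auto simp: A_def)
    then show False using that[of y] dist_triangle2[of y x z] by linarith
  qed
  have \<phi>L: "\<phi> j x = 0" if "x \<notin> L" for j x
    using that e(2)[of j] by (intro \<phi>0) (auto simp: L_def not_le intro: less_imp_le less_le_trans)
  have T: "test_fun \<Omega> (\<phi> j)" for j
    using L \<phi>L by (intro test_funI[OF \<phi>(1)]) (auto simp: L_def)
  have Lm: "L \<in> sets lebesgue" "K \<in> sets lebesgue" "\<Omega> \<in> sets lebesgue" "K \<subseteq> L"
    using L K \<Omega> \<delta> by (auto simp: L_def intro: compact_sets_lebesgue)
  have fL: "integrable (lebesgue_on L) f" using f L by (auto simp: loc_integrable_def L_def)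
  have lim: "(\<lambda>j. \<phi> j x) \<longlonglongrightarrow> indicator K x" for x
  proof (cases "x \<in> K")
    case True then show ?thesis by (simp add: \<phi>K)
  next
    case False
    then obtain d where d: "d > 0" "ball x d \<inter> K = {}"
      using compact_imp_closed[OF K(1)]
      by (metis Compl_iff disjoint_eq_subset_Compl inf.commute open_Compl open_contains_ball)
    have "\<forall>\<^sub>F j in sequentially. 2 * e j < d"
      using tendsto_mult_right_zero[OF elim, of 2] d by (intro order_tendstoD) auto
    then have "\<forall>\<^sub>F j in sequentially. \<phi> j x = 0"
    proof eventually_elim
      case (elim j)
      show ?case
      proof (rule \<phi>0)
        fix y assume "y \<in> K"
        then have "y \<notin> ball x d" using d by auto
        then show "2 * e j \<le> dist y x" using elim by (simp add: dist_commute)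
      qed
    qed
    then show ?thesis using False by (simp add: tendsto_eventually)
  qed
  have "(\<lambda>j. \<integral>x. \<phi> j x * f x \<partial>lebesgue_on L) \<longlonglongrightarrow> (\<integral>x. indicator K x * f x \<partial>lebesgue_on L)"
  proof (rule integral_dominated_convergence)
    show "integrable (lebesgue_on L) (\<lambda>x. \<bar>f x\<bar>)" using fL by simp
    show "AE x in lebesgue_on L. norm (\<phi> j x * f x) \<le> \<bar>f x\<bar>" for j
      using \<phi>(2,3)[of j] by (auto simp: abs_mult intro!: AE_I2 mult_left_le_one_le)
    show "AE x in lebesgue_on L. (\<lambda>j. \<phi> j x * f x) \<longlonglongrightarrow> indicator K x * f x"
      by (intro AE_I2 tendsto_intros lim)
    have [measurable]: "\<phi> j \<in> borel_measurable (lebesgue_on L)" for j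
      by (intro borel_measurable_lebesgue_on_borel smooth_borel_measurable \<phi>(1))
    have [measurable]: "f \<in> borel_measurable (lebesgue_on L)" using fL by auto
    have [measurable]: "(indicator K :: _ \<Rightarrow> real) \<in> borel_measurable (lebesgue_on L)"
      using compact_imp_closed[OF K(1)] by (intro borel_measurable_lebesgue_on_borel) auto
    show "(\<lambda>x. \<phi> j x * f x) \<in> borel_measurable (lebesgue_on L)" for j by measurable
    show "(\<lambda>x. indicator K x * f x) \<in> borel_measurable (lebesgue_on L)" by measurable
  qed
  moreover have "(\<integral>x. \<phi> j x * f x \<partial>lebesgue_on L) = 0" for j
    using lebesgue_on_reduce(2)[of \<Omega> L "\<lambda>x. \<phi> j x * f x"] 0[OF T[of j]] \<phi>L[of _ j] Lm L(2)
    by (simp add: L_def)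
  ultimately have "(\<integral>x. indicator K x * f x \<partial>lebesgue_on L) = 0"
    by (simp add: LIMSEQ_const_iff)
  also have "(\<integral>x. indicator K x * f x \<partial>lebesgue_on L) = (\<integral>x. indicator K x * f x \<partial>lebesgue_on K)"
    using Lm by (intro lebesgue_on_reduce) auto
  also have "\<dots> = (\<integral>x. f x \<partial>lebesgue_on K)"
    by (intro Bochner_Integration.integral_cong) auto
  finally show ?thesis .
qed

text \<open>Inner regularity: a closed subset of the positivity set is null because a positive
  function has integral zero on it, and the rest of the positivity set can be made arbitrarily
  small.\<close>

lemma negligible_pos_if_compact_integrals_0:
  fixes f :: "'a::euclidean_space \<Rightarrow> real"
  assumes C: "compact C" and f: "integrable (lebesgue_on C) f"
    and 0: "\<And>K. compact K \<Longrightarrow> K \<subseteq> C \<Longrightarrow> (\<integral>x. f x \<partial>lebesgue_on K) = 0"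
  shows "negligible {x\<in>C. f x > 0}"
proof -
  define A where "A = {x\<in>C. f x > 0}"
  have Cm: "C \<in> sets lebesgue" using C by (rule compact_sets_lebesgue)
  have "{x \<in> space (lebesgue_on C). f x > 0} \<in> sets (lebesgue_on C)"
    using borel_measurable_integrable[OF f] by measurable
  then have A: "A \<in> sets lebesgue" using Cm by (auto simp: A_def sets_restrict_space_iff)
  have "emeasure lebesgue A \<le> ennreal e" if e: "e > 0" for e
  proof -
    obtain T where T: "closed T" "T \<subseteq> A" "A - T \<in> lmeasurable" "emeasure lebesgue (A - T) < ennreal e"
      using sets_lebesgue_inner_closed[OF A e] by metis
    have TC: "compact T" "T \<subseteq> C"
    proof -
      show "T \<subseteq> C" using T(2) by (auto simp: A_def)
      then show "compact T" using T(1) C by (metis compact_Int_closed inf.absorb_iff2)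
    qed
    have Tm: "T \<in> sets lebesgue" using T(1) by auto
    have fT: "integrable (lebesgue_on T) f"
      by (rule integrable_lebesgue_on_subset[OF f Cm Tm TC(2)])
    have "AE x in lebesgue_on T. f x = 0"
      using 0[OF TC] T(2) by (subst (asm) integral_nonneg_eq_0_iff_AE[OF fT])
        (auto intro!: AE_I2 simp: A_def less_imp_le subset_iff)
    then have "AE x in lebesgue. x \<notin> T"
      using T(2) by (auto simp: AE_lebesgue_on_iff Tm A_def elim!: eventually_mono)
    then have "T \<in> null_sets lebesgue" using Tm by (subst AE_iff_null_sets) auto
    then have "emeasure lebesgue T = 0" by auto
    moreover have "emeasure lebesgue A \<le> emeasure lebesgue (A - T) + emeasure lebesgue T"
    proof -
      have "A = (A - T) \<union> T" using T(2) by auto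
      then show ?thesis using emeasure_subadditive[of "A - T" lebesgue T] A Tm by auto
    qed
    ultimately show ?thesis using T(4) by simp
  qed
  note small = this
  have "emeasure lebesgue A \<le> 0"
  proof (rule ennreal_le_epsilon)
    fix e :: real assume "0 < e"
    from small[OF this] show "emeasure lebesgue A \<le> 0 + ennreal e" by (simp only: add_0)
  qed
  then have "A \<in> null_sets lebesgue" using A by auto
  then show ?thesis by (simp add: negligible_iff_null_sets A_def)
qed

text \<open>Compact sets test both signs: the positivity sets of \<open>f\<close> and
  \<open>- f\<close> are null on each member of a countable compact exhaustion of
  \<open>\<Omega>\<close>.\<close>

lemma fundamental_lemma:
  fixes f :: "real^'n::finite \<Rightarrow> real"
  assumes \<Omega>: "open \<Omega>" and f: "loc_integrable \<Omega> f"
    and 0: "\<And>\<phi>. test_fun \<Omega> \<phi> \<Longrightarrow> (\<integral>x. \<phi> x * f x \<partial>lebesgue_on \<Omega>) = 0"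
  shows "AE x in lebesgue_on \<Omega>. f x = 0"
proof -
  have neg: "negligible {x\<in>C. f x \<noteq> 0}" if C: "compact C" "C \<subseteq> \<Omega>" for C
  proof -
    have fC: "integrable (lebesgue_on C) f" using f C by (auto simp: loc_integrable_def)
    have Z: "(\<integral>x. f x \<partial>lebesgue_on K) = 0" if "compact K" "K \<subseteq> C" for K
      using that C by (intro integral_compact_eq_0[OF \<Omega> f 0]) auto
    have "negligible {x\<in>C. f x > 0}"
      by (rule negligible_pos_if_compact_integrals_0[OF C(1) fC Z])
    moreover have "negligible {x\<in>C. - f x > 0}"
      by (rule negligible_pos_if_compact_integrals_0[OF C(1)]) (use fC Z in auto)
    moreover have "{x\<in>C. f x \<noteq> 0} = {x\<in>C. f x > 0} \<union> {x\<in>C. - f x > 0}" by auto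
    ultimately show ?thesis by (simp only: negligible_Un)
  qed
  obtain C where C: "\<And>n. compact (C n)" "\<And>n::nat. C n \<subseteq> \<Omega>" "\<Union>(range C) = \<Omega>"
    using open_Union_compact_subsets[OF \<Omega>] by metis
  have "AE x in lebesgue. x \<in> C n \<longrightarrow> f x = 0" for n
  proof -
    have "AE x in lebesgue. x \<notin> {x\<in>C n. f x \<noteq> 0}"
      using neg[OF C(1,2), of n] unfolding negligible_iff_null_sets by (rule AE_not_in)
    then show ?thesis by eventually_elim auto
  qed
  then have "AE x in lebesgue. \<forall>n. x \<in> C n \<longrightarrow> f x = 0"
    unfolding AE_all_countable by blast
  then have "AE x in lebesgue. x \<in> \<Omega> \<longrightarrow> f x = 0"
    unfolding C(3)[symmetric] by eventually_elim auto
  then show ?thesis using \<Omega> by (subst AE_lebesgue_on_iff) auto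
qed

lemma loc_integrable_diff:
  fixes f g :: "'a::euclidean_space \<Rightarrow> real"
  shows "loc_integrable \<Omega> f \<Longrightarrow> loc_integrable \<Omega> g \<Longrightarrow> loc_integrable \<Omega> (\<lambda>x. f x - g x)"
  by (auto simp: loc_integrable_def)

lemma loc_integrable_add:
  fixes f g :: "'a::euclidean_space \<Rightarrow> real"
  shows "loc_integrable \<Omega> f \<Longrightarrow> loc_integrable \<Omega> g \<Longrightarrow> loc_integrable \<Omega> (\<lambda>x. f x + g x)"
  by (auto simp: loc_integrable_def)

lemma weak_partial_unique:
  fixes u g g' :: "real^'n::finite \<Rightarrow> real"
  assumes \<Omega>: "open \<Omega>" and g: "is_weak_partial \<Omega> i u g" "is_weak_partial \<Omega> i u g'"
  shows "AE x in lebesgue_on \<Omega>. g x = g' x"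
proof -
  have L: "loc_integrable \<Omega> g" "loc_integrable \<Omega> g'" using g by (auto simp: is_weak_partial_def)
  have "AE x in lebesgue_on \<Omega>. g x - g' x = 0"
  proof (rule fundamental_lemma[OF \<Omega> loc_integrable_diff[OF L]])
    fix \<phi> :: "real^'n \<Rightarrow> real" assume \<phi>: "test_fun \<Omega> \<phi>"
    have I: "integrable (lebesgue_on \<Omega>) (\<lambda>x. \<phi> x * g x)" "integrable (lebesgue_on \<Omega>) (\<lambda>x. \<phi> x * g' x)"
      using L \<phi> \<Omega> by (auto intro!: test_fun_mult_integrable)
    then show "(\<integral>x. \<phi> x * (g x - g' x) \<partial>lebesgue_on \<Omega>) = 0"
      using g \<phi> by (simp add: is_weak_partial_def right_diff_distrib)
  qed
  then show ?thesis by simp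
qed

lemma weak_partial_props:
  fixes u :: "real^'n::finite \<Rightarrow> real"
  assumes \<Omega>: "open \<Omega>" and g: "is_weak_partial \<Omega> i u g"
  shows "is_weak_partial \<Omega> i u (weak_partial \<Omega> i u)"
    "AE x in lebesgue_on \<Omega>. weak_partial \<Omega> i u x = g x"
proof -
  show *: "is_weak_partial \<Omega> i u (weak_partial \<Omega> i u)"
    unfolding weak_partial_def using someI[of "is_weak_partial \<Omega> i u", OF g] .
  show "AE x in lebesgue_on \<Omega>. weak_partial \<Omega> i u x = g x"
    by (rule weak_partial_unique[OF \<Omega> * g])
qed

text \<open>Lebesgue measure is complete. The lemma transfers measurability to weak derivatives
  selected by choice, which are compared with a measurable one only almost everywhere, and to almost
  everywhere limits.\<close>

lemma borel_measurable_lebesgue_on_AE_eq: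
  fixes f g :: "'a::euclidean_space \<Rightarrow> real"
  assumes "f \<in> borel_measurable (lebesgue_on \<Omega>)" "AE x in lebesgue_on \<Omega>. g x = f x"
    and \<Omega>: "\<Omega> \<in> sets lebesgue"
  shows "g \<in> borel_measurable (lebesgue_on \<Omega>)"
proof -
  have f: "f measurable_on \<Omega>"
    using assms(1) measurable_on_iff_borel_measurable[OF \<Omega>] by blast
  have "AE x in lebesgue. x \<in> \<Omega> \<longrightarrow> g x = f x"
    using assms(2) unfolding AE_lebesgue_on_iff[OF \<Omega>] .
  then obtain N where N: "{x \<in> space lebesgue. \<not> (x \<in> \<Omega> \<longrightarrow> g x = f x)} \<subseteq> N"
      "emeasure lebesgue N = 0" "N \<in> sets lebesgue"
    by (rule AE_E)
  have "g measurable_on \<Omega>"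
  proof (rule measurable_on_spike[OF f])
    show "negligible N" using N(2,3) unfolding negligible_iff_null_sets by (rule null_setsI)
    show "g x = f x" if "x \<in> \<Omega> - N" for x using that N(1) by auto
  qed
  then show ?thesis
    using measurable_on_iff_borel_measurable[OF \<Omega>] by blast
qed

section \<open>Products with smooth functions and local approximation by test functions\<close>

lemma smooth_bounded_on_compact:
  assumes "smooth \<zeta>" "compact K"
  shows "\<exists>B. \<forall>x\<in>K. \<bar>\<zeta> x\<bar> \<le> B"
proof -
  have "compact (\<zeta> ` K)"
    using assms by (intro compact_continuous_image smooth_continuous_on)
  then have "bounded (\<zeta> ` K)" by (rule compact_imp_bounded)
  then show ?thesis unfolding bounded_iff by auto
qed

lemma smooth_mult_loc_integrable:
  fixes g :: "real^'n::finite \<Rightarrow> real"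
  assumes "smooth \<zeta>" "loc_integrable \<Omega> g"
  shows "loc_integrable \<Omega> (\<lambda>x. \<zeta> x * g x)"
  unfolding loc_integrable_def
proof (intro allI impI)
  fix K assume K: "compact K \<and> K \<subseteq> \<Omega>"
  then obtain B where B: "\<forall>x\<in>K. \<bar>\<zeta> x\<bar> \<le> B" using smooth_bounded_on_compact[OF assms(1)] by blast
  have "integrable (lebesgue_on K) g" using assms(2) K by (simp add: loc_integrable_def)
  then show "integrable (lebesgue_on K) (\<lambda>x. \<zeta> x * g x)"
    by (rule integrable_mult_bounded(2)[where B = B])
      (use B assms(1) in \<open>auto intro!: AE_I2 borel_measurable_lebesgue_on_borel smooth_borel_measurable\<close>)
qed

text \<open>Test the weak derivative of \<open>u\<close> with \<open>\<zeta> * \<phi>\<close> and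
  move the term in which the derivative falls on \<open>\<zeta>\<close> to the other side.\<close>

lemma is_weak_partial_smooth_mult:
  fixes u g :: "real^'n::finite \<Rightarrow> real"
  assumes \<Omega>: "open \<Omega>" and g: "is_weak_partial \<Omega> i u g" and \<zeta>: "smooth \<zeta>"
  shows "is_weak_partial \<Omega> i (\<lambda>x. \<zeta> x * u x) (\<lambda>x. \<zeta> x * g x + partial_deriv i \<zeta> x * u x)"
  unfolding is_weak_partial_def
proof (intro conjI allI impI)
  have L: "loc_integrable \<Omega> u" "loc_integrable \<Omega> g" using g by (auto simp: is_weak_partial_def)
  show "loc_integrable \<Omega> (\<lambda>x. \<zeta> x * u x)"
    "loc_integrable \<Omega> (\<lambda>x. \<zeta> x * g x + partial_deriv i \<zeta> x * u x)"
    using \<zeta> L by (auto intro!: loc_integrable_add smooth_mult_loc_integrable smooth_partial_deriv)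
  fix \<phi> :: "real^'n \<Rightarrow> real" assume \<phi>: "test_fun \<Omega> \<phi>"
  have T: "test_fun \<Omega> (\<lambda>x. \<zeta> x * \<phi> x)" by (rule test_fun_mult_smooth[OF \<phi> \<zeta>])
  have p: "partial_deriv i (\<lambda>x. \<zeta> x * \<phi> x) x = \<zeta> x * partial_deriv i \<phi> x + partial_deriv i \<zeta> x * \<phi> x" for x
    using \<zeta> test_fun_smooth[OF \<phi>] by (intro partial_deriv_mult smooth_differentiable)
  have \<Omega>m: "\<Omega> \<in> sets lebesgue" using \<Omega> by auto
  note M = test_fun_mult_smooth test_fun_partial_deriv smooth_partial_deriv
  have I: "integrable (lebesgue_on \<Omega>) (\<lambda>x. (\<zeta> x * partial_deriv i \<phi> x) * u x)"
    "integrable (lebesgue_on \<Omega>) (\<lambda>x. (partial_deriv i \<zeta> x * \<phi> x) * u x)"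
    "integrable (lebesgue_on \<Omega>) (\<lambda>x. (\<zeta> x * \<phi> x) * g x)"
    by (intro test_fun_mult_integrable[OF _ L(1) \<Omega>m] test_fun_mult_integrable[OF _ L(2) \<Omega>m] M \<phi> \<zeta>)+
  have "(\<integral>x. partial_deriv i (\<lambda>x. \<zeta> x * \<phi> x) x * u x \<partial>lebesgue_on \<Omega>)
      = - (\<integral>x. (\<zeta> x * \<phi> x) * g x \<partial>lebesgue_on \<Omega>)"
    using g T by (simp add: is_weak_partial_def)
  moreover have "(\<integral>x. partial_deriv i (\<lambda>x. \<zeta> x * \<phi> x) x * u x \<partial>lebesgue_on \<Omega>) =
     (\<integral>x. (\<zeta> x * partial_deriv i \<phi> x) * u x \<partial>lebesgue_on \<Omega>)
     + (\<integral>x. (partial_deriv i \<zeta> x * \<phi> x) * u x \<partial>lebesgue_on \<Omega>)"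
    unfolding p distrib_right by (rule Bochner_Integration.integral_add[OF I(1,2)])
  moreover have "(\<integral>x. \<phi> x *\<^sub>R (\<zeta> x * g x + partial_deriv i \<zeta> x * u x) \<partial>lebesgue_on \<Omega>) =
     (\<integral>x. (\<zeta> x * \<phi> x) * g x \<partial>lebesgue_on \<Omega>)
     + (\<integral>x. (partial_deriv i \<zeta> x * \<phi> x) * u x \<partial>lebesgue_on \<Omega>)"
  proof -
    have "(\<lambda>x. \<phi> x *\<^sub>R (\<zeta> x * g x + partial_deriv i \<zeta> x * u x)) =
      (\<lambda>x. (\<zeta> x * \<phi> x) * g x + (partial_deriv i \<zeta> x * \<phi> x) * u x)"
      by (simp add: fun_eq_iff algebra_simps)
    then show ?thesis using Bochner_Integration.integral_add[OF I(3,2)] by simp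
  qed
  moreover have "(\<integral>x. partial_deriv i \<phi> x *\<^sub>R (\<zeta> x * u x) \<partial>lebesgue_on \<Omega>) =
     (\<integral>x. (\<zeta> x * partial_deriv i \<phi> x) * u x \<partial>lebesgue_on \<Omega>)"
    by (intro Bochner_Integration.integral_cong) auto
  ultimately show "(\<integral>x. partial_deriv i \<phi> x *\<^sub>R (\<zeta> x * u x) \<partial>lebesgue_on \<Omega>) =
     - (\<integral>x. \<phi> x *\<^sub>R (\<zeta> x * g x + partial_deriv i \<zeta> x * u x) \<partial>lebesgue_on \<Omega>)"
    by simp
qed

lemma in_L2_bounded_mult:
  fixes u :: "real^'n::finite \<Rightarrow> real"
  assumes u: "in_L2 \<Omega> u" and \<zeta>: "\<zeta> \<in> borel_measurable borel" "\<And>x. \<bar>\<zeta> x\<bar> \<le> B"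
  shows "in_L2 \<Omega> (\<lambda>x. \<zeta> x * u x)"
proof -
  have [measurable]: "\<zeta> \<in> borel_measurable (lebesgue_on \<Omega>)" "u \<in> borel_measurable (lebesgue_on \<Omega>)"
    using u \<zeta> by (auto simp: in_L2_def intro: borel_measurable_lebesgue_on_borel)
  have "integrable (lebesgue_on \<Omega>) (\<lambda>x. (u x)\<^sup>2)" using u by (simp add: in_L2_def)
  then have "integrable (lebesgue_on \<Omega>) (\<lambda>x. (\<zeta> x)\<^sup>2 * (u x)\<^sup>2)"
  proof (rule integrable_mult_bounded(2)[where B = "B\<^sup>2"])
    have "(\<zeta> x)\<^sup>2 \<le> B\<^sup>2" for x using power_mono[OF \<zeta>(2)[of x], of 2] by simp
    then show "AE x in lebesgue_on \<Omega>. \<bar>(\<zeta> x)\<^sup>2\<bar> \<le> B\<^sup>2" by auto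
  qed auto
  then show ?thesis by (simp add: in_L2_def power_mult_distrib)
qed

lemma in_L2_add:
  fixes u v :: "real^'n::finite \<Rightarrow> real"
  assumes "in_L2 \<Omega> u" "in_L2 \<Omega> v"
  shows "in_L2 \<Omega> (\<lambda>x. u x + v x)"
  using assms integrable_power2_diff(2)[of u "lebesgue_on \<Omega>" v] by (auto simp: in_L2_def)

text \<open>Convolution and Fubini are carried out for Borel functions and \<open>lborel\<close>,
  whereas Sobolev functions are only Lebesgue measurable on \<open>\<Omega>\<close>. Representatives
  connect the two settings.\<close>

lemma ex_borel_representative:
  fixes u :: "real^'n::finite \<Rightarrow> real"
  assumes u: "u \<in> borel_measurable (lebesgue_on \<Omega>)" and \<Omega>: "\<Omega> \<in> sets lebesgue"
  shows "\<exists>u'. u' \<in> borel_measurable borel \<and> (AE x in lebesgue. x \<in> \<Omega> \<longrightarrow> u x = u' x)"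
proof -
  have "(\<lambda>x. indicator \<Omega> x *\<^sub>R u x) \<in> borel_measurable lebesgue"
    using u \<Omega> by (subst (asm) borel_measurable_restrict_space_iff) auto
  then obtain u' where u': "u' \<in> borel_measurable lborel" "AE x in lborel. indicator \<Omega> x *\<^sub>R u x = u' x"
    using completion_ex_borel_measurable_real by blast
  have "AE x in lebesgue. indicator \<Omega> x *\<^sub>R u x = u' x" by (rule AE_completion[OF u'(2)])
  then have "AE x in lebesgue. x \<in> \<Omega> \<longrightarrow> u x = u' x" by eventually_elim auto
  with u'(1) show ?thesis by auto
qed

lemma lebesgue_on_integral_eq_lborel:
  fixes h h' :: "real^'n::finite \<Rightarrow> real"
  assumes h: "h \<in> borel_measurable (lebesgue_on \<Omega>)" and [measurable]: "h' \<in> borel_measurable borel"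
    and \<Omega>: "\<Omega> \<in> sets lebesgue"
    and eq: "AE x in lebesgue. x \<in> \<Omega> \<longrightarrow> h x = h' x" and 0: "\<And>x. x \<notin> \<Omega> \<Longrightarrow> h' x = 0"
  shows "(\<integral>x. h x \<partial>lebesgue_on \<Omega>) = (\<integral>x. h' x \<partial>lborel)"
    "integrable (lebesgue_on \<Omega>) h \<longleftrightarrow> integrable lborel h'"
proof -
  have 1: "(\<lambda>x. indicator \<Omega> x *\<^sub>R h x) \<in> borel_measurable lebesgue"
    using h \<Omega> by (subst (asm) borel_measurable_restrict_space_iff) auto
  have 2: "h' \<in> borel_measurable lebesgue" by (intro measurable_completion) simp
  have 3: "AE x in lebesgue. indicator \<Omega> x *\<^sub>R h x = h' x"
    using eq by eventually_elim (auto simp: indicator_def 0)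
  show "(\<integral>x. h x \<partial>lebesgue_on \<Omega>) = (\<integral>x. h' x \<partial>lborel)"
    using integral_cong_AE[OF 1 2 3] \<Omega> by (simp add: integral_restrict_space integral_completion)
  show "integrable (lebesgue_on \<Omega>) h \<longleftrightarrow> integrable lborel h'"
    using integrable_cong_AE[OF 1 2 3] \<Omega> by (simp add: integrable_restrict_space integrable_completion)
qed

text \<open>After multiplication by \<open>\<eta>\<close>, the extension by zero has weak
  derivatives on the whole space. Mollification therefore commutes with differentiation, and at
  small scales it produces test functions in \<open>\<Omega>\<close>. The lemma serves both to place
  competitors in \<open>in_H10\<close> and to replace \<open>u\<close> by smooth functions in the
  translation estimate.\<close>

lemma H1_cutoff_approx:
  fixes u :: "real^'n::finite \<Rightarrow> real"
  assumes \<Omega>: "open \<Omega>" and \<eta>: "test_fun \<Omega> \<eta>" and g: "\<And>i. is_weak_partial \<Omega> i u (g i)"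
    and u: "in_L2 \<Omega> u" and gL: "\<And>i. in_L2 \<Omega> (g i)"
  shows "\<exists>\<phi>. (\<forall>k::nat. test_fun \<Omega> (\<phi> k)) \<and>
     (\<lambda>k. \<integral>x. (\<phi> k x - \<eta> x * u x)\<^sup>2 \<partial>lebesgue_on \<Omega>) \<longlonglongrightarrow> 0 \<and>
     (\<forall>i. (\<lambda>k. \<integral>x. (partial_deriv i (\<phi> k) x - (\<eta> x * g i x + partial_deriv i \<eta> x * u x))\<^sup>2 \<partial>lebesgue_on \<Omega>)
          \<longlonglongrightarrow> 0)"
proof -
  have \<Omega>m: "\<Omega> \<in> sets lebesgue" using \<Omega> by auto
  have um: "u \<in> borel_measurable (lebesgue_on \<Omega>)" and gm: "g i \<in> borel_measurable (lebesgue_on \<Omega>)" for i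
    using u gL by (auto simp: in_L2_def)
  obtain K where K: "compact K" "K \<subseteq> \<Omega>" "\<And>x. x \<notin> K \<Longrightarrow> \<eta> x = 0"
    "\<And>i x. x \<notin> K \<Longrightarrow> partial_deriv i \<eta> x = 0"
    using test_fun_support[OF \<eta>] by blast
  obtain B where B: "\<And>x. \<bar>\<eta> x\<bar> \<le> B" using test_fun_bounded[OF \<eta>] by blast
  have "\<exists>B. \<forall>x. \<bar>partial_deriv i \<eta> x\<bar> \<le> B" for i
    using test_fun_bounded[OF test_fun_partial_deriv[OF \<eta>, of i]] by blast
  then obtain B' where B': "\<And>i x. \<bar>partial_deriv i \<eta> x\<bar> \<le> B' i" by metis
  obtain r where r: "\<And>x. x \<in> K \<Longrightarrow> norm x \<le> r"
    using compact_imp_bounded[OF K(1)] unfolding bounded_iff by blast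
  obtain \<delta> where \<delta>: "\<delta> > 0" and L: "compact (\<Union>x\<in>K. cball x \<delta>)" "(\<Union>x\<in>K. cball x \<delta>) \<subseteq> \<Omega>"
    using compact_nbhd[OF K(1) \<Omega> K(2)] by blast
  obtain u' where [measurable]: "u' \<in> borel_measurable borel" and u': "AE x in lebesgue. x \<in> \<Omega> \<longrightarrow> u x = u' x"
    using ex_borel_representative[OF um \<Omega>m] by blast
  have "\<forall>i. \<exists>g'. g' \<in> borel_measurable borel \<and> (AE x in lebesgue. x \<in> \<Omega> \<longrightarrow> g i x = g' x)"
    using ex_borel_representative[OF gm \<Omega>m] by blast
  then obtain g' where [measurable]: "\<And>i. g' i \<in> borel_measurable borel"
    and g': "\<And>i. AE x in lebesgue. x \<in> \<Omega> \<longrightarrow> g i x = g' i x"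
    by metis
  have [measurable]: "\<eta> \<in> borel_measurable borel" "\<And>i. partial_deriv i \<eta> \<in> borel_measurable borel"
    using \<eta> by (auto intro: smooth_borel_measurable smooth_partial_deriv test_fun_smooth)
  note toL = borel_measurable_lebesgue_on_borel
  define w where "w x = \<eta> x * u' x" for x
  define h where "h i x = \<eta> x * g' i x + partial_deriv i \<eta> x * u' x" for i x
  have [measurable]: "w \<in> borel_measurable borel" "\<And>i. h i \<in> borel_measurable borel"
    unfolding w_def h_def by measurable
  have w0: "w x = 0" "h i x = 0" if "x \<notin> K" for i x
    using K(3)[OF that] K(4)[OF that] by (simp_all add: w_def h_def)
  have wr: "w x = 0" "h i x = 0" if "norm x > r" for i x
  proof -
    have "x \<notin> K" using that r[of x] by auto
    then show "w x = 0" "h i x = 0" by (rule w0)+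
  qed
  have wae: "AE x in lebesgue. x \<in> \<Omega> \<longrightarrow> \<eta> x * u x = w x"
    using u' by eventually_elim (auto simp: w_def)
  have hae: "AE x in lebesgue. x \<in> \<Omega> \<longrightarrow> \<eta> x * g i x + partial_deriv i \<eta> x * u x = h i x" for i
    using u' g'[of i] by eventually_elim (auto simp: h_def)
  have wL: "in_L2 \<Omega> (\<lambda>x. \<eta> x * u x)" by (rule in_L2_bounded_mult[OF u _ B]) simp
  have hL: "in_L2 \<Omega> (\<lambda>x. \<eta> x * g i x + partial_deriv i \<eta> x * u x)" for i
    by (intro in_L2_add in_L2_bounded_mult[OF gL _ B] in_L2_bounded_mult[OF u _ B']) simp_all
  have w2: "integrable lborel (\<lambda>x. (w x)\<^sup>2)"
  proof (rule iffD1[OF lebesgue_on_integral_eq_lborel(2)[OF _ _ \<Omega>m]])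
    have [measurable]: "(\<lambda>x. \<eta> x * u x) \<in> borel_measurable (lebesgue_on \<Omega>)" using wL by (simp add: in_L2_def)
    show "(\<lambda>x. (\<eta> x * u x)\<^sup>2) \<in> borel_measurable (lebesgue_on \<Omega>)" by measurable
    show "AE x in lebesgue. x \<in> \<Omega> \<longrightarrow> (\<eta> x * u x)\<^sup>2 = (w x)\<^sup>2"
      using wae by eventually_elim simp
    show "(w x)\<^sup>2 = 0" if "x \<notin> \<Omega>" for x using w0(1)[of x] that K(2) by auto
    show "integrable (lebesgue_on \<Omega>) (\<lambda>x. (\<eta> x * u x)\<^sup>2)" using wL by (simp add: in_L2_def)
  qed measurable
  have h2: "integrable lborel (\<lambda>x. (h i x)\<^sup>2)" for i
  proof (rule iffD1[OF lebesgue_on_integral_eq_lborel(2)[OF _ _ \<Omega>m]])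
    let ?f = "\<lambda>x. \<eta> x * g i x + partial_deriv i \<eta> x * u x"
    have [measurable]: "?f \<in> borel_measurable (lebesgue_on \<Omega>)" using hL[of i] by (simp add: in_L2_def)
    show "(\<lambda>x. (?f x)\<^sup>2) \<in> borel_measurable (lebesgue_on \<Omega>)" by measurable
    show "AE x in lebesgue. x \<in> \<Omega> \<longrightarrow> (?f x)\<^sup>2 = (h i x)\<^sup>2"
      using hae[of i] by eventually_elim simp
    show "(h i x)\<^sup>2 = 0" if "x \<notin> \<Omega>" for x using w0(2)[of x] that K(2) by auto
    show "integrable (lebesgue_on \<Omega>) (\<lambda>x. (?f x)\<^sup>2)" using hL[of i] by (simp add: in_L2_def)
  qed measurable
  have w1: "integrable lborel w" by (rule integrable_of_power2_bounded_support[OF _ w2 wr(1)]) simp_all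
  \<comment> \<open>Every smooth \<open>\<psi>\<close> is allowed here, because the factor
    \<open>\<eta>\<close> already supplies compact support in \<open>\<Omega>\<close>. So
    \<open>h i\<close> is the weak derivative of \<open>w\<close> on the whole space.\<close>
  have weak: "(\<integral>x. w x * partial_deriv i \<psi> x \<partial>lborel) = - (\<integral>x. h i x * \<psi> x \<partial>lborel)"
    if \<psi>: "smooth \<psi>" for \<psi> i
  proof -
    have T: "test_fun \<Omega> (\<lambda>x. \<psi> x * \<eta> x)" by (rule test_fun_mult_smooth[OF \<eta> \<psi>])
    have [measurable]: "\<psi> \<in> borel_measurable borel" "partial_deriv i \<psi> \<in> borel_measurable borel"
      using \<psi> by (auto intro: smooth_borel_measurable smooth_partial_deriv)
    have p: "partial_deriv i (\<lambda>x. \<psi> x * \<eta> x) x = \<psi> x * partial_deriv i \<eta> x + partial_deriv i \<psi> x * \<eta> x" for x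
      using \<psi> test_fun_smooth[OF \<eta>] by (intro partial_deriv_mult smooth_differentiable)
    have Ll: "loc_integrable \<Omega> u" "loc_integrable \<Omega> (g i)"
      using g[of i] by (auto simp: is_weak_partial_def)
    have I: "integrable (lebesgue_on \<Omega>) (\<lambda>x. (\<psi> x * partial_deriv i \<eta> x) * u x)"
      "integrable (lebesgue_on \<Omega>) (\<lambda>x. (partial_deriv i \<psi> x * \<eta> x) * u x)"
      "integrable (lebesgue_on \<Omega>) (\<lambda>x. (\<psi> x * \<eta> x) * g i x)"
      by (intro test_fun_mult_integrable[OF _ Ll(1) \<Omega>m] test_fun_mult_integrable[OF _ Ll(2) \<Omega>m]
          test_fun_mult_smooth test_fun_partial_deriv smooth_partial_deriv \<eta> \<psi>)+
    have "(\<integral>x. partial_deriv i (\<lambda>x. \<psi> x * \<eta> x) x * u x \<partial>lebesgue_on \<Omega>)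
      = - (\<integral>x. (\<psi> x * \<eta> x) * g i x \<partial>lebesgue_on \<Omega>)"
      using g[of i] T by (simp add: is_weak_partial_def)
    then have 1: "(\<integral>x. (\<psi> x * partial_deriv i \<eta> x) * u x \<partial>lebesgue_on \<Omega>)
      + (\<integral>x. (partial_deriv i \<psi> x * \<eta> x) * u x \<partial>lebesgue_on \<Omega>) =
      - (\<integral>x. (\<psi> x * \<eta> x) * g i x \<partial>lebesgue_on \<Omega>)"
      unfolding p distrib_right using Bochner_Integration.integral_add[OF I(1,2)] by simp
    have 2: "(\<integral>x. (partial_deriv i \<psi> x * \<eta> x) * u x \<partial>lebesgue_on \<Omega>) = (\<integral>x. w x * partial_deriv i \<psi> x \<partial>lborel)"
    proof (rule lebesgue_on_integral_eq_lborel(1)[OF borel_measurable_integrable[OF I(2)] _ \<Omega>m])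
      show "AE x in lebesgue. x \<in> \<Omega> \<longrightarrow> partial_deriv i \<psi> x * \<eta> x * u x = w x * partial_deriv i \<psi> x"
        using u' by eventually_elim (auto simp: w_def)
    qed (use w0 K(2) in auto)
    have 3: "(\<integral>x. (\<psi> x * \<eta> x) * g i x + (\<psi> x * partial_deriv i \<eta> x) * u x \<partial>lebesgue_on \<Omega>)
        = (\<integral>x. h i x * \<psi> x \<partial>lborel)"
    proof (rule lebesgue_on_integral_eq_lborel(1)[OF borel_measurable_integrable[OF Bochner_Integration.integrable_add[OF I(3,1)]] _ \<Omega>m])
      show "AE x in lebesgue. x \<in> \<Omega> \<longrightarrow>
        \<psi> x * \<eta> x * g i x + \<psi> x * partial_deriv i \<eta> x * u x = h i x * \<psi> x"
        using u' g'[of i] by eventually_elim (auto simp: h_def algebra_simps)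
    qed (use w0 K(2) in auto)
    show ?thesis
      using 1 2 3 Bochner_Integration.integral_add[OF I(3,1)] by linarith
  qed
  define e where "e k = \<delta> / real (Suc k)" for k
  have e: "e k > 0" "e k \<le> \<delta>" for k using \<delta> by (auto simp: e_def field_simps)
  have elim: "e \<longlonglongrightarrow> 0" unfolding e_def by real_asymp
  define \<phi> where "\<phi> k = conv w (mollifier (e k))" for k
  have Tm: "test_fun UNIV (mollifier (e k) :: real^'n \<Rightarrow> real)" for k by (rule test_fun_mollifier[OF e(1)])
  have sm: "smooth (\<phi> k)" for k
    unfolding \<phi>_def by (rule smooth_conv[OF w1 Tm])
  have \<phi>0: "\<phi> k x = 0" if "x \<notin> (\<Union>x\<in>K. cball x \<delta>)" for k x
    unfolding \<phi>_def
  proof (intro conv_eq_0 mollifier_eq_0[OF e(1)])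
    fix y assume "w y \<noteq> 0"
    then have "y \<in> K" using w0(1)[of y] by blast
    then have "x \<notin> cball y \<delta>" using that by blast
    then show "e k \<le> norm (x - y)" using e(2)[of k] by (auto simp: dist_norm norm_minus_commute)
  qed
  have T\<phi>: "test_fun \<Omega> (\<phi> k)" for k
    by (rule test_funI[OF sm L \<phi>0])
  have pd: "partial_deriv i (\<phi> k) = conv (h i) (mollifier (e k))" for i k
  proof
    fix x
    let ?K = "mollifier (e k) :: real^'n \<Rightarrow> real"
    \<comment> \<open>This is the kernel at \<open>x - y\<close> as a function of \<open>y\<close>.
      Differentiation in \<open>y\<close> reverses the sign, which cancels the minus sign of the
      integration by parts.\<close>
    define \<psi> where "\<psi> y = 1 * ?K ((-1) *\<^sub>R y + x)" for y
    have s: "smooth \<psi>" unfolding \<psi>_def by (rule smooth_affine[OF test_fun_smooth[OF Tm]])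
    have p: "partial_deriv i \<psi> y = - partial_deriv i ?K (x - y)" for y
      unfolding \<psi>_def partial_deriv_affine(1)[OF test_fun_smooth[OF Tm]] by simp
    have "partial_deriv i (\<phi> k) x = (\<integral>y. w y * partial_deriv i ?K (x - y) \<partial>lborel)"
      unfolding \<phi>_def partial_deriv_conv[OF w1 Tm] by (simp add: conv_def)
    also have "\<dots> = - (\<integral>y. w y * partial_deriv i \<psi> y \<partial>lborel)"
      by (simp add: p)
    also have "\<dots> = (\<integral>y. h i y * \<psi> y \<partial>lborel)" by (simp add: weak[OF s])
    also have "\<dots> = conv (h i) ?K x" by (simp add: conv_def \<psi>_def)
    finally show "partial_deriv i (\<phi> k) x = conv (h i) ?K x" .
  qed
  have \<phi>m[measurable]: "\<phi> k \<in> borel_measurable borel" "partial_deriv i (\<phi> k) \<in> borel_measurable borel" for k i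
    using sm by (auto intro: smooth_borel_measurable smooth_partial_deriv)
  have p\<phi>0: "partial_deriv i (\<phi> k) x = 0" if "x \<notin> \<Omega>" for i k x
    using test_fun_support[OF T\<phi>[of k]] that by blast
  have A: "(\<lambda>k. \<integral>x. (\<phi> k x - \<eta> x * u x)\<^sup>2 \<partial>lebesgue_on \<Omega>) \<longlonglongrightarrow> 0"
  proof -
    have "(\<integral>x. (\<phi> k x - \<eta> x * u x)\<^sup>2 \<partial>lebesgue_on \<Omega>) = (\<integral>x. (\<phi> k x - w x)\<^sup>2 \<partial>lborel)" for k
    proof (rule lebesgue_on_integral_eq_lborel(1)[OF _ _ \<Omega>m])
      have [measurable]: "\<phi> k \<in> borel_measurable (lebesgue_on \<Omega>)" by (rule toL[OF \<phi>m(1)])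
      have [measurable]: "(\<lambda>x. \<eta> x * u x) \<in> borel_measurable (lebesgue_on \<Omega>)" using wL by (simp add: in_L2_def)
      show "(\<lambda>x. (\<phi> k x - \<eta> x * u x)\<^sup>2) \<in> borel_measurable (lebesgue_on \<Omega>)" by measurable
      show "AE x in lebesgue. x \<in> \<Omega> \<longrightarrow> (\<phi> k x - \<eta> x * u x)\<^sup>2 = (\<phi> k x - w x)\<^sup>2"
        using wae by eventually_elim auto
      show "(\<phi> k x - w x)\<^sup>2 = 0" if "x \<notin> \<Omega>" for x
      proof -
        have "x \<notin> (\<Union>x\<in>K. cball x \<delta>)" "x \<notin> K" using that L(2) K(2) by blast+
        from \<phi>0[OF this(1), of k] w0(1)[OF this(2)] show ?thesis by simp
      qed
    qed measurable
    then show ?thesis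
      using conv_mollifier_L2_tendsto[OF _ wr(1) w2 e(1) elim] by (simp add: \<phi>_def)
  qed
  have B: "(\<lambda>k. \<integral>x. (partial_deriv i (\<phi> k) x - (\<eta> x * g i x + partial_deriv i \<eta> x * u x))\<^sup>2 \<partial>lebesgue_on \<Omega>) \<longlonglongrightarrow> 0"
    for i
  proof -
    have "(\<integral>x. (partial_deriv i (\<phi> k) x - (\<eta> x * g i x + partial_deriv i \<eta> x * u x))\<^sup>2 \<partial>lebesgue_on \<Omega>)
      = (\<integral>x. (partial_deriv i (\<phi> k) x - h i x)\<^sup>2 \<partial>lborel)" for k
    proof (rule lebesgue_on_integral_eq_lborel(1)[OF _ _ \<Omega>m])
      have [measurable]: "partial_deriv i (\<phi> k) \<in> borel_measurable (lebesgue_on \<Omega>)" by (rule toL[OF \<phi>m(2)])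
      have [measurable]: "(\<lambda>x. \<eta> x * g i x + partial_deriv i \<eta> x * u x) \<in> borel_measurable (lebesgue_on \<Omega>)"
        using hL[of i] by (simp add: in_L2_def)
      show "(\<lambda>x. (partial_deriv i (\<phi> k) x - (\<eta> x * g i x + partial_deriv i \<eta> x * u x))\<^sup>2) \<in> borel_measurable (lebesgue_on \<Omega>)"
        by measurable
      show "AE x in lebesgue. x \<in> \<Omega> \<longrightarrow>
        (partial_deriv i (\<phi> k) x - (\<eta> x * g i x + partial_deriv i \<eta> x * u x))\<^sup>2 = (partial_deriv i (\<phi> k) x - h i x)\<^sup>2"
        using hae[of i] by eventually_elim auto
      show "(partial_deriv i (\<phi> k) x - h i x)\<^sup>2 = 0" if "x \<notin> \<Omega>" for x
        using p\<phi>0[of x i k] w0(2)[of x i] that K(2) by auto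
    qed measurable
    then show ?thesis
      using conv_mollifier_L2_tendsto[OF _ wr(2) h2 e(1) elim] by (simp add: pd)
  qed
  show ?thesis using T\<phi> A B by blast
qed

lemma in_H1_cutoff:
  fixes u :: "real^'n::finite \<Rightarrow> real"
  assumes \<Omega>: "open \<Omega>" and u: "in_H1 \<Omega> u" and \<zeta>: "smooth \<zeta>"
    and B: "\<And>x. \<bar>\<zeta> x\<bar> \<le> B" "\<And>i x. \<bar>partial_deriv i \<zeta> x\<bar> \<le> B"
  shows "in_H1 \<Omega> (\<lambda>x. \<zeta> x * u x)"
    "AE x in lebesgue_on \<Omega>. weak_grad \<Omega> (\<lambda>x. \<zeta> x * u x) x =
       \<zeta> x *\<^sub>R weak_grad \<Omega> u x + u x *\<^sub>R (\<chi> i. partial_deriv i \<zeta> x)"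
proof -
  have [measurable]: "\<zeta> \<in> borel_measurable borel" "\<And>i. partial_deriv i \<zeta> \<in> borel_measurable borel"
    using \<zeta> by (auto intro: smooth_borel_measurable smooth_partial_deriv)
  have uL: "in_L2 \<Omega> u" using u by (simp add: in_H1_def)
  have "\<forall>i. \<exists>g. is_weak_partial \<Omega> i u g \<and> in_L2 \<Omega> g" using u by (simp add: in_H1_def)
  then obtain g where g: "\<And>i. is_weak_partial \<Omega> i u (g i)" "\<And>i. in_L2 \<Omega> (g i)" by metis
  let ?h = "\<lambda>i x. \<zeta> x * g i x + partial_deriv i \<zeta> x * u x"
  have W: "is_weak_partial \<Omega> i (\<lambda>x. \<zeta> x * u x) (?h i)" for i
    by (rule is_weak_partial_smooth_mult[OF \<Omega> g(1) \<zeta>])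
  have "in_L2 \<Omega> (\<lambda>x. \<zeta> x * u x)" by (rule in_L2_bounded_mult[OF uL _ B(1)]) simp
  moreover have "in_L2 \<Omega> (?h i)" for i
    by (intro in_L2_add in_L2_bounded_mult[OF g(2) _ B(1)] in_L2_bounded_mult[OF uL _ B(2)]) simp_all
  ultimately show "in_H1 \<Omega> (\<lambda>x. \<zeta> x * u x)"
    using W unfolding in_H1_def by blast
  have "AE x in lebesgue_on \<Omega>. \<forall>i. weak_partial \<Omega> i u x = g i x \<and>
      weak_partial \<Omega> i (\<lambda>x. \<zeta> x * u x) x = ?h i x"
    by (intro eventually_all_finite eventually_conj weak_partial_props(2)[OF \<Omega> g(1)]
        weak_partial_props(2)[OF \<Omega> W])
  then show "AE x in lebesgue_on \<Omega>. weak_grad \<Omega> (\<lambda>x. \<zeta> x * u x) x =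
       \<zeta> x *\<^sub>R weak_grad \<Omega> u x + u x *\<^sub>R (\<chi> i. partial_deriv i \<zeta> x)"
    by eventually_elim (simp add: weak_grad_def vec_eq_iff mult.commute)
qed

text \<open>\<open>H1_cutoff_approx\<close> gives convergence to the derivatives of the product
  rule; what remains is to identify these almost everywhere with the representatives selected by
  \<open>weak_partial\<close>.\<close>

lemma in_H10_cutoff:
  fixes u :: "real^'n::finite \<Rightarrow> real"
  assumes \<Omega>: "open \<Omega>" and u: "in_H1 \<Omega> u" and \<eta>: "test_fun \<Omega> \<eta>"
  shows "in_H10 \<Omega> (\<lambda>x. \<eta> x * u x)"
proof -
  have "\<exists>B. \<forall>x. \<bar>partial_deriv i \<eta> x\<bar> \<le> B" for i
    using test_fun_bounded[OF test_fun_partial_deriv[OF \<eta>, of i]] by blast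
  then obtain B' where B': "\<And>i x. \<bar>partial_deriv i \<eta> x\<bar> \<le> B' i" by metis
  obtain B0 where B0: "\<And>x. \<bar>\<eta> x\<bar> \<le> B0" using test_fun_bounded[OF \<eta>] by blast
  define B where "B = max B0 (Max (range B'))"
  have B: "\<bar>\<eta> x\<bar> \<le> B" "\<bar>partial_deriv i \<eta> x\<bar> \<le> B" for i x
    using B0[of x] B'[of i x] Max_ge[of "range B'" "B' i"] by (auto simp: B_def le_max_iff_disj intro: order_trans)
  have uL: "in_L2 \<Omega> u" using u by (simp add: in_H1_def)
  have "\<forall>i. \<exists>g. is_weak_partial \<Omega> i u g \<and> in_L2 \<Omega> g" using u by (simp add: in_H1_def)
  then obtain g where g: "\<And>i. is_weak_partial \<Omega> i u (g i)" "\<And>i. in_L2 \<Omega> (g i)" by metis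
  let ?h = "\<lambda>i x. \<eta> x * g i x + partial_deriv i \<eta> x * u x"
  have W: "is_weak_partial \<Omega> i (\<lambda>x. \<eta> x * u x) (?h i)" for i
    by (rule is_weak_partial_smooth_mult[OF \<Omega> g(1) test_fun_smooth[OF \<eta>]])
  obtain \<phi> where \<phi>: "\<And>k::nat. test_fun \<Omega> (\<phi> k)"
     "(\<lambda>k. \<integral>x. (\<phi> k x - \<eta> x * u x)\<^sup>2 \<partial>lebesgue_on \<Omega>) \<longlonglongrightarrow> 0"
     "\<And>i. (\<lambda>k. \<integral>x. (partial_deriv i (\<phi> k) x - ?h i x)\<^sup>2 \<partial>lebesgue_on \<Omega>) \<longlonglongrightarrow> 0"
    using H1_cutoff_approx[OF \<Omega> \<eta> g(1) uL g(2)] by blast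
  have H1: "in_H1 \<Omega> (\<lambda>x. \<eta> x * u x)"
    by (rule in_H1_cutoff(1)[OF \<Omega> u test_fun_smooth[OF \<eta>] B])
  have eq: "(\<integral>x. (partial_deriv i (\<phi> k) x - weak_partial \<Omega> i (\<lambda>x. \<eta> x * u x) x)\<^sup>2 \<partial>lebesgue_on \<Omega>)
      = (\<integral>x. (partial_deriv i (\<phi> k) x - ?h i x)\<^sup>2 \<partial>lebesgue_on \<Omega>)" for i k
  proof (rule integral_cong_AE)
    have ae: "AE x in lebesgue_on \<Omega>. weak_partial \<Omega> i (\<lambda>x. \<eta> x * u x) x = ?h i x"
      by (rule weak_partial_props(2)[OF \<Omega> W])
    have [measurable]: "partial_deriv i (\<phi> k) \<in> borel_measurable (lebesgue_on \<Omega>)"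
      by (intro borel_measurable_lebesgue_on_borel smooth_borel_measurable smooth_partial_deriv test_fun_smooth[OF \<phi>(1)])
    have m[measurable]: "?h i \<in> borel_measurable (lebesgue_on \<Omega>)"
    proof -
      have "in_L2 \<Omega> (?h i)"
        by (intro in_L2_add in_L2_bounded_mult[OF g(2) _ B(1)] in_L2_bounded_mult[OF uL _ B(2)]
            smooth_borel_measurable smooth_partial_deriv test_fun_smooth[OF \<eta>])
      then show ?thesis by (simp add: in_L2_def)
    qed
    have [measurable]: "weak_partial \<Omega> i (\<lambda>x. \<eta> x * u x) \<in> borel_measurable (lebesgue_on \<Omega>)"
      by (rule borel_measurable_lebesgue_on_AE_eq[OF m ae]) (use \<Omega> in auto)
    show "(\<lambda>x. (partial_deriv i (\<phi> k) x - weak_partial \<Omega> i (\<lambda>x. \<eta> x * u x) x)\<^sup>2) \<in> borel_measurable (lebesgue_on \<Omega>)"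
      by measurable
    show "(\<lambda>x. (partial_deriv i (\<phi> k) x - ?h i x)\<^sup>2) \<in> borel_measurable (lebesgue_on \<Omega>)"
      by measurable
    show "AE x in lebesgue_on \<Omega>. (partial_deriv i (\<phi> k) x - weak_partial \<Omega> i (\<lambda>x. \<eta> x * u x) x)\<^sup>2 =
        (partial_deriv i (\<phi> k) x - ?h i x)\<^sup>2"
      using ae by eventually_elim simp
  qed
  show ?thesis
    unfolding in_H10_def
  proof (intro conjI H1 exI[of _ \<phi>] allI)
    show "test_fun \<Omega> (\<phi> k)" for k by (rule \<phi>(1))
    show "(\<lambda>k. \<integral>x. (\<phi> k x - \<eta> x * u x)\<^sup>2 \<partial>lebesgue_on \<Omega>) \<longlonglongrightarrow> 0" by (rule \<phi>(2))
    show "(\<lambda>k. \<integral>x. (partial_deriv i (\<phi> k) x - weak_partial \<Omega> i (\<lambda>x. \<eta> x * u x) x)\<^sup>2 \<partial>lebesgue_on \<Omega>)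
        \<longlonglongrightarrow> 0" for i unfolding eq by (rule \<phi>(3))
  qed
qed

section \<open>The double-well potential\<close>

lemma potential_deriv:
  assumes "continuous_on UNIV f"
  shows "(potential f has_real_derivative - f x) (at x)"
proof -
  \<comment> \<open>A symmetric interval with both 0 and \<open>x\<close> in its interior covers
    both orientations of the integral.\<close>
  define A where "A = \<bar>x\<bar> + 1"
  have "((\<lambda>u. LBINT y=ereal 0..ereal u. f y) has_vector_derivative f x) (at x within {-A..A})"
    using interval_integral_FTC2[of "-A" 0 A f x] continuous_on_subset[OF assms] by (simp add: A_def)
  then have "((\<lambda>u. LBINT y=ereal 0..ereal u. f y) has_real_derivative f x) (at x)"
    using at_within_interior[of x "{-A..A}"]
    by (simp add: has_real_derivative_iff_has_vector_derivative A_def interior_atLeastAtMost_real abs_if split: if_splits)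
  from DERIV_minus[OF this] show ?thesis
    by (simp add: potential_def[abs_def])
qed

text \<open>By l'Hopital's rule the quotient of \<open>potential f s\<close> by the square of
  \<open>s\<close> extends continuously to 0, with the positive value
  \<open>- deriv f 0 / 2\<close>. The bound \<open>\<beta> < 1\<close> keeps away the point 1, where
  positivity is not assumed, so the extrema of the quotient on compact intervals give both
  constants.\<close>

lemma potential_bounds:
  assumes fd: "\<And>x. f differentiable (at (x::real))" and f0: "f 0 = 0" "deriv f 0 < 0"
    and W: "potential f 0 = 0" "\<And>s. s \<noteq> 0 \<Longrightarrow> s \<noteq> 1 \<Longrightarrow> potential f s > 0"
    and \<beta>: "0 < \<beta>" "\<beta> < 1"
  shows "\<exists>c K. 0 < c \<and> 0 < K \<and> (\<forall>s. \<bar>s\<bar> \<le> \<beta> \<longrightarrow> c * s\<^sup>2 \<le> potential f s) \<and>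
      (\<forall>s. \<bar>s\<bar> \<le> 3/2 \<longrightarrow> potential f s \<le> K * s\<^sup>2)"
proof -
  have fc: "continuous_on UNIV f"
    using fd by (auto simp: continuous_on_eq_continuous_at differentiable_imp_continuous_within)
  note D = potential_deriv[OF fc]
  have Wc: "isCont (potential f) x" for x using D DERIV_isCont by blast
  define Q where "Q s = (if s = 0 then - deriv f 0 / 2 else potential f s / s\<^sup>2)" for s
  have f': "(f has_real_derivative deriv f 0) (at 0)"
    using fd[of 0] DERIV_deriv_iff_real_differentiable by blast
  have "((\<lambda>s. f s / s) \<longlongrightarrow> deriv f 0) (at 0)"
    using f' f0 by (simp add: DERIV_def)
  then have "((\<lambda>s. (f s / s) * (- 1 / 2)) \<longlongrightarrow> deriv f 0 * (- 1 / 2)) (at 0)"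
    by (intro tendsto_intros)
  then have L: "((\<lambda>s. - f s / (2 * s)) \<longlongrightarrow> - deriv f 0 / 2) (at 0)"
    by (simp add: field_simps)
  have "((\<lambda>s. potential f s / s\<^sup>2) \<longlongrightarrow> - deriv f 0 / 2) (at 0)"
  proof (rule lhopital[OF _ _ _ _ _ _ L])
    show "(potential f \<longlongrightarrow> 0) (at 0)" using Wc[of 0] W(1) by (simp add: isCont_def)
    show "((\<lambda>s::real. s\<^sup>2) \<longlongrightarrow> 0) (at 0)" by (rule tendsto_eq_intros | simp)+
    show "\<forall>\<^sub>F x in at (0::real). x\<^sup>2 \<noteq> 0" "\<forall>\<^sub>F x in at (0::real). 2 * x \<noteq> 0"
      by (auto simp: eventually_at_filter)
    show "\<forall>\<^sub>F x in at 0. (potential f has_real_derivative - f x) (at x)" using D by simp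
    show "\<forall>\<^sub>F x in at (0::real). ((\<lambda>s. s\<^sup>2) has_real_derivative 2 * x) (at x)"
      by (intro always_eventually allI) (auto intro!: derivative_eq_intros)
  qed
  then have "(Q \<longlongrightarrow> - deriv f 0 / 2) (at 0)"
    by (rule Lim_transform_eventually) (auto simp: eventually_at_filter Q_def)
  then have Q0: "isCont Q 0" by (simp add: isCont_def Q_def)
  have "isCont Q x" for x
  proof (cases "x = 0")
    case False
    have "isCont (\<lambda>s. potential f s / s\<^sup>2) x" using False Wc by (intro continuous_intros) auto
    moreover have "\<forall>\<^sub>F s in nhds x. potential f s / s\<^sup>2 = Q s"
    proof -
      have "\<forall>\<^sub>F s in nhds x. s \<in> - {0}"
        using False by (intro eventually_nhds_in_open) (auto simp: open_Compl)
      then show ?thesis by eventually_elim (simp add: Q_def)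
    qed
    ultimately show ?thesis by (simp only: isCont_cong)
  qed (use Q0 in simp)
  then have Qc: "continuous_on S Q" for S by (simp add: continuous_at_imp_continuous_on)
  have eq: "potential f s = Q s * s\<^sup>2" for s using W(1) by (simp add: Q_def)
  obtain s0 where s0: "s0 \<in> {-\<beta>..\<beta>}" "\<forall>s\<in>{-\<beta>..\<beta>}. Q s0 \<le> Q s"
    using continuous_attains_inf[of "{-\<beta>..\<beta>}" Q] Qc \<beta> by auto
  have "Q s0 > 0" using s0(1) W(2)[of s0] f0 \<beta> by (auto simp: Q_def)
  moreover obtain s1 where s1: "s1 \<in> {-3/2..3/2}" "\<forall>s\<in>{-3/2..3/2}. Q s \<le> Q s1"
    using continuous_attains_sup[of "{-3/2..3/2}" Q] Qc by auto
  moreover have "c * s\<^sup>2 \<le> potential f s" if "\<forall>s\<in>{-\<beta>..\<beta>}. c \<le> Q s" "\<bar>s\<bar> \<le> \<beta>" for c s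
    unfolding eq using that by (intro mult_right_mono) (auto simp: abs_le_iff)
  moreover have "potential f s \<le> max 1 (Q s1) * s\<^sup>2" if "\<bar>s\<bar> \<le> 3/2" for s
  proof -
    have "s \<in> {-3/2..3/2}" using that by auto
    then have "Q s \<le> max 1 (Q s1)" using s1(2) by (metis max.coboundedI2)
    then show ?thesis unfolding eq by (intro mult_right_mono) auto
  qed
  ultimately show ?thesis using s0 by (intro exI[of _ "Q s0"] exI[of _ "max 1 (Q s1)"]) auto
qed

section \<open>Caratheodory functions\<close>

text \<open>Rounding \<open>v\<close> down to multiples of 1/(k+1) gives functions with countably
  many values, for which measurability in \<open>x\<close> at fixed \<open>s\<close> suffices.
  Continuity in \<open>s\<close> passes to the limit.\<close>

lemma caratheodory_measurable:
  fixes v :: "real^'n::finite \<Rightarrow> real"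
  assumes G: "caratheodory \<Omega> G" and v[measurable]: "v \<in> borel_measurable (lebesgue_on \<Omega>)"
    and \<Omega>: "\<Omega> \<in> sets lebesgue"
  shows "(\<lambda>x. G x (v x)) \<in> borel_measurable (lebesgue_on \<Omega>)"
proof -
  define q where "q k x = \<lfloor>real (Suc k) * v x\<rfloor>" for k x
  define w where "w k x = G x (real_of_int (q k x) / real (Suc k))" for k x
  have [measurable]: "q k \<in> measurable (lebesgue_on \<Omega>) (count_space UNIV)" for k
    unfolding q_def by measurable
  have [measurable]: "(\<lambda>x. G x s) \<in> borel_measurable (lebesgue_on \<Omega>)" for s
    using G by (simp add: caratheodory_def)
  have [measurable]: "w k \<in> borel_measurable (lebesgue_on \<Omega>)" for k
    unfolding w_def
    by (rule measurable_compose_countable[of "\<lambda>i x. G x (real_of_int i / real (Suc k))" _ _ "q k"]) measurable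
  have qlim: "(\<lambda>k. real_of_int (q k x) / real (Suc k)) \<longlonglongrightarrow> v x" for x
  proof (rule tendsto_sandwich[of "\<lambda>k. v x - 1 / real (Suc k)" _ _ "\<lambda>k. v x"])
    have *: "real (Suc k) * v x - 1 \<le> real_of_int (q k x)" "real_of_int (q k x) \<le> real (Suc k) * v x" for k
      unfolding q_def by linarith+
    show "\<forall>\<^sub>F k in sequentially. v x - 1 / real (Suc k) \<le> real_of_int (q k x) / real (Suc k)"
    proof (intro always_eventually allI)
      fix k
      have "v x - 1 / real (Suc k) = (real (Suc k) * v x - 1) / real (Suc k)" by (simp add: diff_divide_distrib)
      also have "\<dots> \<le> real_of_int (q k x) / real (Suc k)" by (intro divide_right_mono *) simp
      finally show "v x - 1 / real (Suc k) \<le> real_of_int (q k x) / real (Suc k)" .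
    qed
    show "\<forall>\<^sub>F k in sequentially. real_of_int (q k x) / real (Suc k) \<le> v x"
    proof (intro always_eventually allI)
      fix k
      have "real_of_int (q k x) / real (Suc k) \<le> (real (Suc k) * v x) / real (Suc k)" by (intro divide_right_mono *) simp
      then show "real_of_int (q k x) / real (Suc k) \<le> v x" by simp
    qed
    show "(\<lambda>k. v x - 1 / real (Suc k)) \<longlonglongrightarrow> v x" by real_asymp
  qed simp
  have "AE x in lebesgue_on \<Omega>. continuous_on UNIV (G x)" using G by (simp add: caratheodory_def)
  then have "AE x in lebesgue_on \<Omega>. G x (v x) = lim (\<lambda>k. w k x)"
  proof eventually_elim
    case (elim x)
    have "(\<lambda>k. w k x) \<longlonglongrightarrow> G x (v x)"
      unfolding w_def by (rule continuous_on_tendsto_compose[OF elim qlim]) auto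
    then show ?case by (simp add: limI)
  qed
  from borel_measurable_lebesgue_on_AE_eq[OF _ this \<Omega>] show ?thesis by measurable
qed

lemma Linf_norm_nonneg_bound:
  fixes u :: "'a::euclidean_space \<Rightarrow> real"
  assumes "Linf_norm \<Omega> u \<le> ereal c"
  shows "AE x in lebesgue_on \<Omega>. \<bar>u x\<bar> \<le> c"
proof -
  have "AE x in lebesgue_on \<Omega>. ereal (norm (u x)) \<le> Linf_norm \<Omega> u"
    unfolding Linf_norm_def by (rule esssup_AE)
  then show ?thesis
  proof eventually_elim
    case (elim x)
    then have "ereal \<bar>u x\<bar> \<le> ereal c" using assms by (metis order_trans real_norm_def)
    then show ?case by simp
  qed
qed

text \<open>By Fubini the essential bound on the product holds, for almost every \<open>x\<close>,
  at almost every \<open>s\<close>; continuity extends it to every \<open>s\<close>, endpoints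
  included. A bound for almost every \<open>s\<close> would be of no use, because \<open>G x\<close>
  is evaluated at the single point \<open>u x\<close>.\<close>

lemma caratheodory_bound:
  fixes G :: "real^'n::finite \<Rightarrow> real \<Rightarrow> real"
  assumes G: "caratheodory \<Omega> G" and \<Omega>: "open \<Omega>" and ab: "a < b"
    and M: "Linf_norm (\<Omega> \<times> {a<..<b}) (\<lambda>(x, s). G x s) \<le> ereal M"
  shows "AE x in lebesgue_on \<Omega>. \<forall>s\<in>{a..b}. \<bar>G x s\<bar> \<le> M"
proof -
  have "open (\<Omega> \<times> {a<..<b})" using \<Omega> by (intro open_Times) auto
  then have \<Omega>2: "\<Omega> \<times> {a<..<b} \<in> sets lebesgue" by auto
  have \<Omega>m: "\<Omega> \<in> sets lebesgue" using \<Omega> by auto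
  have "AE p in lebesgue. p \<in> \<Omega> \<times> {a<..<b} \<longrightarrow> \<bar>case p of (x, s) \<Rightarrow> G x s\<bar> \<le> M"
    using Linf_norm_nonneg_bound[OF M] unfolding AE_lebesgue_on_iff[OF \<Omega>2] .
  then have "AE p in lborel. p \<in> \<Omega> \<times> {a<..<b} \<longrightarrow> \<bar>case p of (x, s) \<Rightarrow> G x s\<bar> \<le> M"
    by (simp only: AE_completion_iff)
  then have "AE x in (lborel :: (real^'n) measure). AE s in (lborel :: real measure).
      (x, s) \<in> \<Omega> \<times> {a<..<b} \<longrightarrow> \<bar>case (x, s) of (x, s) \<Rightarrow> G x s\<bar> \<le> M"
    unfolding lborel_prod[symmetric] by (rule lborel_pair.AE_pair)
  from AE_completion[OF this]
  have 1: "AE x in lebesgue. AE s in (lborel :: real measure). x \<in> \<Omega> \<and> s \<in> {a<..<b} \<longrightarrow> \<bar>G x s\<bar> \<le> M"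
    by simp
  have 2: "AE x in lebesgue. x \<in> \<Omega> \<longrightarrow> continuous_on UNIV (G x)"
    using G unfolding caratheodory_def AE_lebesgue_on_iff[OF \<Omega>m] by blast
  have "AE x in lebesgue. x \<in> \<Omega> \<longrightarrow> (\<forall>s\<in>{a..b}. \<bar>G x s\<bar> \<le> M)"
    using 1 2
  proof eventually_elim
    case (elim x)
    show ?case
    proof (intro impI ballI, rule ccontr)
      fix s assume x: "x \<in> \<Omega>" and s: "s \<in> {a..b}" and n: "\<not> \<bar>G x s\<bar> \<le> M"
      define U where "U = {t. M < \<bar>G x t\<bar>} \<inter> {a<..<b}"
      have c: "continuous_on UNIV (G x)" using elim x by blast
      have o: "open {t. M < \<bar>G x t\<bar>}"
        using c by (intro open_Collect_less continuous_intros)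
      have "s \<in> closure {a<..<b}" using s ab by simp
      then have "U \<noteq> {}"
        using o n unfolding U_def by (subst inf.commute, subst (asm) closure_iff_nhds_not_empty) force
      moreover have "open U" unfolding U_def using o by auto
      moreover have "negligible U"
      proof -
        have "AE t in lborel. t \<notin> U" using elim(1) by eventually_elim (use x in \<open>auto simp: U_def\<close>)
        then have "AE t in lebesgue. t \<notin> U" by (rule AE_completion)
        then show ?thesis using \<open>open U\<close> by (subst negligible_iff_null_sets) (subst AE_iff_null_sets, auto)
      qed
      ultimately show False using open_not_negligible by blast
    qed
  qed
  then show ?thesis unfolding AE_lebesgue_on_iff[OF \<Omega>m] .
qed

section \<open>Radial cutoff functions\<close>

text \<open>A transition layer of width 1/2 leaves room inside a unit shell, so that the support is
  compact in the open ball of radius \<open>s + 1\<close>. The bound \<open>C\<close> is kept as a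
  parameter because one value has to serve all \<open>s\<close>.\<close>

definition radial_cutoff :: "real \<Rightarrow> real \<Rightarrow> (real^'n::finite \<Rightarrow> real) \<Rightarrow> bool" where
  "radial_cutoff C s \<zeta> \<longleftrightarrow> smooth \<zeta> \<and> (\<forall>x. 0 \<le> \<zeta> x \<and> \<zeta> x \<le> 1) \<and> (\<forall>x. norm x < s \<longrightarrow> \<zeta> x = 1) \<and>
     (\<forall>x. s + 1/2 \<le> norm x \<longrightarrow> \<zeta> x = 0) \<and> (\<forall>x. norm (\<chi> i. partial_deriv i \<zeta> x) \<le> C)"

lemma radial_cutoffD:
  assumes "radial_cutoff C s \<zeta>"
  shows "smooth \<zeta>" "0 \<le> \<zeta> x" "\<zeta> x \<le> 1" "norm x < s \<Longrightarrow> \<zeta> x = 1" "s + 1/2 \<le> norm x \<Longrightarrow> \<zeta> x = 0"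
    "norm (\<chi> i. partial_deriv i \<zeta> x) \<le> C" "0 \<le> C"
proof -
  show "norm (\<chi> i. partial_deriv i \<zeta> x) \<le> C" for x using assms by (simp add: radial_cutoff_def)
  from order_trans[OF norm_ge_zero this] show "0 \<le> C" .
qed (use assms in \<open>auto simp: radial_cutoff_def\<close>)

lemma radial_cutoff_partial_deriv:
  fixes \<zeta> :: "real^'n::finite \<Rightarrow> real"
  assumes "radial_cutoff C s \<zeta>"
  shows "norm x < s \<Longrightarrow> partial_deriv i \<zeta> x = 0" "s + 1/2 < norm x \<Longrightarrow> partial_deriv i \<zeta> x = 0"
proof -
  show "partial_deriv i \<zeta> x = 0" if "norm x < s"
    by (rule partial_deriv_eq_0_open[where S = "ball 0 s" and c = 1])
      (use that radial_cutoffD(4)[OF assms] in auto)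
  show "partial_deriv i \<zeta> x = 0" if "s + 1/2 < norm x"
    by (rule partial_deriv_eq_0_open[where S = "- cball 0 (s + 1/2)" and c = 0])
      (use that radial_cutoffD(5)[OF assms] in \<open>auto intro: open_Compl\<close>)
qed

lemma test_fun_radial_cutoff:
  fixes \<zeta> :: "real^'n::finite \<Rightarrow> real"
  assumes "radial_cutoff C s \<zeta>" "s + 1/2 < \<rho>"
  shows "test_fun (ball 0 \<rho>) \<zeta>"
  by (rule test_funI[of _ "cball 0 (s + 1/2)"])
    (use assms radial_cutoffD[OF assms(1)] in \<open>auto simp: not_le\<close>)

lemma ex_radial_cutoff:
  "\<exists>C>0. \<forall>s>0. \<exists>\<zeta>::real^'n::finite \<Rightarrow> real. radial_cutoff C s \<zeta>"
proof -
  let ?c = "\<lambda>i. \<integral>y. \<bar>partial_deriv i (mollifier (1/4) :: real^'n \<Rightarrow> real) y\<bar> \<partial>lborel"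
  define C where "C = 1 + (\<Sum>i\<in>(UNIV::'n set). ?c i)"
  have "0 \<le> (\<Sum>i\<in>(UNIV::'n set). ?c i)" by (intro sum_nonneg Bochner_Integration.integral_nonneg) auto
  then have "C > 0" by (simp add: C_def)
  \<comment> \<open>The radius \<open>s + 1/4\<close> is the middle of the layer, and smoothing at
    scale 1/4 reaches exactly to its two ends.\<close>
  moreover have "radial_cutoff C s (conv (indicator (ball (0::real^'n) (s + 1/4))) (mollifier (1/4)))" for s
    unfolding radial_cutoff_def
  proof (intro conjI allI impI)
    let ?A = "ball (0::real^'n) (s + 1/4)"
    let ?\<zeta> = "conv (indicator ?A) (mollifier (1/4))"
    have A: "?A \<in> sets borel" "bounded ?A" "(0::real) < 1/4" by auto
    note * = conv_indicator_mollifier[OF A]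
    show "smooth ?\<zeta>" "0 \<le> ?\<zeta> x" "?\<zeta> x \<le> 1" for x by (rule *)+
    show "?\<zeta> x = 1" if "norm x < s" for x
    proof (rule *(4), rule subsetI)
      fix y assume "y \<in> ball x (1/4)"
      then show "y \<in> ?A" using that norm_triangle_ineq2[of y x] by (simp add: dist_norm norm_minus_commute)
    qed
    show "?\<zeta> x = 0" if "s + 1/2 \<le> norm x" for x
    proof (rule *(5), rule ccontr)
      assume "ball x (1/4) \<inter> ?A \<noteq> {}"
      then obtain y where "norm (x - y) < 1/4" "norm y < s + 1/4" by (auto simp: dist_norm)
      then show False using that norm_triangle_ineq2[of x y] by simp
    qed
    show "norm (\<chi> i. partial_deriv i ?\<zeta> x) \<le> C" for x
    proof -
      have "norm (\<chi> i. partial_deriv i ?\<zeta> x) \<le> (\<Sum>i\<in>UNIV. \<bar>partial_deriv i ?\<zeta> x\<bar>)"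
        using norm_le_l1_cart[of "\<chi> i. partial_deriv i ?\<zeta> x"] by simp
      also have "\<dots> \<le> (\<Sum>i\<in>(UNIV::'n set). ?c i)" by (intro sum_mono *(6))
      finally show ?thesis by (simp add: C_def)
    qed
  qed
  ultimately show ?thesis by blast
qed

section \<open>The quadratic form of the energy\<close>

lemma matrix_form_sym:
  fixes A :: "real^'n::finite^'n"
  assumes "transpose A = A"
  shows "(A *v x) \<bullet> y = (A *v y) \<bullet> x"
proof -
  have "(A *v x) \<bullet> y = x \<bullet> (A *v y)"
    using dot_lmul_matrix[of x A y] assms by (metis vector_transpose_matrix)
  then show ?thesis by (simp add: inner_commute)
qed

text \<open>This is the reason for the square in the competitor \<open>(1 - \<zeta>\<^sup>2) u\<close>: the cross term is
  absorbed because \<open>\<bar>\<nabla>(\<zeta>\<^sup>2)\<bar>\<^sup>2 \<le> 4 \<zeta>\<^sup>2 \<bar>\<nabla>\<zeta>\<bar>\<^sup>2\<close>.\<close>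

lemma cutoff_form_estimate:
  fixes A :: "real^'n::finite^'n" and p q :: "real^'n" and z t :: real
  assumes sym: "transpose A = A" and pos: "\<And>\<xi>. 0 \<le> (A *v \<xi>) \<bullet> \<xi>" and z: "0 \<le> z" "z \<le> 1"
  defines "P \<equiv> (1 - z\<^sup>2) *\<^sub>R p + t *\<^sub>R ((- 2 * z) *\<^sub>R q)"
  shows "z\<^sup>2 / 2 * ((A *v p) \<bullet> p) - 12 * t\<^sup>2 * ((A *v q) \<bullet> q) \<le> (A *v p) \<bullet> p - (A *v P) \<bullet> P"
proof -
  define pp pq qq where "pp = (A *v p) \<bullet> p" and "pq = (A *v p) \<bullet> q" and "qq = (A *v q) \<bullet> q"
  have qp: "(A *v q) \<bullet> p = pq" unfolding pq_def by (rule matrix_form_sym[OF sym])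
  have ex: "(A *v (c *\<^sub>R p + d *\<^sub>R q)) \<bullet> (c *\<^sub>R p + d *\<^sub>R q) = c\<^sup>2 * pp + 2 * c * d * pq + d\<^sup>2 * qq" for c d
    by (simp add: matrix_vector_right_distrib scaleR_matrix_vector_assoc[symmetric] matrix_vector_mult_scaleR
        inner_add_left inner_add_right pp_def[symmetric] pq_def[symmetric] qq_def[symmetric] qp
        power2_eq_square algebra_simps)
  have nn: "0 \<le> pp" "0 \<le> qq" unfolding pp_def qq_def by (rule pos)+
  \<comment> \<open>Positivity of the form at \<open>z *\<^sub>R p + (4 * t) *\<^sub>R q\<close> is
    Young's inequality for the cross term, weighted so that only half of
    \<open>z\<^sup>2 * pp\<close> is lost. The coefficient 8 obtained here and the 4 from the square
    of the last term add up to 12.\<close>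
  have "0 \<le> z\<^sup>2 * pp + 2 * z * (4 * t) * pq + (4 * t)\<^sup>2 * qq"
    using pos[of "z *\<^sub>R p + (4 * t) *\<^sub>R q"] unfolding ex .
  then have cross: "- (z\<^sup>2 * pp / 2 + 8 * t\<^sup>2 * qq) \<le> 4 * z * t * pq"
    by (simp add: power2_eq_square algebra_simps)
  have z2: "0 \<le> z\<^sup>2" "z\<^sup>2 \<le> 1" using z by (auto simp: power_le_one)
  have "(1 - z\<^sup>2) * (- (z\<^sup>2 * pp / 2 + 8 * t\<^sup>2 * qq)) \<le> (1 - z\<^sup>2) * (4 * z * t * pq)"
    using cross z2 by (intro mult_left_mono) auto
  moreover have "- (z\<^sup>2 * pp / 2 + 8 * t\<^sup>2 * qq) \<le> (1 - z\<^sup>2) * (- (z\<^sup>2 * pp / 2 + 8 * t\<^sup>2 * qq))"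
  proof -
    have "(1 - z\<^sup>2) * (z\<^sup>2 * pp / 2 + 8 * t\<^sup>2 * qq) \<le> 1 * (z\<^sup>2 * pp / 2 + 8 * t\<^sup>2 * qq)"
      using nn z2 by (intro mult_right_mono) auto
    then show ?thesis by (simp only: mult_minus_right neg_le_iff_le mult_1)
  qed
  moreover have "P = (1 - z\<^sup>2) *\<^sub>R p + (- 2 * z * t) *\<^sub>R q" by (simp add: P_def)
  then have "(A *v P) \<bullet> P = (1 - z\<^sup>2)\<^sup>2 * pp - (1 - z\<^sup>2) * (4 * z * t * pq) + 4 * z\<^sup>2 * t\<^sup>2 * qq"
    by (simp only: ex) (simp add: power2_eq_square algebra_simps)
  moreover have "(1 - z\<^sup>2)\<^sup>2 * pp \<le> (1 - z\<^sup>2) * pp"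
    using z2 nn by (intro mult_right_mono) (simp_all add: power2_eq_square mult_left_le_one_le)
  moreover have "4 * z\<^sup>2 * t\<^sup>2 * qq \<le> 4 * t\<^sup>2 * qq"
    using z2 nn mult_right_mono[of "z\<^sup>2" 1 "t\<^sup>2 * qq"] by (simp add: mult.assoc)
  moreover have "(1 - z\<^sup>2) * pp = pp - z\<^sup>2 * pp" "z\<^sup>2 / 2 * pp = z\<^sup>2 * pp / 2"
    by (simp_all add: algebra_simps)
  ultimately have "z\<^sup>2 / 2 * pp - 12 * t\<^sup>2 * qq \<le> pp - (A *v P) \<bullet> P"
    by linarith
  then show ?thesis by (simp add: pp_def qq_def)
qed

section \<open>The energy estimate\<close>

lemma matrix_form_measurable:
  fixes A :: "'a \<Rightarrow> real^'n::finite^'n" and p :: "'a \<Rightarrow> real^'n"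
  assumes A: "A \<in> borel_measurable M" and [measurable]: "\<And>i. (\<lambda>x. p x $ i) \<in> borel_measurable M"
  shows "(\<lambda>x. (A x *v p x) \<bullet> p x) \<in> borel_measurable M"
proof -
  have [measurable]: "(\<lambda>x. A x $ i $ j) \<in> borel_measurable M" for i j
    by (rule measurable_compose[OF A borel_measurable_continuous_onI]) (intro continuous_intros)
  have eq: "(A x *v p x) \<bullet> p x = (\<Sum>i\<in>UNIV. (\<Sum>j\<in>UNIV. A x $ i $ j * p x $ j) * p x $ i)" for x
    by (simp add: inner_vec_def matrix_vector_mult_def)
  show ?thesis unfolding eq by measurable
qed

lemma in_H1_weak_partial:
  fixes u :: "real^'n::finite \<Rightarrow> real"
  assumes \<Omega>: "open \<Omega>" and u: "in_H1 \<Omega> u"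
  shows "is_weak_partial \<Omega> i u (weak_partial \<Omega> i u)" "in_L2 \<Omega> (weak_partial \<Omega> i u)"
proof -
  obtain g where g: "is_weak_partial \<Omega> i u g" "in_L2 \<Omega> g" using u unfolding in_H1_def by blast
  note w = weak_partial_props[OF \<Omega> g(1)]
  show "is_weak_partial \<Omega> i u (weak_partial \<Omega> i u)" by (rule w(1))
  have gm: "g \<in> borel_measurable (lebesgue_on \<Omega>)" and gi: "integrable (lebesgue_on \<Omega>) (\<lambda>x. (norm (g x))\<^sup>2)"
    using g by (auto simp: in_L2_def)
  have m: "weak_partial \<Omega> i u \<in> borel_measurable (lebesgue_on \<Omega>)"
    by (rule borel_measurable_lebesgue_on_AE_eq[OF gm w(2)]) (use \<Omega> in auto)
  have "integrable (lebesgue_on \<Omega>) (\<lambda>x. (norm (weak_partial \<Omega> i u x))\<^sup>2)"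
  proof (rule iffD1[OF integrable_cong_AE gi])
    show "(\<lambda>x. (norm (g x))\<^sup>2) \<in> borel_measurable (lebesgue_on \<Omega>)" using gm by measurable
    show "(\<lambda>x. (norm (weak_partial \<Omega> i u x))\<^sup>2) \<in> borel_measurable (lebesgue_on \<Omega>)" using m by measurable
    show "AE x in lebesgue_on \<Omega>. (norm (g x))\<^sup>2 = (norm (weak_partial \<Omega> i u x))\<^sup>2"
      using w(2) by eventually_elim simp
  qed
  with m show "in_L2 \<Omega> (weak_partial \<Omega> i u)" by (simp add: in_L2_def)
qed

lemma norm_power2_vec: "(norm (x :: real^'n::finite))\<^sup>2 = (\<Sum>i\<in>UNIV. (x $ i)\<^sup>2)"
  unfolding power2_norm_eq_inner inner_vec_def by (simp add: power2_eq_square)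

lemma in_H1_weak_grad:
  fixes u :: "real^'n::finite \<Rightarrow> real"
  assumes \<Omega>: "open \<Omega>" and u: "in_H1 \<Omega> u"
  shows "(\<lambda>x. weak_grad \<Omega> u x $ i) \<in> borel_measurable (lebesgue_on \<Omega>)"
    "integrable (lebesgue_on \<Omega>) (\<lambda>x. (norm (weak_grad \<Omega> u x))\<^sup>2)"
proof -
  note w = in_H1_weak_partial(2)[OF \<Omega> u]
  show "(\<lambda>x. weak_grad \<Omega> u x $ i) \<in> borel_measurable (lebesgue_on \<Omega>)"
    using w[of i] by (simp add: weak_grad_def in_L2_def)
  have "integrable (lebesgue_on \<Omega>) (\<lambda>x. \<Sum>i\<in>UNIV. (weak_partial \<Omega> i u x)\<^sup>2)"
    using w by (intro Bochner_Integration.integrable_sum) (simp add: in_L2_def)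
  then show "integrable (lebesgue_on \<Omega>) (\<lambda>x. (norm (weak_grad \<Omega> u x))\<^sup>2)"
    by (simp add: norm_power2_vec weak_grad_def)
qed

text \<open>The hypotheses are reduced to the numbers that enter the estimates: \<open>M\<close> is
  any bound of \<open>G\<close> on the range of \<open>u\<close>, and \<open>c\<^sub>W\<close> and
  \<open>K\<^sub>W\<close> compare the potential with a quadratic. Constants expressed through these
  parameters are common to all minimizers.\<close>

locale bounded_minimizer =
  fixes \<rho> lam M c\<^sub>W K\<^sub>W \<beta> :: real and f :: "real \<Rightarrow> real" and a :: "real^'n::finite \<Rightarrow> real^'n^'n"
    and b :: "real^'n \<Rightarrow> real" and G :: "real^'n \<Rightarrow> real \<Rightarrow> real" and u :: "real^'n \<Rightarrow> real"
  assumes lam: "lam > 0" and M: "M \<ge> 0" and \<beta>: "0 < \<beta>" "\<beta> < 1"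
    and a_measurable: "a \<in> borel_measurable (lebesgue_on (ball 0 \<rho>))"
    and a_sym: "\<And>x. x \<in> ball 0 \<rho> \<Longrightarrow> transpose (a x) = a x"
    and a_lower: "\<And>x \<xi>. x \<in> ball 0 \<rho> \<Longrightarrow> lam * (norm \<xi>)\<^sup>2 \<le> (a x *v \<xi>) \<bullet> \<xi>"
    and a_upper: "\<And>x \<xi>. x \<in> ball 0 \<rho> \<Longrightarrow> (a x *v \<xi>) \<bullet> \<xi> \<le> inverse lam * (norm \<xi>)\<^sup>2"
    and b_measurable: "b \<in> borel_measurable (lebesgue_on (ball 0 \<rho>))"
    and b_bounds: "\<And>x. x \<in> ball 0 \<rho> \<Longrightarrow> lam \<le> b x" "\<And>x. x \<in> ball 0 \<rho> \<Longrightarrow> b x \<le> inverse lam"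
    and G: "caratheodory (ball 0 \<rho>) G"
    and G_bound: "AE x in lebesgue_on (ball 0 \<rho>). \<forall>s\<in>{-1/2..3/2}. \<bar>G x s\<bar> \<le> M"
    and min: "is_minimizer (ball 0 \<rho>) f a b G u"
    and u_bound: "AE x in lebesgue_on (ball 0 \<rho>). \<bar>u x - 1/2\<bar> \<le> 1"
    and W_cont: "continuous_on UNIV (potential f)" and W_0: "potential f 0 = 0"
    and W_nonneg: "\<And>s. 0 \<le> potential f s"
    and W_lower: "\<And>s. \<bar>s\<bar> \<le> \<beta> \<Longrightarrow> c\<^sub>W * s\<^sup>2 \<le> potential f s" "c\<^sub>W > 0"
    and W_upper: "\<And>s. \<bar>s\<bar> \<le> 3/2 \<Longrightarrow> potential f s \<le> K\<^sub>W * s\<^sup>2" "K\<^sub>W > 0"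
begin

abbreviation \<Omega> :: "(real^'n) set" where "\<Omega> \<equiv> ball 0 \<rho>"
abbreviation \<mu> :: "(real^'n) measure" where "\<mu> \<equiv> lebesgue_on \<Omega>"
abbreviation W :: "real \<Rightarrow> real" where "W \<equiv> potential f"
abbreviation Du :: "real^'n \<Rightarrow> real^'n" where "Du \<equiv> weak_grad \<Omega> u"

definition dens :: "real^'n \<Rightarrow> real" where
  "dens x = (a x *v Du x) \<bullet> Du x + b x * W (u x)"

text \<open>Integrating an indicator over the fixed domain, instead of integrating over the smaller
  ball, makes these functions meaningful for every real \<open>s\<close>. In particular
  \<open>\<Phi>\<close> is monotone on the whole line, as the iteration lemma requires.\<close>

definition E :: "real \<Rightarrow> real" where "E s = (\<integral>x. indicator (ball 0 s) x * dens x \<partial>\<mu>)"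
definition \<Phi> :: "real \<Rightarrow> real" where "\<Phi> s = (\<integral>x. indicator (ball 0 s) x * (u x)\<^sup>2 \<partial>\<mu>)"
definition V :: "real \<Rightarrow> real" where "V s = (\<integral>x. indicator ({x. \<bar>u x\<bar> > \<beta>} \<inter> ball 0 s) x \<partial>\<mu>)"

lemma \<Omega>_measurable: "\<Omega> \<in> sets lebesgue" by auto

lemma finite_\<mu>: "finite_measure \<mu>"
  by (rule finite_measure_lebesgue_on) auto

lemma bounded_integrable:
  fixes h :: "real^'n \<Rightarrow> real"
  assumes "h \<in> borel_measurable \<mu>" "AE x in \<mu>. \<bar>h x\<bar> \<le> B"
  shows "integrable \<mu> h"
  using finite_measure.integrable_const_bound[OF finite_\<mu>, of h B] assms by simp

lemma in_\<Omega>: "AE x in \<mu>. x \<in> \<Omega>" by (rule AE_I2) simp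

lemma H1: "in_H1 \<Omega> u" and u_measurable[measurable]: "u \<in> borel_measurable \<mu>"
  and integrable_energy: "integrable \<mu> (energy_density \<Omega> f a b G u)"
  using min by (auto simp: is_minimizer_def admissible_def in_Linf_def)

lemma a_form_nonneg: "x \<in> \<Omega> \<Longrightarrow> 0 \<le> (a x *v \<xi>) \<bullet> \<xi>"
  using a_lower[of x \<xi>] lam by (meson mult_nonneg_nonneg less_imp_le order_trans zero_le_power2)

lemma b_pos: "x \<in> \<Omega> \<Longrightarrow> 0 \<le> b x"
  using b_bounds(1)[of x] lam by linarith

lemma W_measurable[measurable]: "W \<in> borel_measurable borel"
  by (rule borel_measurable_continuous_onI[OF W_cont])

lemma u_range: "AE x in \<mu>. u x \<in> {-1/2..3/2}"
  using u_bound by eventually_elim (auto simp: abs_le_iff)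

lemma integrable_bounded_energy:
  assumes v: "in_H1 \<Omega> v" "AE x in \<mu>. v x \<in> {-1/2..3/2}"
  shows "integrable \<mu> (\<lambda>x. (a x *v weak_grad \<Omega> v x) \<bullet> weak_grad \<Omega> v x)"
    "integrable \<mu> (\<lambda>x. b x * W (v x))" "integrable \<mu> (\<lambda>x. G x (v x))"
proof -
  have vm[measurable]: "v \<in> borel_measurable \<mu>" using v by (simp add: in_H1_def in_L2_def)
  have [measurable]: "b \<in> borel_measurable \<mu>" by (rule b_measurable)
  note Dv = in_H1_weak_grad[OF open_ball v(1)]
  have I: "integrable \<mu> (\<lambda>x. inverse lam * (norm (weak_grad \<Omega> v x))\<^sup>2)" using Dv(2) by simp
  show "integrable \<mu> (\<lambda>x. (a x *v weak_grad \<Omega> v x) \<bullet> weak_grad \<Omega> v x)"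
  proof (rule Bochner_Integration.integrable_bound[OF I])
    show "(\<lambda>x. (a x *v weak_grad \<Omega> v x) \<bullet> weak_grad \<Omega> v x) \<in> borel_measurable \<mu>"
      by (rule matrix_form_measurable[OF a_measurable Dv(1)])
    show "AE x in \<mu>. norm ((a x *v weak_grad \<Omega> v x) \<bullet> weak_grad \<Omega> v x)
        \<le> norm (inverse lam * (norm (weak_grad \<Omega> v x))\<^sup>2)"
      using in_\<Omega>
    proof eventually_elim
      case (elim x)
      then show ?case
        using a_form_nonneg[OF elim, of "weak_grad \<Omega> v x"] a_upper[OF elim, of "weak_grad \<Omega> v x"]
        by auto
    qed
  qed
  show "integrable \<mu> (\<lambda>x. b x * W (v x))"
  proof (rule bounded_integrable[where B = "inverse lam * (K\<^sub>W * (3/2)\<^sup>2)"])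
    show "AE x in \<mu>. \<bar>b x * W (v x)\<bar> \<le> inverse lam * (K\<^sub>W * (3/2)\<^sup>2)"
      using in_\<Omega> v(2)
    proof eventually_elim
      case (elim x)
      have v: "\<bar>v x\<bar> \<le> 3/2" using elim(2) by auto
      have "(v x)\<^sup>2 \<le> (3/2)\<^sup>2" using power_mono[OF v, of 2] by simp
      then have "W (v x) \<le> K\<^sub>W * (3/2)\<^sup>2"
        using W_upper(1)[OF v] W_upper(2) by (meson less_imp_le mult_left_mono order_trans)
      then show ?case
        using b_pos[OF elim(1)] b_bounds(2)[OF elim(1)] W_nonneg[of "v x"]
        by (simp only: abs_mult abs_of_nonneg) (intro mult_mono, use lam in \<open>auto intro: order_trans\<close>)
    qed
  qed measurable
  show "integrable \<mu> (\<lambda>x. G x (v x))"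
  proof (rule bounded_integrable[where B = M])
    show "(\<lambda>x. G x (v x)) \<in> borel_measurable \<mu>"
      by (rule caratheodory_measurable[OF G vm \<Omega>_measurable])
    show "AE x in \<mu>. \<bar>G x (v x)\<bar> \<le> M"
      using G_bound v(2) by eventually_elim blast
  qed
qed

text \<open>On the range [-1/2, 3/2] the potential and \<open>G\<close> are bounded, so
  integrability of the energy density never excludes a competitor with values there.\<close>

lemma admissible_bounded:
  assumes v: "in_H1 \<Omega> v" "AE x in \<mu>. v x \<in> {-1/2..3/2}"
  shows "admissible \<Omega> f a b G v"
proof -
  have vm[measurable]: "v \<in> borel_measurable \<mu>" using v by (simp add: in_H1_def in_L2_def)
  have "AE x in \<mu>. ereal (norm (v x)) \<le> ereal (3/2)"
    using v(2) by eventually_elim auto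
  then have "Linf_norm \<Omega> v \<le> ereal (3/2)"
    unfolding Linf_norm_def by (intro esssup_I) measurable
  then have "in_Linf \<Omega> v" unfolding in_Linf_def using vm by (auto intro: le_less_trans)
  moreover have "integrable \<mu> (energy_density \<Omega> f a b G v)"
    unfolding energy_density_def[abs_def]
    by (intro Bochner_Integration.integrable_add integrable_bounded_energy v)
  ultimately show ?thesis using v by (simp add: admissible_def)
qed

lemma dens_integrable: "integrable \<mu> dens"
  unfolding dens_def[abs_def]
  by (intro Bochner_Integration.integrable_add integrable_bounded_energy H1 u_range)

lemma dens_nonneg: "x \<in> \<Omega> \<Longrightarrow> 0 \<le> dens x"
  unfolding dens_def using a_form_nonneg b_pos W_nonneg by (simp add: mult_nonneg_nonneg add_nonneg_nonneg)

lemma u2_integrable: "integrable \<mu> (\<lambda>x. (u x)\<^sup>2)"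
  using H1 by (simp add: in_H1_def in_L2_def)

lemma indicator_integrable:
  fixes h :: "real^'n \<Rightarrow> real"
  assumes "integrable \<mu> h" shows "integrable \<mu> (\<lambda>x. indicator (ball 0 s) x * h x)"
  by (rule integrable_mult_bounded(2)[OF assms, where B = 1])
    (auto intro!: borel_measurable_lebesgue_on_borel simp: indicator_def)

lemma indicator_ball_integrable: "integrable \<mu> (\<lambda>x. indicator (ball 0 r) x :: real)"
  by (rule bounded_integrable[where B = 1])
    (auto intro!: borel_measurable_lebesgue_on_borel simp: indicator_def)

lemma indicator_ball_integral:
  assumes "s \<le> \<rho>" "s \<ge> 0"
  shows "(\<integral>x. indicator (ball 0 s) x \<partial>\<mu>) = unit_ball_vol (real CARD('n)) * s ^ CARD('n)"
proof -
  have "(\<integral>x. indicator (ball 0 s) x \<partial>\<mu>) = measure \<mu> (ball (0::real^'n) s \<inter> space \<mu>)"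
    by simp
  also have "ball (0::real^'n) s \<inter> space \<mu> = ball 0 s" using assms by auto
  also have "measure \<mu> (ball (0::real^'n) s) = measure lebesgue (ball (0::real^'n) s)"
    using assms by (intro measure_restrict_space) auto
  also have "\<dots> = measure lborel (ball (0::real^'n) s)" by (simp add: measure_completion)
  also have "\<dots> = unit_ball_vol (real CARD('n)) * s ^ CARD('n)"
    using content_ball[OF assms(2), of "0::real^'n"] by simp
  finally show ?thesis .
qed

text \<open>A Caccioppoli inequality. The competitor vanishes in the inner ball, where at least half
  of the energy is therefore gained; on the shell it costs a multiple of the square of
  \<open>u\<close>. Farther out nothing changes, and \<open>G\<close> costs at most
  \<open>2 * M\<close> per unit of volume.\<close>

lemma energy_estimate:
  fixes \<zeta> :: "real^'n \<Rightarrow> real"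
  assumes cut: "radial_cutoff C s \<zeta>"
    and s: "0 < s" "s + 1 \<le> \<rho>"
  defines "C\<^sub>1 \<equiv> inverse lam * (12 * C\<^sup>2 + K\<^sub>W)"
  shows "E s / 2 \<le> C\<^sub>1 * (\<Phi> (s + 1) - \<Phi> s) + 2 * M * (unit_ball_vol (real CARD('n)) * (s + 1) ^ CARD('n))"
proof -
  note \<zeta> = radial_cutoffD[OF cut]
  let ?Z = "\<lambda>x. (\<chi> i. partial_deriv i \<zeta> x)"
  \<comment> \<open>This is \<open>1 - (\<zeta> x)\<^sup>2\<close>, written with the sums and
    products for which smoothness is available.\<close>
  define \<omega> where "\<omega> x = 1 + (- 1) * (\<zeta> x * \<zeta> x)" for x
  define v where "v x = \<omega> x * u x" for x
  have \<zeta>d: "\<zeta> differentiable (at x)" for x by (rule smooth_differentiable[OF \<zeta>(1)])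
  have \<omega>s: "smooth \<omega>" unfolding \<omega>_def by (intro smooth_add smooth_mult smooth_const \<zeta>(1))
  have \<omega>p: "partial_deriv i \<omega> x = - 2 * \<zeta> x * partial_deriv i \<zeta> x" for i x
  proof -
    have "partial_deriv i \<omega> x = partial_deriv i (\<lambda>x. 1) x + partial_deriv i (\<lambda>x. (- 1) * (\<zeta> x * \<zeta> x)) x"
      unfolding \<omega>_def
      by (intro partial_deriv_add smooth_differentiable smooth_mult smooth_const \<zeta>(1))
    also have "partial_deriv i (\<lambda>x. (- 1) * (\<zeta> x * \<zeta> x)) x = (- 1) * partial_deriv i (\<lambda>x. \<zeta> x * \<zeta> x) x"
      by (subst partial_deriv_mult) (simp_all add: smooth_differentiable[OF smooth_mult[OF \<zeta>(1) \<zeta>(1)]])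
    also have "partial_deriv i (\<lambda>x. \<zeta> x * \<zeta> x) x = 2 * \<zeta> x * partial_deriv i \<zeta> x"
      by (subst partial_deriv_mult) (auto intro!: \<zeta>d)
    finally show ?thesis by simp
  qed
  have z2: "0 \<le> (\<zeta> x)\<^sup>2" "(\<zeta> x)\<^sup>2 \<le> 1" for x using \<zeta>(2,3)[of x] by (auto simp: power_le_one)
  have \<omega>01: "0 \<le> \<omega> x" "\<omega> x \<le> 1" for x using z2[of x] by (auto simp: \<omega>_def power2_eq_square)
  have T: "test_fun \<Omega> (\<lambda>x. (- \<zeta> x) * \<zeta> x)"
    using smooth_mult[OF smooth_const[of "- 1"] \<zeta>(1)] test_fun_radial_cutoff[OF cut, of \<rho>] s
    by (intro test_fun_mult_smooth) auto
  have pb: "\<bar>partial_deriv i \<zeta> x\<bar> \<le> C" for i x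
    using component_le_norm_cart[of "?Z x" i] \<zeta>(6)[of x] by simp
  have "\<bar>partial_deriv i \<omega> x\<bar> \<le> 2 * C" for i x
  proof -
    have "\<zeta> x * \<bar>partial_deriv i \<zeta> x\<bar> \<le> 1 * C" using \<zeta>(2,3)[of x] pb \<zeta>(7) by (intro mult_mono) auto
    then show ?thesis using \<zeta>(2)[of x] by (simp add: \<omega>p abs_mult)
  qed
  then have \<omega>B: "\<bar>partial_deriv i \<omega> x\<bar> \<le> 1 + 2 * C" for i x by (meson add_increasing zero_le_one)
  have \<omega>B': "\<bar>\<omega> x\<bar> \<le> 1 + 2 * C" for x using \<omega>01[of x] \<zeta>(7) by simp
  note H = in_H1_cutoff[OF open_ball H1 \<omega>s \<omega>B' \<omega>B, folded v_def]
  \<comment> \<open>\<open>v\<close> lies between 0 and \<open>u\<close>, and the interval contains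
    0.\<close>
  have vr: "AE x in \<mu>. v x \<in> {-1/2..3/2}"
    using u_range
  proof eventually_elim
    case (elim x)
    have "\<omega> x * (u x) \<le> \<omega> x * (3/2)" "\<omega> x * (-1/2) \<le> \<omega> x * u x"
      by (rule mult_left_mono; use elim \<omega>01[of x] in simp)+
    moreover have "\<omega> x * (3/2) \<le> 3/2" "-1/2 \<le> \<omega> x * (-1/2)" using \<omega>01[of x] by auto
    ultimately show ?case unfolding v_def by auto
  qed
  have "in_H10 \<Omega> (\<lambda>x. v x - u x)"
  proof -
    have "(\<lambda>x. v x - u x) = (\<lambda>x. (- \<zeta> x) * \<zeta> x * u x)"
      by (simp add: v_def \<omega>_def fun_eq_iff algebra_simps)
    then show ?thesis using in_H10_cutoff[OF open_ball H1 T] by simp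
  qed
  then have "energy \<Omega> f a b G u \<le> energy \<Omega> f a b G v"
    using min admissible_bounded[OF H(1) vr] by (auto simp: is_minimizer_def)
  then have le0: "(\<integral>x. energy_density \<Omega> f a b G u x - energy_density \<Omega> f a b G v x \<partial>\<mu>) \<le> 0"
    using integrable_energy admissible_bounded[OF H(1) vr]
    by (simp add: energy_def admissible_def)
  let ?B = "\<lambda>r x. indicator (ball (0::real^'n) r) x :: real"
  \<comment> \<open>A pointwise lower bound for the energy density lost in passing from
    \<open>u\<close> to \<open>v\<close>; by minimality the total loss is at most 0.\<close>
  let ?L = "\<lambda>x. (1/2) * (?B s x * dens x) - (C\<^sub>1 * (?B (s + 1) x * (u x)\<^sup>2 - ?B s x * (u x)\<^sup>2) + 2 * M * ?B (s + 1) x)"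
  note iB = indicator_ball_integrable
  have I: "integrable \<mu> ?L"
    by (rule Bochner_Integration.integrable_diff[OF
          integrable_mult_right[OF indicator_integrable[OF dens_integrable]]
          Bochner_Integration.integrable_add[OF
            integrable_mult_right[OF Bochner_Integration.integrable_diff[OF
              indicator_integrable[OF u2_integrable] indicator_integrable[OF u2_integrable]]]
            integrable_mult_right[OF iB]]])
  have "AE x in \<mu>. ?L x \<le> energy_density \<Omega> f a b G u x - energy_density \<Omega> f a b G v x"
    using in_\<Omega> u_range vr G_bound H(2)
  proof eventually_elim
    case (elim x)
    let ?p = "Du x" and ?q = "?Z x"
    have Dv: "weak_grad \<Omega> v x = (1 - (\<zeta> x)\<^sup>2) *\<^sub>R ?p + u x *\<^sub>R ((- 2 * \<zeta> x) *\<^sub>R ?q)"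
    proof -
      have "(\<chi> i. partial_deriv i \<omega> x) = (- 2 * \<zeta> x) *\<^sub>R ?q"
        by (simp add: \<omega>p vec_eq_iff)
      moreover have "\<omega> x = 1 - (\<zeta> x)\<^sup>2" by (simp add: \<omega>_def power2_eq_square)
      ultimately show ?thesis using elim(5) by simp
    qed
    let ?A = "\<lambda>\<xi>. (a x *v \<xi>) \<bullet> \<xi>"
    have form: "(\<zeta> x)\<^sup>2 / 2 * ?A ?p - 12 * (u x)\<^sup>2 * ?A ?q \<le> ?A ?p - ?A (weak_grad \<Omega> v x)"
      unfolding Dv
      by (rule cutoff_form_estimate[OF a_sym[OF elim(1)] a_form_nonneg[OF elim(1)] \<zeta>(2,3)])
    have Gd: "- 2 * M \<le> G x (u x) - G x (v x)"
      using bspec[OF elim(4) elim(2)] bspec[OF elim(4) elim(3)] by linarith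
    have ed: "energy_density \<Omega> f a b G u x - energy_density \<Omega> f a b G v x =
      (?A ?p - ?A (weak_grad \<Omega> v x)) + (b x * W (u x) - b x * W (v x)) + (G x (u x) - G x (v x))"
      by (simp add: energy_density_def)
    have bW: "0 \<le> b x * W (u x)" using b_pos[OF elim(1)] W_nonneg by simp
    have pA: "0 \<le> ?A ?p" by (rule a_form_nonneg[OF elim(1)])
    consider "norm x < s" | "s \<le> norm x" "norm x < s + 1" | "s + 1 \<le> norm x" by linarith
    then show ?case
    proof cases
      case 1
      have "?q = 0" by (simp add: vec_eq_iff radial_cutoff_partial_deriv(1)[OF cut 1])
      then have form': "?A ?p / 2 \<le> ?A ?p - ?A (weak_grad \<Omega> v x)"
        using form \<zeta>(4)[OF 1] by simp
      have "v x = 0" using \<zeta>(4)[OF 1] by (simp add: v_def \<omega>_def)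
      then have bv: "b x * W (v x) = 0" by (simp add: W_0)
      have "?L x = (?A ?p + b x * W (u x)) / 2 - 2 * M"
        using 1 by (simp add: dens_def)
      also have "\<dots> \<le> (?A ?p - ?A (weak_grad \<Omega> v x)) + (b x * W (u x) - b x * W (v x)) + (G x (u x) - G x (v x))"
        using form' Gd bW bv by argo
      finally show ?thesis unfolding ed .
    next
      case 2
      have "?A ?q \<le> inverse lam * C\<^sup>2"
      proof -
        have "(norm ?q)\<^sup>2 \<le> C\<^sup>2" by (intro power_mono \<zeta>(6)) simp
        then show ?thesis using a_upper[OF elim(1), of ?q] lam
          by (meson inverse_nonnegative_iff_nonnegative less_imp_le mult_left_mono order_trans)
      qed
      then have 1: "12 * (u x)\<^sup>2 * ?A ?q \<le> 12 * (u x)\<^sup>2 * (inverse lam * C\<^sup>2)"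
        by (intro mult_left_mono) auto
      have 2: "b x * W (v x) \<le> inverse lam * (K\<^sub>W * (u x)\<^sup>2)"
      proof (intro mult_mono b_bounds elim(1))
        have "\<bar>v x\<bar> \<le> 3/2" using elim(3) by auto
        then have "W (v x) \<le> K\<^sub>W * (v x)\<^sup>2" by (rule W_upper)
        also have "(v x)\<^sup>2 \<le> (u x)\<^sup>2"
          using \<omega>01[of x] by (simp add: v_def power_mult_distrib mult_left_le_one_le power_le_one)
        finally show "W (v x) \<le> K\<^sub>W * (u x)\<^sup>2" using W_upper(2) by simp
      qed (use lam W_nonneg in auto)
      have 3: "0 \<le> (\<zeta> x)\<^sup>2 / 2 * ?A ?p" using pA by simp
      have "C\<^sub>1 * (u x)\<^sup>2 = 12 * (u x)\<^sup>2 * (inverse lam * C\<^sup>2) + inverse lam * (K\<^sub>W * (u x)\<^sup>2)"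
        by (simp add: C\<^sub>1_def algebra_simps)
      then have "- (C\<^sub>1 * (u x)\<^sup>2) - 2 * M \<le>
          (?A ?p - ?A (weak_grad \<Omega> v x)) + (b x * W (u x) - b x * W (v x)) + (G x (u x) - G x (v x))"
        using form Gd bW 1 2 3 by argo
      moreover have "?L x = - (C\<^sub>1 * (u x)\<^sup>2) - 2 * M"
        using \<open>s \<le> norm x\<close> \<open>norm x < s + 1\<close> by simp
      ultimately show ?thesis unfolding ed by simp
    next
      case 3
      have "?q = 0" using 3 by (simp add: vec_eq_iff radial_cutoff_partial_deriv(2)[OF cut])
      moreover have z: "\<zeta> x = 0" using \<zeta>(5)[of x] 3 by simp
      moreover from this have "v x = u x" by (simp add: v_def \<omega>_def)
      moreover have "?B s x = 0" "?B (s + 1) x = 0" using 3 by auto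
      ultimately show ?thesis
        unfolding ed Dv by simp
    qed
  qed
  then have "(\<integral>x. ?L x \<partial>\<mu>) \<le> (\<integral>x. energy_density \<Omega> f a b G u x - energy_density \<Omega> f a b G v x \<partial>\<mu>)"
    using I integrable_energy admissible_bounded[OF H(1) vr]
    by (intro integral_mono_AE) (auto simp: admissible_def)
  also note le0
  also have "(\<integral>x. ?L x \<partial>\<mu>) = E s / 2 - (C\<^sub>1 * (\<Phi> (s + 1) - \<Phi> s) + 2 * M * (\<integral>x. ?B (s + 1) x \<partial>\<mu>))"
  proof -
    note J = indicator_integrable[OF dens_integrable] indicator_integrable[OF u2_integrable] iB
    show ?thesis unfolding E_def \<Phi>_def using J by simp
  qed
  finally show ?thesis using indicator_ball_integral[of "s + 1"] s by simp
qed

section \<open>Comparison of \<open>\<Phi>\<close>, \<open>V\<close> and \<open>E\<close>\<close>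

lemma \<Phi>_annulus:
  assumes s: "0 \<le> s" "s + 1 \<le> \<rho>"
  shows "\<Phi> (s + 1) - \<Phi> s \<le> 9/4 * unit_ball_vol (real CARD('n)) * ((s + 1) ^ CARD('n) - s ^ CARD('n))"
proof -
  let ?B = "\<lambda>r x. indicator (ball (0::real^'n) r) x :: real"
  note iB = indicator_ball_integrable
  note J = indicator_integrable[OF u2_integrable]
  have "\<Phi> (s + 1) - \<Phi> s = (\<integral>x. ?B (s + 1) x * (u x)\<^sup>2 - ?B s x * (u x)\<^sup>2 \<partial>\<mu>)"
    unfolding \<Phi>_def using J by simp
  also have "\<dots> \<le> (\<integral>x. 9/4 * (?B (s + 1) x - ?B s x) \<partial>\<mu>)"
  proof (rule integral_mono_AE)
    show "AE x in \<mu>. ?B (s + 1) x * (u x)\<^sup>2 - ?B s x * (u x)\<^sup>2 \<le> 9/4 * (?B (s + 1) x - ?B s x)"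
      using u_range
    proof eventually_elim
      case (elim x)
      have "\<bar>u x\<bar> \<le> 3/2" using elim by auto
      from power_mono[OF this, of 2] have "(u x)\<^sup>2 \<le> 9/4" by (simp add: power2_eq_square)
      then show ?case by (auto simp: indicator_def)
    qed
  qed (use J iB in auto)
  also have "\<dots> = 9/4 * ((\<integral>x. ?B (s + 1) x \<partial>\<mu>) - (\<integral>x. ?B s x \<partial>\<mu>))"
    using iB by simp
  also have "\<dots> = 9/4 * unit_ball_vol (real CARD('n)) * ((s + 1) ^ CARD('n) - s ^ CARD('n))"
    using indicator_ball_integral[of "s + 1"] indicator_ball_integral[of s] s by (simp add: algebra_simps)
  finally show ?thesis .
qed

lemma superlevel_measurable: "{x. \<bar>u x\<bar> > \<beta>} \<inter> \<Omega> \<in> sets \<mu>"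
proof -
  have "{x \<in> space \<mu>. \<bar>u x\<bar> > \<beta>} \<in> sets \<mu>" by measurable
  then show ?thesis by (simp add: Int_def conj_commute)
qed

lemma indicator_superlevel_measurable[measurable]:
  assumes "s \<le> \<rho>"
  shows "(\<lambda>x. indicator ({x. \<bar>u x\<bar> > \<beta>} \<inter> ball 0 s) x :: real) \<in> borel_measurable \<mu>"
proof -
  have "(\<lambda>x. indicator ({x. \<bar>u x\<bar> > \<beta>} \<inter> \<Omega>) x * indicator (ball 0 s) x :: real) \<in> borel_measurable \<mu>"
    by (intro borel_measurable_times borel_measurable_indicator superlevel_measurable
        borel_measurable_lebesgue_on_borel) auto
  moreover have "indicator ({x. \<bar>u x\<bar> > \<beta>} \<inter> \<Omega>) x * indicator (ball 0 s) x =
      (indicator ({x. \<bar>u x\<bar> > \<beta>} \<inter> ball 0 s) x :: real)" for x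
    using assms by (auto simp: indicator_def)
  ultimately show ?thesis by simp
qed

lemma V_integrable:
  assumes "s \<le> \<rho>"
  shows "integrable \<mu> (\<lambda>x. indicator ({x. \<bar>u x\<bar> > \<beta>} \<inter> ball 0 s) x :: real)"
  by (rule bounded_integrable[where B = 1, OF indicator_superlevel_measurable[OF assms]])
    (auto simp: indicator_def)

lemma V_eq_superlevel_measure:
  assumes "s \<le> \<rho>"
  shows "V s = superlevel_measure u \<beta> s"
proof -
  let ?S = "{x. \<bar>u x\<bar> > \<beta>} \<inter> ball 0 s"
  have "V s = measure \<mu> (?S \<inter> space \<mu>)" by (simp add: V_def)
  also have "?S \<inter> space \<mu> = ?S" using assms by auto
  also have "measure \<mu> ?S = measure lebesgue ?S"
    using assms by (intro measure_restrict_space) auto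
  finally show ?thesis by (simp add: superlevel_measure_def)
qed

lemma V_nonneg: "V s \<ge> 0" unfolding V_def by (rule Bochner_Integration.integral_nonneg) auto

lemma E_mono: "s \<le> t \<Longrightarrow> E s \<le> E t" unfolding E_def
  by (intro integral_mono_AE indicator_integrable dens_integrable)
    (use in_\<Omega> in eventually_elim, auto simp: indicator_def dens_nonneg)

lemma \<Phi>_mono: "s \<le> t \<Longrightarrow> \<Phi> s \<le> \<Phi> t" unfolding \<Phi>_def
  by (intro integral_mono indicator_integrable u2_integrable) (auto simp: indicator_def)

lemma V_mono: "s \<le> t \<Longrightarrow> t \<le> \<rho> \<Longrightarrow> V s \<le> V t" unfolding V_def
  by (intro integral_mono V_integrable) (auto simp: indicator_def)

lemma V_le_\<Phi>: "s \<le> \<rho> \<Longrightarrow> \<beta>\<^sup>2 * V s \<le> \<Phi> s"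
proof -
  assume s: "s \<le> \<rho>"
  have "\<beta>\<^sup>2 * V s = (\<integral>x. \<beta>\<^sup>2 * indicator ({x. \<bar>u x\<bar> > \<beta>} \<inter> ball 0 s) x \<partial>\<mu>)"
    by (simp add: V_def)
  also have "\<dots> \<le> \<Phi> s" unfolding \<Phi>_def
  proof (intro integral_mono indicator_integrable u2_integrable integrable_mult_right V_integrable s)
    fix x
    have "\<beta>\<^sup>2 \<le> (u x)\<^sup>2" if "\<bar>u x\<bar> > \<beta>"
      using power_mono[of \<beta> "\<bar>u x\<bar>" 2] that \<beta> by simp
    then show "\<beta>\<^sup>2 * indicator ({x. \<bar>u x\<bar> > \<beta>} \<inter> ball 0 s) x \<le> indicator (ball 0 s) x * (u x)\<^sup>2"
      by (auto simp: indicator_def)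
  qed
  finally show ?thesis .
qed

text \<open>On the superlevel set \<open>\<bar>u\<bar> \<le> 3/2\<close> is used. Elsewhere the
  quadratic lower bound of the potential, together with \<open>b \<ge> lam\<close>, dominates the
  square of \<open>u\<close> by the energy density.\<close>

lemma \<Phi>_le: "s \<le> \<rho> \<Longrightarrow> \<Phi> s \<le> 9/4 * V s + inverse (c\<^sub>W * lam) * E s"
proof -
  assume s: "s \<le> \<rho>"
  have "\<Phi> s \<le> (\<integral>x. 9/4 * indicator ({x. \<bar>u x\<bar> > \<beta>} \<inter> ball 0 s) x
      + inverse (c\<^sub>W * lam) * (indicator (ball 0 s) x * dens x) \<partial>\<mu>)"
    unfolding \<Phi>_def
  proof (rule integral_mono_AE)
    show "AE x in \<mu>. indicator (ball 0 s) x * (u x)\<^sup>2 \<le> 9/4 * indicator ({x. \<bar>u x\<bar> > \<beta>} \<inter> ball 0 s) x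
      + inverse (c\<^sub>W * lam) * (indicator (ball 0 s) x * dens x)"
      using in_\<Omega> u_range
    proof eventually_elim
      case (elim x)
      have d: "0 \<le> dens x" by (rule dens_nonneg[OF elim(1)])
      have cl: "0 < c\<^sub>W * lam" using W_lower(2) lam by simp
      show ?case
      proof (cases "\<bar>u x\<bar> > \<beta>")
        case True
        have "\<bar>u x\<bar> \<le> 3/2" using elim by auto
        from power_mono[OF this, of 2] have "(u x)\<^sup>2 \<le> 9/4" by (simp add: power2_eq_square)
        moreover have "0 \<le> inverse (c\<^sub>W * lam) * dens x" using cl d less_imp_le[OF positive_imp_inverse_positive[OF cl]] by (rule_tac mult_nonneg_nonneg)
        ultimately show ?thesis using True by (auto simp: indicator_def)
      next
        case False
        then have "c\<^sub>W * (u x)\<^sup>2 \<le> W (u x)" by (intro W_lower) simp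
        then have "lam * (c\<^sub>W * (u x)\<^sup>2) \<le> b x * W (u x)"
          using b_bounds(1)[OF elim(1)] lam W_lower(2) by (intro mult_mono) auto
        also have "\<dots> \<le> dens x" using a_form_nonneg[OF elim(1)] by (simp add: dens_def)
        finally have "(u x)\<^sup>2 \<le> inverse (c\<^sub>W * lam) * dens x"
          using cl by (simp add: field_simps)
        then show ?thesis using False by (auto simp: indicator_def)
      qed
    qed
  qed (intro Bochner_Integration.integrable_add integrable_mult_right V_integrable s
      indicator_integrable dens_integrable u2_integrable)+
  also have "\<dots> = 9/4 * V s + inverse (c\<^sub>W * lam) * E s"
    using V_integrable[OF s] indicator_integrable[OF dens_integrable, of s]
    by (simp add: V_def E_def)
  finally show ?thesis .
qed

end

section \<open>The isoperimetric estimate\<close>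

text \<open>The fundamental theorem of calculus along the segment from \<open>x\<close> to
  \<open>x + h\<close>. With nonnegative extended integrals, the later integrations in
  \<open>x\<close>, \<open>h\<close> and \<open>t\<close> can be interchanged freely.\<close>

lemma le_translate:
  fixes w :: "'a::euclidean_space \<Rightarrow> real"
  assumes w: "\<And>x. (w has_derivative (\<lambda>h. g x \<bullet> h)) (at x)" and g: "continuous_on UNIV g"
    and w0: "\<And>x. 0 \<le> w x"
  shows "ennreal (w x) \<le> ennreal (w (x + h)) +
    (\<integral>\<^sup>+t. indicator {0..1} t * ennreal (norm (g (x + t *\<^sub>R h)) * norm h) \<partial>lborel)"
proof -
  let ?f = "\<lambda>t. g (x + t *\<^sub>R h) \<bullet> h" and ?n = "\<lambda>t. norm (g (x + t *\<^sub>R h)) * norm h"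
  have cg: "continuous_on S (\<lambda>t. g (x + t *\<^sub>R h))" for S :: "real set"
    by (rule continuous_on_compose2[OF g]) (auto intro!: continuous_intros)
  have D: "((\<lambda>t. w (x + t *\<^sub>R h)) has_vector_derivative ?f t) (at t within {0..1})" for t
  proof -
    have "((\<lambda>t. x + t *\<^sub>R h) has_derivative (\<lambda>d. d *\<^sub>R h)) (at t within {0..1})"
      by (auto intro!: derivative_eq_intros)
    from has_derivative_compose[OF this w]
    show ?thesis by (simp add: has_vector_derivative_def mult.commute)
  qed
  have "(\<integral>t. indicator {0..1} t *\<^sub>R ?f t \<partial>lborel) = w (x + 1 *\<^sub>R h) - w (x + 0 *\<^sub>R h)"
    by (rule integral_FTC_Icc[OF _ D]) (auto intro!: continuous_intros cg)
  moreover have I: "integrable lborel (\<lambda>t. indicator {0..1} t *\<^sub>R ?f t)"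
      "integrable lborel (\<lambda>t. indicator {0..1} t *\<^sub>R ?n t)"
    by (rule borel_integrable_compact; auto intro!: continuous_intros cg)+
  ultimately have "w x = w (x + h) + (\<integral>t. - (indicator {0..1} t *\<^sub>R ?f t) \<partial>lborel)" by simp
  also have "(\<integral>t. - (indicator {0..1} t *\<^sub>R ?f t) \<partial>lborel) \<le> (\<integral>t. indicator {0..1} t *\<^sub>R ?n t \<partial>lborel)"
  proof (rule integral_mono)
    fix t
    have "- ?f t \<le> ?n t" using Cauchy_Schwarz_ineq2[of "g (x + t *\<^sub>R h)" h] by linarith
    then show "- (indicator {0..1} t *\<^sub>R ?f t) \<le> indicator {0..1} t *\<^sub>R ?n t"
      by (auto simp: indicator_def)
  qed (use I in auto)
  finally have "w x \<le> w (x + h) + (\<integral>t. indicator {0..1} t *\<^sub>R ?n t \<partial>lborel)"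
    by simp
  then have "ennreal (w x) \<le> ennreal (w (x + h) + (\<integral>t. indicator {0..1} t *\<^sub>R ?n t \<partial>lborel))"
    by (rule ennreal_leI)
  also have "\<dots> = ennreal (w (x + h)) + ennreal (\<integral>t. indicator {0..1} t *\<^sub>R ?n t \<partial>lborel)"
    by (intro ennreal_plus w0 Bochner_Integration.integral_nonneg) auto
  also have "ennreal (\<integral>t. indicator {0..1} t *\<^sub>R ?n t \<partial>lborel) = (\<integral>\<^sup>+t. ennreal (indicator {0..1} t *\<^sub>R ?n t) \<partial>lborel)"
    by (rule nn_integral_eq_integral[symmetric, OF I(2)]) auto
  also have "\<dots> = (\<integral>\<^sup>+t. indicator {0..1} t * ennreal (?n t) \<partial>lborel)"
    by (intro nn_integral_cong) (auto simp: indicator_def)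
  finally show ?thesis .
qed

lemma nn_integral_translate:
  fixes f :: "'a::euclidean_space \<Rightarrow> ennreal"
  assumes [measurable]: "f \<in> borel_measurable borel"
  shows "(\<integral>\<^sup>+x. f (x + c) \<partial>lborel) = (\<integral>\<^sup>+x. f x \<partial>lborel)"
    and "(\<integral>\<^sup>+x. f (c + x) \<partial>lborel) = (\<integral>\<^sup>+x. f x \<partial>lborel)"
proof -
  have 1: "distr lborel borel ((+) c) = lborel" by (rule lborel_distr_plus)
  have "(\<integral>\<^sup>+x. f (c + x) \<partial>lborel) = (\<integral>\<^sup>+x. f x \<partial>distr lborel borel ((+) c))"
    by (subst nn_integral_distr) auto
  then show "(\<integral>\<^sup>+x. f (c + x) \<partial>lborel) = (\<integral>\<^sup>+x. f x \<partial>lborel)" by (simp only: 1)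
  then show "(\<integral>\<^sup>+x. f (x + c) \<partial>lborel) = (\<integral>\<^sup>+x. f x \<partial>lborel)" by (simp only: add.commute)
qed

text \<open>A substitute for the Sobolev inequality: comparing \<open>w\<close> with its translates by vectors in
  \<open>ball 0 r\<close> and averaging over them.\<close>

lemma averaged_translation_estimate:
  fixes w :: "'a::euclidean_space \<Rightarrow> real"
  assumes w: "\<And>x. (w has_derivative (\<lambda>h. g x \<bullet> h)) (at x)" and g: "continuous_on UNIV g"
    and w0: "\<And>x. 0 \<le> w x" and Iw: "integrable lborel w" and Ig: "integrable lborel (\<lambda>x. norm (g x))"
    and S: "S \<in> sets borel" "bounded S" and r: "r > 0"
  shows "measure lborel (ball (0::'a) r) * (\<integral>x. indicator S x * w x \<partial>lborel) \<le>
     measure lborel S * (\<integral>x. w x \<partial>lborel) + r * measure lborel (ball (0::'a) r) * (\<integral>x. norm (g x) \<partial>lborel)"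
proof -
  let ?B = "ball (0::'a) r"
  have "continuous_on UNIV w"
    by (rule continuous_at_imp_continuous_on) (use has_derivative_continuous[OF w] in blast)
  note [measurable] = borel_measurable_continuous_onI[OF this] borel_measurable_continuous_onI[OF g]
  have [measurable]: "S \<in> sets borel" "?B \<in> sets borel" using S(1) by auto
  let ?J = "\<lambda>h x. \<integral>\<^sup>+t. indicator {0..1::real} t * ennreal (norm (g (x + t *\<^sub>R h)) * norm h) \<partial>lborel"
  have [measurable]: "(\<lambda>(h, x). ?J h x) \<in> borel_measurable (lborel \<Otimes>\<^sub>M lborel)"
    by measurable
  have [measurable]: "(\<lambda>h. \<integral>\<^sup>+x. indicator S x * ?J h x \<partial>lborel) \<in> borel_measurable lborel"
    by measurable
  have [measurable]: "(\<lambda>h. \<integral>\<^sup>+x. indicator S x * ennreal (w (x + h)) \<partial>lborel) \<in> borel_measurable lborel"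
    by measurable
  \<comment> \<open>The pointwise inequality is integrated over \<open>x\<close> in \<open>S\<close>
    and over \<open>h\<close> in the ball.\<close>
  have "(\<integral>\<^sup>+h. indicator ?B h * (\<integral>\<^sup>+x. indicator S x * ennreal (w x) \<partial>lborel) \<partial>lborel)
     \<le> (\<integral>\<^sup>+h. indicator ?B h * (\<integral>\<^sup>+x. indicator S x * (ennreal (w (x + h)) + ?J h x) \<partial>lborel) \<partial>lborel)"
    by (intro nn_integral_mono mult_left_mono le_translate[OF w g w0]) auto
  also have "\<dots> = (\<integral>\<^sup>+h. indicator ?B h * (\<integral>\<^sup>+x. indicator S x * ennreal (w (x + h)) \<partial>lborel)
      + indicator ?B h * (\<integral>\<^sup>+x. indicator S x * ?J h x \<partial>lborel) \<partial>lborel)"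
    by (simp add: distrib_left nn_integral_add)
  also have "\<dots> = (\<integral>\<^sup>+h. indicator ?B h * (\<integral>\<^sup>+x. indicator S x * ennreal (w (x + h)) \<partial>lborel) \<partial>lborel)
      + (\<integral>\<^sup>+h. indicator ?B h * (\<integral>\<^sup>+x. indicator S x * ?J h x \<partial>lborel) \<partial>lborel)"
    by (intro nn_integral_add) measurable
  \<comment> \<open>Once the restriction of \<open>h\<close> to the ball is dropped, the integral
    over \<open>h\<close> is the full integral of \<open>w\<close> for each \<open>x\<close>;
    integration over \<open>x\<close> contributes the measure of \<open>S\<close>.\<close>
  also have "(\<integral>\<^sup>+h. indicator ?B h * (\<integral>\<^sup>+x. indicator S x * ennreal (w (x + h)) \<partial>lborel) \<partial>lborel)
      \<le> (\<integral>\<^sup>+h. \<integral>\<^sup>+x. indicator S x * ennreal (w (x + h)) \<partial>lborel \<partial>lborel)"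
    by (intro nn_integral_mono) (auto simp: indicator_def)
  also have "\<dots> = (\<integral>\<^sup>+x. \<integral>\<^sup>+h. indicator S x * ennreal (w (x + h)) \<partial>lborel \<partial>lborel)"
    by (rule lborel_pair.Fubini') measurable
  also have "\<dots> = (\<integral>\<^sup>+x. indicator S x * (\<integral>\<^sup>+x. ennreal (w x) \<partial>lborel) \<partial>lborel)"
    by (simp add: nn_integral_cmult nn_integral_translate(2)[of "\<lambda>x. ennreal (w x)"])
  also have "\<dots> = emeasure lborel S * (\<integral>\<^sup>+x. ennreal (w x) \<partial>lborel)"
    by (simp add: nn_integral_multc)
  also have "(\<integral>\<^sup>+h. indicator ?B h * (\<integral>\<^sup>+x. indicator S x * ?J h x \<partial>lborel) \<partial>lborel)
      \<le> (\<integral>\<^sup>+h. indicator ?B h * (ennreal r * (\<integral>\<^sup>+x. ennreal (norm (g x)) \<partial>lborel)) \<partial>lborel)"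
  proof (intro nn_integral_mono)
    fix h :: 'a
    show "indicator ?B h * (\<integral>\<^sup>+x. indicator S x * ?J h x \<partial>lborel)
        \<le> indicator ?B h * (ennreal r * (\<integral>\<^sup>+x. ennreal (norm (g x)) \<partial>lborel))"
    proof (cases "h \<in> ?B")
      case True
      \<comment> \<open>For fixed \<open>h\<close> the restriction to \<open>S\<close> is dropped
        and translation invariance in \<open>x\<close> is used, which leaves at most
        \<open>r\<close> times the integral of the gradient norm.\<close>
      have "(\<integral>\<^sup>+x. indicator S x * ?J h x \<partial>lborel) \<le> (\<integral>\<^sup>+x. ?J h x \<partial>lborel)"
        by (intro nn_integral_mono) (auto simp: indicator_def)
      also have "\<dots> = (\<integral>\<^sup>+t. \<integral>\<^sup>+x. indicator {0..1} t * ennreal (norm (g (x + t *\<^sub>R h)) * norm h) \<partial>lborel \<partial>lborel)"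
        by (rule lborel_pair.Fubini'[symmetric]) measurable
      also have "\<dots> = (\<integral>\<^sup>+t. indicator {0..1::real} t * ((\<integral>\<^sup>+x. ennreal (norm (g x)) \<partial>lborel) * ennreal (norm h)) \<partial>lborel)"
        by (simp add: ennreal_mult nn_integral_cmult nn_integral_multc nn_integral_translate(1)[of "\<lambda>x. ennreal (norm (g x))"])
      also have "\<dots> = (\<integral>\<^sup>+x. ennreal (norm (g x)) \<partial>lborel) * ennreal (norm h)"
        by (simp add: nn_integral_multc)
      also have "\<dots> \<le> (\<integral>\<^sup>+x. ennreal (norm (g x)) \<partial>lborel) * ennreal r"
        using True by (intro mult_left_mono ennreal_leI) auto
      finally show ?thesis using True by (simp add: mult.commute)
    qed simp
  qed
  also have "\<dots> = emeasure lborel ?B * (ennreal r * (\<integral>\<^sup>+x. ennreal (norm (g x)) \<partial>lborel))"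
    by (simp add: nn_integral_multc)
  also have "(\<integral>\<^sup>+h. indicator ?B h * (\<integral>\<^sup>+x. indicator S x * ennreal (w x) \<partial>lborel) \<partial>lborel)
      = emeasure lborel ?B * (\<integral>\<^sup>+x. indicator S x * ennreal (w x) \<partial>lborel)"
    by (simp add: nn_integral_multc)
  finally have *: "emeasure lborel ?B * (\<integral>\<^sup>+x. indicator S x * ennreal (w x) \<partial>lborel)
      \<le> emeasure lborel S * (\<integral>\<^sup>+x. ennreal (w x) \<partial>lborel)
        + emeasure lborel ?B * (ennreal r * (\<integral>\<^sup>+x. ennreal (norm (g x)) \<partial>lborel))" by (simp add: add_mono)
  have eB: "emeasure lborel ?B = ennreal (measure lborel ?B)" "emeasure lborel S = ennreal (measure lborel S)"
    using emeasure_bounded_finite[of ?B] emeasure_bounded_finite[OF S(2)]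
    by (auto simp: emeasure_eq_ennreal_measure top.not_eq_extremum)
  have IS: "integrable lborel (\<lambda>x. indicator S x * w x)"
    by (rule integrable_mult_bounded(2)[OF Iw, where B = 1]) (auto simp: indicator_def)
  have "(\<integral>\<^sup>+x. indicator S x * ennreal (w x) \<partial>lborel) = (\<integral>\<^sup>+x. ennreal (indicator S x * w x) \<partial>lborel)"
    by (intro nn_integral_cong) (auto simp: indicator_def)
  also have "\<dots> = ennreal (\<integral>x. indicator S x * w x \<partial>lborel)"
    by (rule nn_integral_eq_integral[OF IS]) (auto simp: w0)
  finally have e1: "(\<integral>\<^sup>+x. indicator S x * ennreal (w x) \<partial>lborel) = ennreal (\<integral>x. indicator S x * w x \<partial>lborel)" .
  have e2: "(\<integral>\<^sup>+x. ennreal (w x) \<partial>lborel) = ennreal (\<integral>x. w x \<partial>lborel)"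
    by (rule nn_integral_eq_integral[OF Iw]) (auto simp: w0)
  have e3: "(\<integral>\<^sup>+x. ennreal (norm (g x)) \<partial>lborel) = ennreal (\<integral>x. norm (g x) \<partial>lborel)"
    by (rule nn_integral_eq_integral[OF Ig]) auto
  have p: "0 \<le> (\<integral>x. indicator S x * w x \<partial>lborel)" "0 \<le> (\<integral>x. w x \<partial>lborel)" "0 \<le> (\<integral>x. norm (g x) \<partial>lborel)"
    by (intro Bochner_Integration.integral_nonneg; simp add: w0)+
  have "ennreal (measure lborel ?B * (\<integral>x. indicator S x * w x \<partial>lborel)) \<le>
     ennreal (measure lborel S * (\<integral>x. w x \<partial>lborel) + measure lborel ?B * (r * (\<integral>x. norm (g x) \<partial>lborel)))"
    using * unfolding eB e1 e2 e3
    using p r by (simp add: ennreal_mult[symmetric] ennreal_plus[symmetric] del: ennreal_plus)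
  then show ?thesis
    using p r by (subst (asm) ennreal_le_iff) (auto simp: mult_ac)
qed

text \<open>\<open>trunc \<beta>\<close> is of order \<open>s\<^sup>2\<close> at \<open>0\<close> and constant for \<open>\<bar>s\<bar> \<ge> \<beta>\<close>, so that the square of its derivative
  is controlled by the potential even though the latter vanishes at \<open>1\<close>.\<close>

definition trunc :: "real \<Rightarrow> real \<Rightarrow> real" where
  "trunc \<beta> s = (\<beta>\<^sup>2)\<^sup>2 - (max 0 (\<beta>\<^sup>2 - s\<^sup>2))\<^sup>2"

definition trunc' :: "real \<Rightarrow> real \<Rightarrow> real" where
  "trunc' \<beta> s = 4 * s * max 0 (\<beta>\<^sup>2 - s\<^sup>2)"

text \<open>The square makes the truncation differentiable across its threshold with a continuous
  derivative. The classical chain rule then applies to \<open>trunc\<close> of a smooth function,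
  and no weak chain rule is involved.\<close>

lemma has_real_derivative_max0_power2:
  "((\<lambda>y. (max 0 y)\<^sup>2) has_real_derivative 2 * max 0 y) (at (y::real))"
proof -
  consider "y > 0" | "y < 0" | "y = 0" by linarith
  then show ?thesis
  proof cases
    case 1
    have "((\<lambda>y. y\<^sup>2) has_real_derivative 2 * max 0 y) (at y)"
      using 1 by (auto intro!: derivative_eq_intros)
    then show ?thesis
      by (rule has_field_derivative_transform_within_open[where S = "{0<..}"]) (use 1 in auto)
  next
    case 2
    have "((\<lambda>y. 0) has_real_derivative 2 * max 0 y) (at y)" using 2 by simp
    then show ?thesis
      by (rule has_field_derivative_transform_within_open[where S = "{..<0}"]) (use 2 in auto)
  next
    case 3
    have "((\<lambda>h::real. (max 0 h)\<^sup>2 / h) \<longlongrightarrow> 0) (at 0)"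
    proof (rule Lim_null_comparison[where g = "\<lambda>h. \<bar>h\<bar>"])
      show "\<forall>\<^sub>F h::real in at 0. norm ((max 0 h)\<^sup>2 / h) \<le> \<bar>h\<bar>"
        by (auto simp: eventually_at_filter max_def power2_eq_square)
      show "((\<lambda>h::real. \<bar>h\<bar>) \<longlongrightarrow> 0) (at 0)" by (rule tendsto_eq_intros | simp)+
    qed
    then show ?thesis using 3 by (simp add: DERIV_def)
  qed
qed

lemma trunc_deriv: "(trunc \<beta> has_real_derivative trunc' \<beta> s) (at s)"
proof -
  have "((\<lambda>s. \<beta>\<^sup>2 - s\<^sup>2) has_real_derivative - 2 * s) (at s)" by (auto intro!: derivative_eq_intros)
  from DERIV_chain2[OF has_real_derivative_max0_power2 this]
  have "((\<lambda>s. (\<beta>\<^sup>2)\<^sup>2 - (max 0 (\<beta>\<^sup>2 - s\<^sup>2))\<^sup>2) has_real_derivative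
      0 - 2 * max 0 (\<beta>\<^sup>2 - s\<^sup>2) * (- 2 * s)) (at s)"
    by (intro DERIV_diff DERIV_const)
  then show ?thesis by (simp add: trunc_def[abs_def] trunc'_def mult_ac)
qed

lemma trunc_bounds:
  assumes "0 < \<beta>" "\<beta> < 1"
  shows "0 \<le> trunc \<beta> s" "trunc \<beta> s \<le> 2 * \<beta>\<^sup>2 * s\<^sup>2" "\<bar>s\<bar> \<ge> \<beta> \<Longrightarrow> trunc \<beta> s = (\<beta>\<^sup>2)\<^sup>2"
    "\<bar>s\<bar> \<ge> \<beta> \<Longrightarrow> trunc' \<beta> s = 0" "(trunc' \<beta> s)\<^sup>2 \<le> 16 * s\<^sup>2"
    "\<bar>trunc \<beta> s - trunc \<beta> t\<bar> \<le> 4 * \<bar>s - t\<bar>" "\<bar>trunc' \<beta> s - trunc' \<beta> t\<bar> \<le> 16 * \<bar>s - t\<bar>"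
proof -
  define B where "B = \<beta>\<^sup>2"
  have B: "0 < B" "B < 1" using assms by (auto simp: B_def abs_square_less_1)
  have m: "0 \<le> max 0 (B - s\<^sup>2)" "max 0 (B - s\<^sup>2) \<le> B" using B by auto
  have "(max 0 (B - s\<^sup>2))\<^sup>2 \<le> B\<^sup>2" using power_mono[OF m(2,1)] .
  then show "0 \<le> trunc \<beta> s" by (simp add: trunc_def B_def)
  have "B\<^sup>2 - (max 0 (B - s\<^sup>2))\<^sup>2 \<le> 2 * B * s\<^sup>2"
  proof (cases "s\<^sup>2 \<le> B")
    case True
    then show ?thesis by (simp add: power2_diff power2_eq_square[of "s\<^sup>2"] power2_eq_square[of B] algebra_simps)
  next
    case False
    then have "B * B \<le> B * s\<^sup>2" using B by (intro mult_left_mono) auto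
    moreover have "0 \<le> B * s\<^sup>2" using B by simp
    ultimately show ?thesis using False by (simp add: power2_eq_square)
  qed
  then show "trunc \<beta> s \<le> 2 * \<beta>\<^sup>2 * s\<^sup>2" by (simp add: trunc_def B_def)
  have ge: "B \<le> s\<^sup>2" if "\<bar>s\<bar> \<ge> \<beta>"
    using power_mono[OF that, of 2] assms by (simp add: B_def)
  show "trunc \<beta> s = (\<beta>\<^sup>2)\<^sup>2" "trunc' \<beta> s = 0" if "\<bar>s\<bar> \<ge> \<beta>"
    using ge[OF that] by (simp_all add: trunc_def trunc'_def B_def)
  have "(trunc' \<beta> s)\<^sup>2 = 16 * s\<^sup>2 * (max 0 (B - s\<^sup>2))\<^sup>2"
    by (simp add: trunc'_def B_def power_mult_distrib)
  also have "\<dots> \<le> 16 * s\<^sup>2 * 1"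
  proof (intro mult_left_mono)
    have "max 0 (B - s\<^sup>2) \<le> 1" using m B by linarith
    then show "(max 0 (B - s\<^sup>2))\<^sup>2 \<le> 1" using m(1) by (rule power_le_one[rotated])
  qed simp
  finally show "(trunc' \<beta> s)\<^sup>2 \<le> 16 * s\<^sup>2" by simp
  \<comment> \<open>Clamping is 1-Lipschitz with values in [-1, 1], and both \<open>trunc\<close>
    and \<open>trunc'\<close> are polynomials in the clamped variable. Their Lipschitz bounds follow
    by factoring the differences of these polynomials.\<close>
  define cl where "cl s = max (- \<beta>) (min \<beta> s)" for s
  have cl1: "\<bar>cl s\<bar> \<le> 1" for s using assms by (auto simp: cl_def)
  have clL: "\<bar>cl s - cl t\<bar> \<le> \<bar>s - t\<bar>" for s t by (auto simp: cl_def max_def min_def)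
  have clm: "max 0 (B - s\<^sup>2) = B - (cl s)\<^sup>2 \<and> s * max 0 (B - s\<^sup>2) = cl s * (B - (cl s)\<^sup>2)" for s
  proof (cases "\<bar>s\<bar> \<le> \<beta>")
    case True
    then have "cl s = s" "s\<^sup>2 \<le> B"
      using power_mono[OF True, of 2] by (auto simp: cl_def B_def)
    then show ?thesis by simp
  next
    case False
    then have "B \<le> s\<^sup>2" using power_mono[of \<beta> "\<bar>s\<bar>" 2] assms by (simp add: B_def)
    moreover have "(cl s)\<^sup>2 = B" using False assms by (auto simp: cl_def B_def max_def min_def abs_if split: if_splits)
    ultimately show ?thesis by simp
  qed
  have prod1: "\<bar>p * q\<bar> \<le> 1" if "\<bar>p\<bar> \<le> 1" "\<bar>q\<bar> \<le> 1" for p q :: real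
    using mult_mono[of "\<bar>p\<bar>" 1 "\<bar>q\<bar>" 1] that by (simp add: abs_mult)
  have sq1: "0 \<le> (cl s)\<^sup>2" "(cl s)\<^sup>2 \<le> 1" for s
    using prod1[OF cl1 cl1, of s s] by (auto simp: power2_eq_square)
  let ?p = "cl s" and ?q = "cl t"
  have "trunc \<beta> s - trunc \<beta> t = (B - ?q\<^sup>2)\<^sup>2 - (B - ?p\<^sup>2)\<^sup>2"
    using clm by (simp add: trunc_def B_def)
  also have "\<dots> = (?p - ?q) * ((?p + ?q) * (2 * B - ?p\<^sup>2 - ?q\<^sup>2))"
    by (simp add: power2_eq_square algebra_simps)
  also have "\<bar>\<dots>\<bar> \<le> \<bar>s - t\<bar> * (2 * 2)"
    unfolding abs_mult
  proof (intro mult_mono clL)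
    show "\<bar>?p + ?q\<bar> \<le> 2" using cl1[of s] cl1[of t] by linarith
    show "\<bar>2 * B - ?p\<^sup>2 - ?q\<^sup>2\<bar> \<le> 2"
      using sq1[of s] sq1[of t] B by linarith
  qed auto
  finally show "\<bar>trunc \<beta> s - trunc \<beta> t\<bar> \<le> 4 * \<bar>s - t\<bar>" by simp
  have "trunc' \<beta> s - trunc' \<beta> t = 4 * (s * max 0 (B - s\<^sup>2)) - 4 * (t * max 0 (B - t\<^sup>2))"
    by (simp add: trunc'_def B_def)
  also have "\<dots> = 4 * (?p * (B - ?p\<^sup>2)) - 4 * (?q * (B - ?q\<^sup>2))"
    by (simp only: clm[THEN conjunct2])
  also have "\<dots> = (?p - ?q) * (4 * (B - ?p\<^sup>2 - ?p * ?q - ?q\<^sup>2))"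
    by (simp add: power2_eq_square algebra_simps)
  also have "\<bar>\<dots>\<bar> \<le> \<bar>s - t\<bar> * (4 * 4)"
    unfolding abs_mult
  proof (intro mult_mono clL)
    show "\<bar>B - ?p\<^sup>2 - ?p * ?q - ?q\<^sup>2\<bar> \<le> 4"
      using sq1[of s] sq1[of t] prod1[OF cl1 cl1, of s t] B by linarith
  qed auto
  finally show "\<bar>trunc' \<beta> s - trunc' \<beta> t\<bar> \<le> 16 * \<bar>s - t\<bar>" by simp
qed

section \<open>The translation estimate for the minimizer\<close>

context bounded_minimizer
begin

text \<open>The translation estimate is applied to the truncation of a test function
  \<open>\<phi>\<close> close to \<open>\<eta> * u\<close>, where \<open>\<eta>\<close> equals 1 on
  a ball containing the support of \<open>\<zeta>\<close>. The set \<open>S\<close> is the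
  superlevel set of \<open>u\<close> itself, so \<open>V s\<close> appears on both sides. All
  discrepancies are collected in the mean square errors \<open>\<delta>\<^sub>0\<close> and
  \<open>\<delta>\<^sub>1\<close>.\<close>

lemma isoperimetric_approx:
  fixes \<zeta> \<eta> \<phi> :: "real^'n \<Rightarrow> real"
  assumes cut: "radial_cutoff C s \<zeta>"
    and s: "0 < s" "s + 1 \<le> \<rho>" and r: "r > 0"
    and cut': "radial_cutoff C' (s + 1) \<eta>"
    and \<phi>: "test_fun \<Omega> \<phi>"
    and d: "integrable \<mu> (\<lambda>x. (\<phi> x - \<eta> x * u x)\<^sup>2)"
    and D: "\<And>i. integrable \<mu> (\<lambda>x. (partial_deriv i \<phi> x - (\<eta> x * weak_partial \<Omega> i u x + partial_deriv i \<eta> x * u x))\<^sup>2)"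
  defines "B \<equiv> \<beta>\<^sup>2" and "mB \<equiv> measure lborel (ball (0::real^'n) r)"
    and "\<delta>\<^sub>0 \<equiv> (\<integral>x. (\<phi> x - \<eta> x * u x)\<^sup>2 \<partial>\<mu>)"
    and "\<delta>\<^sub>1 \<equiv> (\<Sum>i\<in>UNIV. \<integral>x. (partial_deriv i \<phi> x - (\<eta> x * weak_partial \<Omega> i u x + partial_deriv i \<eta> x * u x))\<^sup>2 \<partial>\<mu>)"
    and "K\<^sub>1 \<equiv> 16 * inverse (c\<^sub>W * lam) + inverse lam"
  shows "mB * (B\<^sup>2 / 2 * V s - 8 / B\<^sup>2 * \<delta>\<^sub>0) \<le> V s * (4 * B * (\<Phi> (s + 1) + \<delta>\<^sub>0))
     + r * mB * (K\<^sub>1 * E (s + 1) + 4 * B * C * (\<Phi> (s + 1) - \<Phi> s) + ((256 + 4 * B * C) * \<delta>\<^sub>0 + \<delta>\<^sub>1))"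
proof -
  note \<zeta> = radial_cutoffD[OF cut] and \<eta> = radial_cutoffD(4)[OF cut']
  let ?I = "\<lambda>r x. indicator (ball (0::real^'n) r) x :: real"
  let ?d = "\<lambda>x. \<phi> x - \<eta> x * u x"
  let ?D = "\<lambda>i x. partial_deriv i \<phi> x - (\<eta> x * weak_partial \<Omega> i u x + partial_deriv i \<eta> x * u x)"
  let ?Z = "\<lambda>x. (\<chi> i. partial_deriv i \<zeta> x)"
  have B: "0 < B" "B < 1" using \<beta> by (auto simp: B_def abs_square_less_1)
  note tb = trunc_bounds[OF \<beta>, folded B_def]
  have \<phi>s: "smooth \<phi>" by (rule test_fun_smooth[OF \<phi>])
  define w where "w x = \<zeta> x * trunc \<beta> (\<phi> x)" for x
  define g where "g x = (\<chi> i. \<zeta> x * (trunc' \<beta> (\<phi> x) * partial_deriv i \<phi> x) + partial_deriv i \<zeta> x * trunc \<beta> (\<phi> x))" for x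
  have wd: "(w has_derivative (\<lambda>h. g x \<bullet> h)) (at x)" for x
  proof -
    have "((\<lambda>x. trunc \<beta> (\<phi> x)) has_derivative
        (\<lambda>h. trunc' \<beta> (\<phi> x) * (\<Sum>i\<in>UNIV. h $ i * partial_deriv i \<phi> x))) (at x)"
      using has_derivative_compose[OF smooth_has_derivative[OF \<phi>s] trunc_deriv[unfolded has_field_derivative_def]] .
    from has_derivative_mult[OF smooth_has_derivative[OF \<zeta>(1)] this]
    have "(w has_derivative (\<lambda>h. \<zeta> x * (trunc' \<beta> (\<phi> x) * (\<Sum>i\<in>UNIV. h $ i * partial_deriv i \<phi> x)) +
        (\<Sum>i\<in>UNIV. h $ i * partial_deriv i \<zeta> x) * trunc \<beta> (\<phi> x))) (at x)"
      unfolding w_def .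
    moreover have "\<zeta> x * (trunc' \<beta> (\<phi> x) * (\<Sum>i\<in>UNIV. h $ i * partial_deriv i \<phi> x)) +
        (\<Sum>i\<in>UNIV. h $ i * partial_deriv i \<zeta> x) * trunc \<beta> (\<phi> x) = g x \<bullet> h" for h
      by (simp add: g_def inner_vec_def sum_distrib_left sum_distrib_right sum.distrib[symmetric] algebra_simps)
    ultimately show ?thesis by simp
  qed
  have tc: "continuous_on UNIV (trunc \<beta>)" "continuous_on UNIV (trunc' \<beta>)"
    unfolding trunc_def[abs_def] trunc'_def[abs_def] by (intro continuous_intros)+
  have c: "continuous_on UNIV (\<lambda>x. trunc \<beta> (\<phi> x))" "continuous_on UNIV (\<lambda>x. trunc' \<beta> (\<phi> x))"
    by (rule continuous_on_compose2[OF tc(1) smooth_continuous_on[OF \<phi>s]], simp)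
      (rule continuous_on_compose2[OF tc(2) smooth_continuous_on[OF \<phi>s]], simp)
  have gc: "continuous_on UNIV g" unfolding g_def
    by (intro continuous_on_vec_lambda continuous_on_add continuous_on_mult c smooth_continuous_on
        smooth_partial_deriv \<zeta>(1) \<phi>s)
  have wc: "continuous_on UNIV w" unfolding w_def
    by (intro continuous_on_mult c smooth_continuous_on \<zeta>(1))
  have w0: "0 \<le> w x" for x unfolding w_def using \<zeta>(2) tb(1) by simp
  have wz: "w x = 0" "g x = 0" if "norm x > s + 1/2" for x
    using \<zeta>(5)[of x] radial_cutoff_partial_deriv(2)[OF cut that] that by (simp_all add: w_def g_def vec_eq_iff)
  have Iw: "integrable lborel w" and Ig: "integrable lborel (\<lambda>x. norm (g x))"
    by (rule integrable_continuous_compact_support[of _ "cball 0 (s + 1/2)"];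
      use wc gc wz in \<open>auto intro: continuous_on_norm\<close>)+
  have wm: "w \<in> borel_measurable borel" and gm: "(\<lambda>x. norm (g x)) \<in> borel_measurable borel"
    using wc gc by (auto intro!: borel_measurable_continuous_onI continuous_on_norm)
  \<comment> \<open>The translation estimate asks for a Borel set, so the superlevel set is formed
    from a Borel representative.\<close>
  obtain u' where u'm[measurable]: "u' \<in> borel_measurable borel" and u': "AE x in lebesgue. x \<in> \<Omega> \<longrightarrow> u x = u' x"
    using ex_borel_representative[OF u_measurable \<Omega>_measurable] by blast
  define S' where "S' = {x. \<bar>u' x\<bar> > \<beta>} \<inter> ball 0 s"
  let ?S = "{x. \<bar>u x\<bar> > \<beta>} \<inter> ball (0::real^'n) s"
  have S': "S' \<in> sets borel" "bounded S'"
  proof -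
    have "{x. \<bar>u' x\<bar> > \<beta>} \<in> sets borel" by measurable
    then show "S' \<in> sets borel" unfolding S'_def by auto
    show "bounded S'" unfolding S'_def by (meson bounded_ball bounded_subset inf_le2)
  qed
  have S's: "S' \<subseteq> \<Omega>" using s by (auto simp: S'_def)
  have Sae: "AE x in lebesgue. x \<in> \<Omega> \<longrightarrow> (indicator ?S x :: real) = indicator S' x"
    using u' by eventually_elim (auto simp: S'_def indicator_def)
  have s\<rho>: "s \<le> \<rho>" using s by simp
  have VS: "V s = measure lborel S'"
  proof -
    have "V s = (\<integral>x. indicator S' x \<partial>lborel)"
      unfolding V_def
      by (rule lebesgue_on_integral_eq_lborel(1)[OF indicator_superlevel_measurable[OF s\<rho>] _ \<Omega>_measurable Sae])
        (use S' S's in \<open>auto simp: indicator_def\<close>)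
    then show ?thesis using S' by simp
  qed
  have w\<mu>: "w \<in> borel_measurable \<mu>" by (rule borel_measurable_lebesgue_on_borel[OF wm])
  have wint: "(\<integral>x. w x \<partial>\<mu>) = (\<integral>x. w x \<partial>lborel)" "integrable \<mu> w"
    using lebesgue_on_integral_eq_lborel[OF w\<mu> wm \<Omega>_measurable] wz(1) s Iw by auto
  have gint: "(\<integral>x. norm (g x) \<partial>\<mu>) = (\<integral>x. norm (g x) \<partial>lborel)" "integrable \<mu> (\<lambda>x. norm (g x))"
    using lebesgue_on_integral_eq_lborel[OF borel_measurable_lebesgue_on_borel[OF gm] gm \<Omega>_measurable] wz(2) s Ig by auto
  have Sint: "(\<integral>x. indicator ?S x * w x \<partial>\<mu>) = (\<integral>x. indicator S' x * w x \<partial>lborel)"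
  proof (rule lebesgue_on_integral_eq_lborel(1)[OF _ _ \<Omega>_measurable])
    show "(\<lambda>x. indicator ?S x * w x) \<in> borel_measurable \<mu>"
      by (intro borel_measurable_times indicator_superlevel_measurable s\<rho> w\<mu>)
    show "(\<lambda>x. indicator S' x * w x) \<in> borel_measurable borel"
      by (intro borel_measurable_times borel_measurable_indicator S' wm)
    show "AE x in lebesgue. x \<in> \<Omega> \<longrightarrow> indicator ?S x * w x = indicator S' x * w x"
      using Sae by eventually_elim auto
    show "indicator S' x * w x = 0" if "x \<notin> \<Omega>" for x using that S's by (auto simp: indicator_def)
  qed
  have main: "mB * (\<integral>x. indicator ?S x * w x \<partial>\<mu>) \<le> V s * (\<integral>x. w x \<partial>\<mu>) + r * mB * (\<integral>x. norm (g x) \<partial>\<mu>)"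
    using averaged_translation_estimate[OF wd gc w0 Iw Ig S' r]
    unfolding mB_def VS Sint wint(1) gint(1) .
  have mB0: "0 \<le> mB" by (simp add: mB_def)
  note II = indicator_integrable[OF u2_integrable] indicator_integrable[OF dens_integrable]
  \<comment> \<open>If \<open>\<phi>\<close> were \<open>u\<close>, the value of \<open>w\<close> on
    the set would be \<open>B\<^sup>2\<close>. The Lipschitz error
    \<open>4 * \<bar>\<phi> x - u x\<bar>\<close> is split into half of this value and a multiple of
    its own square, which is controlled in the mean.\<close>
  have lower: "B\<^sup>2 / 2 * V s - 8 / B\<^sup>2 * \<delta>\<^sub>0 \<le> (\<integral>x. indicator ?S x * w x \<partial>\<mu>)"
  proof -
    have "B\<^sup>2 / 2 * V s - 8 / B\<^sup>2 * \<delta>\<^sub>0 = (\<integral>x. B\<^sup>2 / 2 * indicator ?S x - 8 / B\<^sup>2 * (?d x)\<^sup>2 \<partial>\<mu>)"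
      using V_integrable[OF s\<rho>] d by (simp add: V_def \<delta>\<^sub>0_def)
    also have "\<dots> \<le> (\<integral>x. indicator ?S x * w x \<partial>\<mu>)"
    proof (rule integral_mono)
      show "integrable \<mu> (\<lambda>x. indicator ?S x * w x)"
        by (rule integrable_mult_bounded(2)[OF wint(2) indicator_superlevel_measurable[OF s\<rho>], where B = 1])
          (auto simp: indicator_def)
      show "integrable \<mu> (\<lambda>x. B\<^sup>2 / 2 * indicator ?S x - 8 / B\<^sup>2 * (?d x)\<^sup>2)"
        by (intro Bochner_Integration.integrable_diff integrable_mult_right V_integrable s\<rho> d)
      fix x
      show "B\<^sup>2 / 2 * indicator ?S x - 8 / B\<^sup>2 * (?d x)\<^sup>2 \<le> indicator ?S x * w x"
      proof (cases "x \<in> ?S")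
        case True
        then have x: "norm x < s" "\<bar>u x\<bar> \<ge> \<beta>" by auto
        have "\<zeta> x = 1" "\<eta> x = 1" using x \<zeta>(4) \<eta> by auto
        then have wx: "w x = trunc \<beta> (\<phi> x)" and dx: "?d x = \<phi> x - u x" by (simp_all add: w_def)
        have "\<bar>trunc \<beta> (\<phi> x) - trunc \<beta> (u x)\<bar> \<le> 4 * \<bar>\<phi> x - u x\<bar>" by (rule tb(6))
        moreover have "4 * \<bar>\<phi> x - u x\<bar> \<le> B\<^sup>2 / 2 + 8 / B\<^sup>2 * (\<phi> x - u x)\<^sup>2"
        proof -
          have "0 \<le> (B\<^sup>2 - 4 * \<bar>\<phi> x - u x\<bar>)\<^sup>2" by simp
          then have "8 * B\<^sup>2 * \<bar>\<phi> x - u x\<bar> \<le> (B\<^sup>2)\<^sup>2 + 16 * (\<phi> x - u x)\<^sup>2"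
            by (simp add: power2_diff power_mult_distrib)
          then show ?thesis using B by (simp add: field_simps power2_eq_square)
        qed
        ultimately have "B\<^sup>2 / 2 - 8 / B\<^sup>2 * (\<phi> x - u x)\<^sup>2 \<le> trunc \<beta> (\<phi> x)"
          using tb(3)[OF x(2)] by linarith
        then show ?thesis using True unfolding dx wx by simp
      next
        case False
        have "0 \<le> 8 / B\<^sup>2 * (?d x)\<^sup>2" by simp
        then show ?thesis using False by simp
      qed
    qed
    finally show ?thesis .
  qed
  have \<phi>le: "(\<phi> x)\<^sup>2 \<le> 2 * (u x)\<^sup>2 + 2 * (?d x)\<^sup>2" if "norm x < s + 1" for x
    using power2_sum_le[of "u x" "?d x"] \<eta>[OF that] by simp
  have tle: "trunc \<beta> (\<phi> x) \<le> 4 * B * (u x)\<^sup>2 + 4 * B * (?d x)\<^sup>2" if "norm x < s + 1" for x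
  proof -
    have "trunc \<beta> (\<phi> x) \<le> 2 * B * (\<phi> x)\<^sup>2" by (rule tb(2))
    also have "\<dots> \<le> 2 * B * (2 * (u x)\<^sup>2 + 2 * (?d x)\<^sup>2)" using \<phi>le[OF that] B by (intro mult_left_mono) auto
    finally show ?thesis by (simp add: algebra_simps)
  qed
  have upper1: "(\<integral>x. w x \<partial>\<mu>) \<le> 4 * B * (\<Phi> (s + 1) + \<delta>\<^sub>0)"
  proof -
    have "(\<integral>x. w x \<partial>\<mu>) \<le> (\<integral>x. 4 * B * (?I (s + 1) x * (u x)\<^sup>2) + 4 * B * (?d x)\<^sup>2 \<partial>\<mu>)"
    proof (rule integral_mono[OF wint(2)])
      show "integrable \<mu> (\<lambda>x. 4 * B * (?I (s + 1) x * (u x)\<^sup>2) + 4 * B * (?d x)\<^sup>2)"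
        by (intro Bochner_Integration.integrable_add integrable_mult_right II d)
      fix x
      show "w x \<le> 4 * B * (?I (s + 1) x * (u x)\<^sup>2) + 4 * B * (?d x)\<^sup>2"
      proof (cases "norm x < s + 1")
        case True
        have "w x \<le> 1 * trunc \<beta> (\<phi> x)" unfolding w_def using \<zeta>(3) tb(1) by (intro mult_right_mono)
        also have "\<dots> \<le> 4 * B * (u x)\<^sup>2 + 4 * B * (?d x)\<^sup>2" using tle[OF True] by simp
        finally show ?thesis using True by simp
      next
        case False
        then have "w x = 0" by (intro wz) simp
        then show ?thesis using B by (simp add: add_nonneg_nonneg)
      qed
    qed
    also have "\<dots> = 4 * B * (\<Phi> (s + 1) + \<delta>\<^sub>0)"
      unfolding \<Phi>_def \<delta>\<^sub>0_def using II d by (simp add: distrib_left)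
    finally show ?thesis .
  qed
  \<comment> \<open>The three groups account for the gradient of the truncation, for the gradient of
    the cutoff, which lives on the shell and so produces the increment of \<open>\<Phi>\<close>, and
    for the approximation errors.\<close>
  let ?U = "\<lambda>x. K\<^sub>1 * (?I (s + 1) x * dens x) + 4 * B * C * (?I (s + 1) x * (u x)\<^sup>2 - ?I s x * (u x)\<^sup>2)
      + ((256 + 4 * B * C) * (?d x)\<^sup>2 + (\<Sum>i\<in>UNIV. (?D i x)\<^sup>2))"
  have upper2: "(\<integral>x. norm (g x) \<partial>\<mu>) \<le> K\<^sub>1 * E (s + 1) + 4 * B * C * (\<Phi> (s + 1) - \<Phi> s)
      + ((256 + 4 * B * C) * \<delta>\<^sub>0 + \<delta>\<^sub>1)"
  proof -
    have IU: "integrable \<mu> ?U"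
      by (intro Bochner_Integration.integrable_add Bochner_Integration.integrable_diff integrable_mult_right II d
          Bochner_Integration.integrable_sum D)
    have "(\<integral>x. norm (g x) \<partial>\<mu>) \<le> (\<integral>x. ?U x \<partial>\<mu>)"
    proof (rule integral_mono_AE[OF gint(2) IU])
      show "AE x in \<mu>. norm (g x) \<le> ?U x"
        using in_\<Omega> u_range
      proof eventually_elim
        case (elim x)
        have dn: "0 \<le> dens x" by (rule dens_nonneg[OF elim(1)])
        have K0: "0 \<le> K\<^sub>1" using lam W_lower(2) by (simp add: K\<^sub>1_def)
        have sD: "0 \<le> (\<Sum>i\<in>UNIV. (?D i x)\<^sup>2)" by (intro sum_nonneg) simp
        have BC: "0 \<le> 4 * B * C" using B \<zeta>(7) by simp
        show ?case
        proof (cases "norm x < s + 1")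
          case False
          then have "g x = 0" by (intro wz) simp
          moreover have "0 \<le> (256 + 4 * B * C) * (?d x)\<^sup>2 + (\<Sum>i\<in>UNIV. (?D i x)\<^sup>2)"
            using BC sD by simp
          ultimately show ?thesis using False by simp
        next
          case True
          have \<eta>1: "\<eta> x = 1" by (rule \<eta>[OF True])
          have \<eta>0: "partial_deriv i \<eta> x = 0" for i
            by (rule radial_cutoff_partial_deriv(1)[OF cut' True])
          let ?P = "\<chi> i. partial_deriv i \<phi> x"
          have gx: "g x = (\<zeta> x * trunc' \<beta> (\<phi> x)) *\<^sub>R ?P + trunc \<beta> (\<phi> x) *\<^sub>R ?Z x"
            by (simp add: g_def vec_eq_iff mult_ac)
          have "norm (g x) \<le> norm ((\<zeta> x * trunc' \<beta> (\<phi> x)) *\<^sub>R ?P) + norm (trunc \<beta> (\<phi> x) *\<^sub>R ?Z x)"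
            unfolding gx by (rule norm_triangle_ineq)
          then have 1: "norm (g x) \<le> \<zeta> x * (\<bar>trunc' \<beta> (\<phi> x)\<bar> * norm ?P) + trunc \<beta> (\<phi> x) * norm (?Z x)"
            using \<zeta>(2)[of x] tb(1) by (simp add: abs_mult mult.assoc)
          \<comment> \<open>As in the Modica-Mortola argument, Young's inequality splits the
            gradient of a function of \<open>u\<close> into one square paid by the potential and one
            paid by the gradient energy.\<close>
          have 2: "\<zeta> x * (\<bar>trunc' \<beta> (\<phi> x)\<bar> * norm ?P) \<le> ((trunc' \<beta> (\<phi> x))\<^sup>2 + (norm ?P)\<^sup>2) / 2"
          proof -
            have "\<zeta> x * (\<bar>trunc' \<beta> (\<phi> x)\<bar> * norm ?P) \<le> 1 * (\<bar>trunc' \<beta> (\<phi> x)\<bar> * norm ?P)"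
              by (intro mult_right_mono \<zeta>(3)) auto
            moreover have "0 \<le> (\<bar>trunc' \<beta> (\<phi> x)\<bar> - norm ?P)\<^sup>2" by simp
            then have "2 * (\<bar>trunc' \<beta> (\<phi> x)\<bar> * norm ?P) \<le> (trunc' \<beta> (\<phi> x))\<^sup>2 + (norm ?P)\<^sup>2"
              unfolding power2_diff power2_abs by simp
            ultimately show ?thesis by simp
          qed
          have 3: "(trunc' \<beta> (\<phi> x))\<^sup>2 \<le> 2 * (trunc' \<beta> (u x))\<^sup>2 + 512 * (?d x)\<^sup>2"
          proof -
            have "\<bar>trunc' \<beta> (\<phi> x) - trunc' \<beta> (u x)\<bar> \<le> 16 * \<bar>?d x\<bar>"
              using tb(7)[of "\<phi> x" "u x"] by (simp add: \<eta>1)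
            from power_mono[OF this, of 2]
            have "(trunc' \<beta> (\<phi> x) - trunc' \<beta> (u x))\<^sup>2 \<le> 256 * (?d x)\<^sup>2"
              by (simp add: power_mult_distrib)
            then show ?thesis
              using power2_sum_le[of "trunc' \<beta> (u x)" "trunc' \<beta> (\<phi> x) - trunc' \<beta> (u x)"] by simp
          qed
          have 4: "(norm ?P)\<^sup>2 \<le> 2 * (norm (Du x))\<^sup>2 + 2 * (\<Sum>i\<in>UNIV. (?D i x)\<^sup>2)"
          proof -
            have "(norm ?P)\<^sup>2 \<le> (\<Sum>i\<in>UNIV. 2 * (Du x $ i)\<^sup>2 + 2 * (?D i x)\<^sup>2)"
              unfolding norm_power2_vec
            proof (rule sum_mono)
              show "(?P $ i)\<^sup>2 \<le> 2 * (Du x $ i)\<^sup>2 + 2 * (?D i x)\<^sup>2" for i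
                using power2_sum_le[of "Du x $ i" "?D i x"] by (simp add: \<eta>1 \<eta>0 weak_grad_def)
            qed
            then show ?thesis by (simp add: norm_power2_vec sum.distrib sum_distrib_left)
          qed
          have 5: "(trunc' \<beta> (u x))\<^sup>2 + (norm (Du x))\<^sup>2 \<le> K\<^sub>1 * dens x"
          proof -
            let ?A = "(a x *v Du x) \<bullet> Du x"
            have A: "0 \<le> ?A" by (rule a_form_nonneg[OF elim(1)])
            have bW: "0 \<le> b x * W (u x)" using b_pos[OF elim(1)] W_nonneg by simp
            have cl: "0 < c\<^sub>W * lam" using W_lower(2) lam by simp
            have "(norm (Du x))\<^sup>2 \<le> inverse lam * ?A"
              using a_lower[OF elim(1), of "Du x"] lam by (simp add: field_simps)
            also have "\<dots> \<le> inverse lam * dens x"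
              using bW lam by (intro mult_left_mono) (auto simp: dens_def)
            finally have i: "(norm (Du x))\<^sup>2 \<le> inverse lam * dens x" .
            \<comment> \<open>For \<open>\<bar>u x\<bar> \<ge> \<beta>\<close> the derivative of the
              truncation vanishes, so the zero of the potential at 1 does no harm; below
              \<open>\<beta>\<close> the quadratic lower bound applies.\<close>
            have "(trunc' \<beta> (u x))\<^sup>2 \<le> 16 * inverse (c\<^sub>W * lam) * dens x"
            proof (cases "\<bar>u x\<bar> \<ge> \<beta>")
              case True
              have "0 \<le> inverse (c\<^sub>W * lam)" by (rule less_imp_le[OF positive_imp_inverse_positive[OF cl]])
              then have "0 \<le> 16 * inverse (c\<^sub>W * lam) * dens x"
                using dn by (intro mult_nonneg_nonneg[OF mult_nonneg_nonneg]) simp_all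
              then show ?thesis using tb(4)[OF True] by simp
            next
              case False
              then have "c\<^sub>W * (u x)\<^sup>2 \<le> W (u x)" by (intro W_lower) simp
              then have "lam * (c\<^sub>W * (u x)\<^sup>2) \<le> b x * W (u x)"
                using b_bounds(1)[OF elim(1)] lam W_lower(2) by (intro mult_mono) auto
              also have "\<dots> \<le> dens x" using A by (simp add: dens_def)
              finally have "(u x)\<^sup>2 \<le> inverse (c\<^sub>W * lam) * dens x"
                using cl by (simp add: field_simps)
              then show ?thesis using tb(5)[of "u x"] by simp
            qed
            then show ?thesis using i unfolding K\<^sub>1_def distrib_right by linarith
          qed
          have 6: "trunc \<beta> (\<phi> x) * norm (?Z x) \<le>
             4 * B * C * (?I (s + 1) x * (u x)\<^sup>2 - ?I s x * (u x)\<^sup>2) + 4 * B * C * (?d x)\<^sup>2"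
          proof (cases "norm x < s")
            case True
            then have "?Z x = 0" using radial_cutoff_partial_deriv(1)[OF cut] by (simp add: vec_eq_iff)
            moreover have "0 \<le> 4 * B * C * (?d x)\<^sup>2" using BC by simp
            ultimately show ?thesis using True by simp
          next
            case False
            have "trunc \<beta> (\<phi> x) * norm (?Z x) \<le> (4 * B * (u x)\<^sup>2 + 4 * B * (?d x)\<^sup>2) * C"
              using tle[OF True] \<zeta>(6)[of x] tb(1) B by (intro mult_mono) auto
            then show ?thesis using False True by (simp add: algebra_simps)
          qed
          have I1: "?I (s + 1) x = 1" using True by simp
          have "norm (g x) \<le> K\<^sub>1 * dens x + (256 * (?d x)\<^sup>2 + (\<Sum>i\<in>UNIV. (?D i x)\<^sup>2))
             + (4 * B * C * (?I (s + 1) x * (u x)\<^sup>2 - ?I s x * (u x)\<^sup>2) + 4 * B * C * (?d x)\<^sup>2)"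
            using 1 2 3 4 5 6 by argo
          then show ?thesis unfolding I1 distrib_right by simp
        qed
      qed
    qed
    also have "\<dots> = K\<^sub>1 * E (s + 1) + 4 * B * C * (\<Phi> (s + 1) - \<Phi> s)
      + ((256 + 4 * B * C) * \<delta>\<^sub>0 + \<delta>\<^sub>1)"
      unfolding \<Phi>_def \<delta>\<^sub>0_def \<delta>\<^sub>1_def E_def using II d D
      by (simp add: Bochner_Integration.integral_sum)
    finally show ?thesis .
  qed
  have "mB * (B\<^sup>2 / 2 * V s - 8 / B\<^sup>2 * \<delta>\<^sub>0) \<le> mB * (\<integral>x. indicator ?S x * w x \<partial>\<mu>)"
    by (rule mult_left_mono[OF lower mB0])
  also note main
  also have "V s * (\<integral>x. w x \<partial>\<mu>) + r * mB * (\<integral>x. norm (g x) \<partial>\<mu>) \<le>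
     V s * (4 * B * (\<Phi> (s + 1) + \<delta>\<^sub>0)) + r * mB * (K\<^sub>1 * E (s + 1) + 4 * B * C * (\<Phi> (s + 1) - \<Phi> s)
      + ((256 + 4 * B * C) * \<delta>\<^sub>0 + \<delta>\<^sub>1))"
    using r mB0 by (intro add_mono mult_left_mono upper1 upper2 V_nonneg) auto
  finally show ?thesis .
qed

text \<open>The errors tend to 0 along the approximating test functions. The hypothesis
  \<open>big\<close> then makes the term with \<open>V s * (4 * B * \<Phi> (s + 1))\<close> at most
  half of the left-hand side, where it is absorbed. The extra unit in
  \<open>s + 2 \<le> \<rho>\<close> is room for the support of \<open>\<eta>\<close>.\<close>

lemma isoperimetric:
  fixes \<zeta> \<eta> :: "real^'n \<Rightarrow> real"
  assumes cut: "radial_cutoff C s \<zeta>"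
    and s: "0 < s" "s + 2 \<le> \<rho>" and r: "r > 0"
    and cut': "radial_cutoff C' (s + 1) \<eta>"
    and big: "16 * \<Phi> (s + 1) \<le> \<beta>\<^sup>2 * measure lborel (ball (0::real^'n) r)"
  shows "V s \<le> 4 / (\<beta>\<^sup>2)\<^sup>2 * r * ((16 * inverse (c\<^sub>W * lam) + inverse lam) * E (s + 1)
      + 4 * \<beta>\<^sup>2 * C * (\<Phi> (s + 1) - \<Phi> s))"
proof -
  define B mB where "B = \<beta>\<^sup>2" and "mB = measure lborel (ball (0::real^'n) r)"
  define X where "X = (16 * inverse (c\<^sub>W * lam) + inverse lam) * E (s + 1) + 4 * B * C * (\<Phi> (s + 1) - \<Phi> s)"
  have B: "0 < B" using \<beta> by (simp add: B_def)
  have T: "test_fun \<Omega> \<eta>"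
    by (rule test_fun_radial_cutoff[OF cut']) (use s in simp)
  have uL: "in_L2 \<Omega> u" using H1 by (simp add: in_H1_def)
  note wp = in_H1_weak_partial[OF open_ball H1]
  obtain \<phi> where \<phi>: "\<And>k::nat. test_fun \<Omega> (\<phi> k)"
     "(\<lambda>k. \<integral>x. (\<phi> k x - \<eta> x * u x)\<^sup>2 \<partial>\<mu>) \<longlonglongrightarrow> 0"
     "\<And>i. (\<lambda>k. \<integral>x. (partial_deriv i (\<phi> k) x - (\<eta> x * weak_partial \<Omega> i u x + partial_deriv i \<eta> x * u x))\<^sup>2 \<partial>\<mu>)
        \<longlonglongrightarrow> 0"
    using H1_cutoff_approx[OF open_ball T wp(1) uL wp(2)] by blast
  have test_L2: "in_L2 \<Omega> \<psi>" if T\<psi>: "test_fun \<Omega> \<psi>" for \<psi>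
  proof -
    have m: "\<psi> \<in> borel_measurable \<mu>"
      by (intro borel_measurable_lebesgue_on_borel smooth_borel_measurable test_fun_smooth[OF T\<psi>])
    obtain K where K: "\<And>x. \<bar>\<psi> x\<bar> \<le> K" using test_fun_bounded[OF T\<psi>] by blast
    have "integrable \<mu> (\<lambda>x. (\<psi> x)\<^sup>2)"
    proof (rule bounded_integrable[where B = "K\<^sup>2"])
      have "(\<psi> x)\<^sup>2 \<le> K\<^sup>2" for x using power_mono[OF K[of x], of 2] by simp
      then show "AE x in \<mu>. \<bar>(\<psi> x)\<^sup>2\<bar> \<le> K\<^sup>2" by simp
    qed (use m in measurable)
    then show ?thesis using m by (simp add: in_L2_def)
  qed
  have \<eta>b: "\<eta> \<in> borel_measurable borel" "\<And>i. partial_deriv i \<eta> \<in> borel_measurable borel"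
    using radial_cutoffD(1)[OF cut'] by (auto intro: smooth_borel_measurable smooth_partial_deriv)
  obtain K where K: "\<And>x. \<bar>\<eta> x\<bar> \<le> K" using test_fun_bounded[OF T] by blast
  have "\<exists>K. \<forall>x. \<bar>partial_deriv i \<eta> x\<bar> \<le> K" for i
    using test_fun_bounded[OF test_fun_partial_deriv[OF T, of i]] by blast
  then obtain K' where K': "\<And>i x. \<bar>partial_deriv i \<eta> x\<bar> \<le> K' i" by metis
  have L2diff: "integrable \<mu> (\<lambda>x. (f x - g x)\<^sup>2)" if "in_L2 \<Omega> f" "in_L2 \<Omega> g" for f g :: "real^'n \<Rightarrow> real"
    using that by (intro integrable_power2_diff(1)) (auto simp: in_L2_def)
  have d: "integrable \<mu> (\<lambda>x. (\<phi> k x - \<eta> x * u x)\<^sup>2)" for k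
    by (intro L2diff test_L2 \<phi>(1) in_L2_bounded_mult[OF uL \<eta>b(1) K])
  have D: "integrable \<mu> (\<lambda>x. (partial_deriv i (\<phi> k) x - (\<eta> x * weak_partial \<Omega> i u x + partial_deriv i \<eta> x * u x))\<^sup>2)" for k i
    by (intro L2diff test_L2 test_fun_partial_deriv \<phi>(1) in_L2_add in_L2_bounded_mult[OF wp(2) \<eta>b(1) K]
        in_L2_bounded_mult[OF uL \<eta>b(2) K'])
  have s': "s + 1 \<le> \<rho>" using s by simp
  define \<delta>\<^sub>0 where "\<delta>\<^sub>0 k = (\<integral>x. (\<phi> k x - \<eta> x * u x)\<^sup>2 \<partial>\<mu>)" for k
  define \<delta>\<^sub>1 where "\<delta>\<^sub>1 k = (\<Sum>i\<in>UNIV. \<integral>x. (partial_deriv i (\<phi> k) x - (\<eta> x * weak_partial \<Omega> i u x + partial_deriv i \<eta> x * u x))\<^sup>2 \<partial>\<mu>)" for k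
  have step: "mB * (B\<^sup>2 / 2 * V s - 8 / B\<^sup>2 * \<delta>\<^sub>0 k) \<le> V s * (4 * B * (\<Phi> (s + 1) + \<delta>\<^sub>0 k))
     + r * mB * (X + ((256 + 4 * B * C) * \<delta>\<^sub>0 k + \<delta>\<^sub>1 k))" for k
    using isoperimetric_approx[OF cut s(1) s' r cut' \<phi>(1)[of k] d[of k] D[of _ k]]
    unfolding \<delta>\<^sub>0_def \<delta>\<^sub>1_def B_def mB_def X_def by simp
  have l0: "\<delta>\<^sub>0 \<longlonglongrightarrow> 0" unfolding \<delta>\<^sub>0_def by (rule \<phi>(2))
  have l1: "\<delta>\<^sub>1 \<longlonglongrightarrow> 0"
  proof -
    have "\<delta>\<^sub>1 \<longlonglongrightarrow> (\<Sum>i\<in>(UNIV::'n set). 0)" unfolding \<delta>\<^sub>1_def by (intro tendsto_sum \<phi>(3))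
    then show ?thesis by simp
  qed
  have "(\<lambda>k. mB * (B\<^sup>2 / 2 * V s - 8 / B\<^sup>2 * \<delta>\<^sub>0 k)) \<longlonglongrightarrow> mB * (B\<^sup>2 / 2 * V s - 8 / B\<^sup>2 * 0)"
    by (intro tendsto_intros l0)
  moreover have "(\<lambda>k. V s * (4 * B * (\<Phi> (s + 1) + \<delta>\<^sub>0 k)) + r * mB * (X + ((256 + 4 * B * C) * \<delta>\<^sub>0 k + \<delta>\<^sub>1 k)))
     \<longlonglongrightarrow> V s * (4 * B * (\<Phi> (s + 1) + 0)) + r * mB * (X + ((256 + 4 * B * C) * 0 + 0))"
    by (intro tendsto_intros l0 l1)
  ultimately have "mB * (B\<^sup>2 / 2 * V s - 8 / B\<^sup>2 * 0) \<le>
      V s * (4 * B * (\<Phi> (s + 1) + 0)) + r * mB * (X + ((256 + 4 * B * C) * 0 + 0))"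
    by (rule LIMSEQ_le) (use step in auto)
  then have lim: "mB * (B\<^sup>2 / 2 * V s) \<le> V s * (4 * B * \<Phi> (s + 1)) + r * mB * X" by simp
  have "V s * (4 * B * \<Phi> (s + 1)) \<le> V s * (B * (B * mB) / 4)"
  proof (rule mult_left_mono[OF _ V_nonneg])
    have "B * (16 * \<Phi> (s + 1)) \<le> B * (B * mB)"
      using big B unfolding B_def mB_def by (intro mult_left_mono) auto
    then show "4 * B * \<Phi> (s + 1) \<le> B * (B * mB) / 4" by simp
  qed
  then have "mB * (B\<^sup>2 / 4 * V s) \<le> mB * (r * X)"
    using lim by (simp add: power2_eq_square algebra_simps)
  moreover have "mB > 0" using r unfolding mB_def by (simp add: content_ball_pos)
  ultimately have "B\<^sup>2 / 4 * V s \<le> r * X" by simp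
  then have "V s \<le> 4 / B\<^sup>2 * (r * X)" using B by (simp add: field_simps)
  then show ?thesis by (simp add: B_def X_def mult.assoc)
qed

end

section \<open>Growth of the superlevel sets\<close>

text \<open>Bernoulli's inequality at -2/R, multiplied by \<open>R ^ n\<close>. It shows that
  \<open>R ^ n\<close> grows over a step of length 2 by at most a multiple of R^(n-1), the order of
  the increments available for \<open>\<Phi>\<close>.\<close>

lemma power_diff_2_ge:
  assumes "R \<ge> (3::real)" "n \<ge> 1"
  shows "R ^ n - 2 * real n * R ^ (n - 1) \<le> (R - 2) ^ n"
proof -
  obtain k where k: "n = Suc k" using assms(2) by (cases n) auto
  have "1 + real n * (- 2 / R) \<le> (1 + (- 2 / R)) ^ n"
    using assms(1) by (intro Bernoulli_inequality) (simp add: field_simps)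
  then have "R ^ n * (1 + real n * (- 2 / R)) \<le> R ^ n * (1 + (- 2 / R)) ^ n"
    using assms(1) by (intro mult_left_mono) auto
  also have "R ^ n * (1 + (- 2 / R)) ^ n = (R - 2) ^ n"
    using assms(1) by (simp add: power_mult_distrib[symmetric] field_simps)
  also have "R ^ n * (1 + real n * (- 2 / R)) = R ^ n - 2 * real n * R ^ (n - 1)"
    using assms(1) by (simp add: k field_simps)
  finally show ?thesis .
qed

lemma power_third_le:
  assumes "R \<ge> (3::real)"
  shows "R ^ n / 3 ^ n \<le> (R - 2) ^ n"
proof -
  have "(R / 3) ^ n \<le> (R - 2) ^ n" using assms by (intro power_mono) auto
  then show ?thesis by (simp add: power_divide)
qed

text \<open>If \<open>\<Phi> R\<close> fell below \<open>c * R ^ n\<close>, the smallness condition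
  would hold with \<open>r\<close> proportional to \<open>R\<close> and would force an increment at
  least as large as that of \<open>c * R ^ n\<close>, contradicting the bound at
  \<open>R - 2\<close>. The constants precede the quantifiers over \<open>\<Phi>\<close>,
  \<open>\<rho>\<close> and \<open>M\<close>, so they are uniform over all minimizers.\<close>

lemma growth_iteration:
  fixes n :: nat and K \<kappa> m :: real
  assumes n: "n \<ge> 1" and K: "K > 0" and \<kappa>: "\<kappa> > 0" and m: "m > 0"
  shows "\<exists>c>0. \<exists>c'>0. \<forall>(\<Phi>::real \<Rightarrow> real) \<rho> M. mono \<Phi> \<longrightarrow> m \<le> \<Phi> 1 \<longrightarrow> 0 \<le> M \<longrightarrow>
     (\<forall>R r. 3 \<le> R \<longrightarrow> R \<le> \<rho> \<longrightarrow> 1 \<le> r \<longrightarrow> \<Phi> R \<le> \<kappa> * r ^ n \<longrightarrow>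
        \<Phi> (R - 2) \<le> K * r * (\<Phi> R - \<Phi> (R - 2) + M * R ^ n)) \<longrightarrow>
     (\<forall>R. 1 \<le> R \<longrightarrow> R \<le> \<rho> \<longrightarrow> M * R \<le> c' \<longrightarrow> c * R ^ n \<le> \<Phi> R)"
proof -
  define \<sigma> where "\<sigma> = 1 / (4 * real n * 3 ^ n * K)"
  \<comment> \<open>With \<open>r = \<sigma> R\<close>, the hypothesis on \<open>\<Phi>\<close> yields an increment of at least \<open>4 n c R\<^sup>n\<^sup>-\<^sup>1 - M R\<^sup>n\<close>.\<close>
  have \<sigma>: "\<sigma> > 0" using n K by (simp add: \<sigma>_def)
  have \<sigma>K: "K * \<sigma> * (4 * real n * 3 ^ n) = 1" using n K by (simp add: \<sigma>_def)
  \<comment> \<open>From this radius on \<open>\<sigma> * R \<ge> 1\<close>, as required of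
    \<open>r\<close>.\<close>
  define R\<^sub>1 where "R\<^sub>1 = 1 / \<sigma> + 3"
  have R1: "R\<^sub>1 > 3" using \<sigma> by (simp add: R\<^sub>1_def)
  \<comment> \<open>The first entry makes a failure at \<open>R\<close> imply the smallness
    condition with \<open>r = \<sigma> * R\<close>. The second settles all radii up to
    \<open>R\<^sub>1\<close> by monotonicity and the bound at 1.\<close>
  define c where "c = min (\<kappa> * \<sigma> ^ n) (m / R\<^sub>1 ^ n)"
  have c: "c > 0" using \<kappa> \<sigma> m R1 by (simp add: c_def)
  \<comment> \<open>The error \<open>M * R ^ n\<close> thus takes at most half of the increment 4 n
    c R^(n-1), and the other half is what \<open>power_diff_2_ge\<close> asks for.\<close>
  define c' where "c' = 2 * real n * c"
  have c': "c' > 0" using n c by (simp add: c'_def)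
  have "c * R ^ n \<le> \<Phi> R"
    if mono: "mono \<Phi>" and m1: "m \<le> \<Phi> 1" and M: "0 \<le> M"
      and step: "\<And>R r. 3 \<le> R \<Longrightarrow> R \<le> \<rho> \<Longrightarrow> 1 \<le> r \<Longrightarrow> \<Phi> R \<le> \<kappa> * r ^ n \<Longrightarrow>
        \<Phi> (R - 2) \<le> K * r * (\<Phi> R - \<Phi> (R - 2) + M * R ^ n)"
      and R: "1 \<le> R" "R \<le> \<rho>" "M * R \<le> c'"
    for \<Phi> :: "real \<Rightarrow> real" and \<rho> M R
  proof -
    \<comment> \<open>Windows of length 2, indexed by \<open>k\<close>, turn the descent from
      \<open>R\<close> to \<open>R - 2\<close> into an induction on natural numbers.\<close>
    have "c * R ^ n \<le> \<Phi> R" if "R < R\<^sub>1 + 2 * real k" "1 \<le> R" "R \<le> \<rho>" "M * R \<le> c'" for k R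
      using that
    proof (induction k arbitrary: R)
      case 0
      have "c * R ^ n \<le> m / R\<^sub>1 ^ n * R\<^sub>1 ^ n"
        using 0 R1 m by (intro mult_mono power_mono) (auto simp: c_def)
      also have "\<dots> = m" using R1 by simp
      also have "m \<le> \<Phi> R" using m1 monoD[OF mono 0(2)] by linarith
      finally show ?case .
    next
      case (Suc k)
      show ?case
      proof (cases "R < R\<^sub>1")
        case True
        have "c * R ^ n \<le> m / R\<^sub>1 ^ n * R\<^sub>1 ^ n"
          using True Suc.prems R1 m by (intro mult_mono power_mono) (auto simp: c_def)
        also have "\<dots> = m" using R1 by simp
        also have "m \<le> \<Phi> R" using m1 monoD[OF mono Suc.prems(2)] by linarith
        finally show ?thesis .
      next
        case False
        then have R3: "R \<ge> 3" using R1 by simp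
        have r1: "1 \<le> \<sigma> * R"
        proof -
          have "1 / \<sigma> \<le> R" using False by (simp add: R\<^sub>1_def)
          then show ?thesis using \<sigma> by (simp add: field_simps)
        qed
        have "M * (R - 2) \<le> M * R" using M by (intro mult_left_mono) auto
        then have IH: "c * (R - 2) ^ n \<le> \<Phi> (R - 2)"
          using Suc.prems R3 by (intro Suc.IH) auto
        show ?thesis
        proof (rule ccontr)
          assume "\<not> ?thesis"
          then have less: "\<Phi> R < c * R ^ n" by simp
          define \<Delta> where "\<Delta> = \<Phi> R - \<Phi> (R - 2)"
          have "c * R ^ n \<le> \<kappa> * \<sigma> ^ n * R ^ n"
            using R3 by (intro mult_right_mono) (auto simp: c_def)
          then have "\<Phi> R \<le> \<kappa> * (\<sigma> * R) ^ n" using less by (simp add: power_mult_distrib)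
          from step[OF R3 Suc.prems(3) r1 this]
          have 1: "\<Phi> (R - 2) \<le> K * (\<sigma> * R) * (\<Delta> + M * R ^ n)" by (simp add: \<Delta>_def)
          obtain j where j: "n = Suc j" using n by (cases n) auto
          have "c * (R ^ n / 3 ^ n) \<le> c * (R - 2) ^ n"
            using power_third_le[OF R3] c by (intro mult_left_mono) auto
          then have "c * R ^ n / 3 ^ n \<le> K * (\<sigma> * R) * (\<Delta> + M * R ^ n)" using IH 1 by simp
          then have "(c * R ^ n / 3 ^ n) * (4 * real n * 3 ^ n) \<le> K * (\<sigma> * R) * (\<Delta> + M * R ^ n) * (4 * real n * 3 ^ n)"
            by (rule mult_right_mono) simp
          also have "\<dots> = (K * \<sigma> * (4 * real n * 3 ^ n)) * (R * (\<Delta> + M * R ^ n))" by (simp only: mult_ac)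
          also have "\<dots> = R * (\<Delta> + M * R ^ n)" by (simp only: \<sigma>K mult_1)
          finally have "R * (4 * real n * c * R ^ j) \<le> R * (\<Delta> + M * R ^ n)"
            by (simp add: j mult_ac)
          then have 2: "4 * real n * c * R ^ j \<le> \<Delta> + M * R ^ n"
            using R3 by (simp add: mult_le_cancel_left)
          have "M * R ^ n = M * R * R ^ j" by (simp add: j)
          also have "\<dots> \<le> c' * R ^ j" using Suc.prems(4) R3 by (intro mult_right_mono) auto
          finally have 3: "2 * real n * c * R ^ j \<le> \<Delta>" using 2 by (simp add: c'_def)
          have "c * (R ^ n - 2 * real n * R ^ (n - 1)) \<le> c * (R - 2) ^ n"
            using power_diff_2_ge[OF R3 n] c by (intro mult_left_mono) auto
          then have "c * R ^ n - 2 * real n * c * R ^ j \<le> \<Phi> (R - 2)"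
            using IH by (simp add: j right_diff_distrib mult_ac)
          then show False using 3 less by (simp add: \<Delta>_def)
        qed
      qed
    qed
    moreover obtain k :: nat where "R - R\<^sub>1 < real k" using reals_Archimedean2 by blast
    then have "R < R\<^sub>1 + 2 * real k" by linarith
    ultimately show ?thesis using R by blast
  qed
  then show ?thesis using c c' by blast
qed

section \<open>The recursion for the minimizer\<close>

context bounded_minimizer
begin

text \<open>The Caccioppoli inequality is read in two ways. With the increment of
  \<open>\<Phi>\<close> it feeds the recursion; with \<open>\<bar>u\<bar> \<le> 3/2\<close> on the
  shell it shows that \<open>E\<close> is of order R^(n-1) as long as \<open>M\<close> times the
  radius stays bounded.\<close>

lemma E_estimates:
  fixes C :: real
  assumes cut: "\<And>s. s > 0 \<Longrightarrow> \<exists>\<zeta>::real^'n \<Rightarrow> real. radial_cutoff C s \<zeta>"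
    and s: "0 < s" "s + 1 \<le> \<rho>"
  defines "C\<^sub>1 \<equiv> 2 * (inverse lam * (12 * C\<^sup>2 + K\<^sub>W))" and "\<omega> \<equiv> unit_ball_vol (real CARD('n))"
  shows "E s \<le> C\<^sub>1 * (\<Phi> (s + 1) - \<Phi> s) + 4 * \<omega> * M * (s + 1) ^ CARD('n)"
    and "E s \<le> (9/4 * C\<^sub>1 * \<omega> * real CARD('n) + 4 * \<omega> * (M * (s + 1))) * (s + 1) ^ (CARD('n) - 1)"
proof -
  obtain \<zeta> :: "real^'n \<Rightarrow> real" where \<zeta>: "radial_cutoff C s \<zeta>" using cut[OF s(1)] by blast
  show 1: "E s \<le> C\<^sub>1 * (\<Phi> (s + 1) - \<Phi> s) + 4 * \<omega> * M * (s + 1) ^ CARD('n)"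
    using energy_estimate[OF \<zeta> s] by (simp add: C\<^sub>1_def \<omega>_def field_simps)
  obtain k where k: "CARD('n) = Suc k" using zero_less_card_finite[where ?'a = 'n] by (cases "CARD('n)") auto
  have C1: "0 \<le> C\<^sub>1" using lam W_upper(2) by (simp add: C\<^sub>1_def)
  have \<omega>: "0 \<le> \<omega>" by (simp add: \<omega>_def)
  have "(s + 1) ^ Suc k - s ^ Suc k \<le> real (Suc k) * (s + 1) ^ k"
  proof -
    have "(s + 1) ^ Suc k - s ^ Suc k = ((s + 1) - s) * (\<Sum>i<Suc k. s ^ (Suc k - Suc i) * (s + 1) ^ i)"
      by (rule power_diff_sumr2)
    also have "\<dots> \<le> (\<Sum>i<Suc k. (s + 1) ^ k)"
    proof -
      have "s ^ (Suc k - Suc i) * (s + 1) ^ i \<le> (s + 1) ^ k" if "i < Suc k" for i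
      proof -
        have "(s + 1) ^ i * s ^ (k - i) \<le> (s + 1) ^ i * (s + 1) ^ (k - i)"
          using s by (intro mult_left_mono power_mono) auto
        also have "\<dots> = (s + 1) ^ k" using that by (simp add: power_add[symmetric])
        finally show ?thesis by (simp add: mult.commute)
      qed
      then have "(\<Sum>i<Suc k. s ^ (Suc k - Suc i) * (s + 1) ^ i) \<le> (\<Sum>i<Suc k. (s + 1) ^ k)"
        by (intro sum_mono) auto
      then show ?thesis by simp
    qed
    finally show ?thesis by simp
  qed
  then have "9/4 * \<omega> * ((s + 1) ^ CARD('n) - s ^ CARD('n)) \<le> 9/4 * \<omega> * (real CARD('n) * (s + 1) ^ (CARD('n) - 1))"
    unfolding k using \<omega> by (intro mult_left_mono) auto
  from order_trans[OF \<Phi>_annulus[OF less_imp_le[OF s(1)] s(2), folded \<omega>_def] this]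
  have "\<Phi> (s + 1) - \<Phi> s \<le> 9/4 * \<omega> * (real CARD('n) * (s + 1) ^ (CARD('n) - 1))" .
  then have "C\<^sub>1 * (\<Phi> (s + 1) - \<Phi> s) \<le> C\<^sub>1 * (9/4 * \<omega> * (real CARD('n) * (s + 1) ^ (CARD('n) - 1)))"
    using C1 by (intro mult_left_mono)
  then have "E s \<le> C\<^sub>1 * (9/4 * \<omega> * (real CARD('n) * (s + 1) ^ (CARD('n) - 1))) + 4 * \<omega> * M * (s + 1) ^ CARD('n)"
    using 1 by linarith
  also have "\<dots> = (9/4 * C\<^sub>1 * \<omega> * real CARD('n) + 4 * \<omega> * (M * (s + 1))) * (s + 1) ^ (CARD('n) - 1)"
    unfolding k by (simp add: algebra_simps)
  finally show "E s \<le> (9/4 * C\<^sub>1 * \<omega> * real CARD('n) + 4 * \<omega> * (M * (s + 1))) * (s + 1) ^ (CARD('n) - 1)" .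
qed

text \<open>Every contribution is bounded by a multiple of \<open>X\<close>, the increment plus the
  error. The distance 2 consists of two unit shells: one for the cutoff in
  \<open>isoperimetric\<close>, and one for the Caccioppoli inequality that bounds
  \<open>E (R - 1)\<close>.\<close>

lemma \<Phi>_step:
  fixes C :: real
  assumes cut: "\<And>s. s > 0 \<Longrightarrow> \<exists>\<zeta>::real^'n \<Rightarrow> real. radial_cutoff C s \<zeta>"
    and C: "C > 0" and R: "3 \<le> R" "R \<le> \<rho>" and r: "1 \<le> r"
    and big: "\<Phi> R \<le> \<beta>\<^sup>2 * unit_ball_vol (real CARD('n)) / 16 * r ^ CARD('n)"
  defines "C\<^sub>1 \<equiv> 2 * (inverse lam * (12 * C\<^sup>2 + K\<^sub>W))" and "\<omega> \<equiv> unit_ball_vol (real CARD('n))"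
    and "K\<^sub>1 \<equiv> 16 * inverse (c\<^sub>W * lam) + inverse lam" and "K\<^sub>2 \<equiv> 4 / (\<beta>\<^sup>2)\<^sup>2" and "K\<^sub>3 \<equiv> 4 * \<beta>\<^sup>2 * C"
  shows "\<Phi> (R - 2) \<le> (9/4 * K\<^sub>2 * (K\<^sub>1 * (C\<^sub>1 + 4 * \<omega>) + K\<^sub>3) + inverse (c\<^sub>W * lam) * (C\<^sub>1 + 4 * \<omega>)) * r *
     (\<Phi> R - \<Phi> (R - 2) + M * R ^ CARD('n))"
proof -
  let ?s = "R - 2"
  have s: "0 < ?s" "?s + 2 \<le> \<rho>" using R by auto
  obtain \<zeta> \<eta> :: "real^'n \<Rightarrow> real" where \<zeta>: "radial_cutoff C ?s \<zeta>" and \<eta>: "radial_cutoff C (?s + 1) \<eta>"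
    using cut[OF s(1)] cut[of "?s + 1"] s by auto
  define \<Delta> where "\<Delta> = \<Phi> R - \<Phi> ?s"
  define X where "X = \<Delta> + M * R ^ CARD('n)"
  have cl: "0 < inverse (c\<^sub>W * lam)" using W_lower(2) lam by simp
  have pos: "0 \<le> C\<^sub>1" "0 \<le> \<omega>" "0 \<le> K\<^sub>1" "0 \<le> K\<^sub>2" "0 \<le> K\<^sub>3"
    using lam W_upper(2) W_lower(2) \<beta> C by (simp_all add: C\<^sub>1_def \<omega>_def K\<^sub>1_def K\<^sub>2_def K\<^sub>3_def)
  have \<Delta>: "0 \<le> \<Delta>" "\<Phi> R - \<Phi> (R - 1) \<le> \<Delta>" "\<Phi> (R - 1) - \<Phi> ?s \<le> \<Delta>" "\<Phi> (R - 1) \<le> \<Phi> R"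
    using \<Phi>_mono[of ?s R] \<Phi>_mono[of ?s "R - 1"] \<Phi>_mono[of "R - 1" R] by (auto simp: \<Delta>_def)
  have MR: "0 \<le> M * R ^ CARD('n)" using M R by simp
  have X: "\<Delta> \<le> X" "0 \<le> X" using \<Delta>(1) MR by (auto simp: X_def)
  have "E (R - 1) \<le> C\<^sub>1 * (\<Phi> R - \<Phi> (R - 1)) + 4 * \<omega> * M * R ^ CARD('n)"
    using E_estimates(1)[OF cut, of "R - 1"] R by (simp add: C\<^sub>1_def \<omega>_def)
  also have "\<dots> \<le> C\<^sub>1 * X + 4 * \<omega> * X"
  proof (rule add_mono)
    show "C\<^sub>1 * (\<Phi> R - \<Phi> (R - 1)) \<le> C\<^sub>1 * X" using \<Delta>(2) X(1) pos by (intro mult_left_mono) auto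
    have "4 * \<omega> * (M * R ^ CARD('n)) \<le> 4 * \<omega> * X" using \<Delta>(1) pos by (intro mult_left_mono) (auto simp: X_def)
    then show "4 * \<omega> * M * R ^ CARD('n) \<le> 4 * \<omega> * X" by (simp add: mult.assoc)
  qed
  finally have E1: "E (R - 1) \<le> (C\<^sub>1 + 4 * \<omega>) * X" by (simp add: distrib_right)
  have "16 * \<Phi> (?s + 1) \<le> \<beta>\<^sup>2 * measure lborel (ball (0::real^'n) r)"
  proof -
    have "measure lborel (ball (0::real^'n) r) = \<omega> * r ^ CARD('n)"
      using content_ball[of r "0::real^'n"] r by (simp add: \<omega>_def)
    then show ?thesis using big \<Delta>(4) by (simp add: \<omega>_def)
  qed
  from isoperimetric[OF \<zeta> s _ \<eta> this] r
  have "V ?s \<le> K\<^sub>2 * r * (K\<^sub>1 * E (R - 1) + K\<^sub>3 * (\<Phi> (R - 1) - \<Phi> ?s))"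
    by (simp add: K\<^sub>1_def K\<^sub>2_def K\<^sub>3_def)
  also have "\<dots> \<le> K\<^sub>2 * r * (K\<^sub>1 * ((C\<^sub>1 + 4 * \<omega>) * X) + K\<^sub>3 * X)"
    using pos r E1 \<Delta>(3) X(1) by (intro mult_left_mono add_mono) auto
  also have "\<dots> = K\<^sub>2 * (K\<^sub>1 * (C\<^sub>1 + 4 * \<omega>) + K\<^sub>3) * r * X" by (simp add: algebra_simps)
  finally have "9/4 * V ?s \<le> 9/4 * (K\<^sub>2 * (K\<^sub>1 * (C\<^sub>1 + 4 * \<omega>) + K\<^sub>3) * r * X)" by simp
  then have V1: "9/4 * V ?s \<le> 9/4 * K\<^sub>2 * (K\<^sub>1 * (C\<^sub>1 + 4 * \<omega>) + K\<^sub>3) * r * X"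
    by (simp only: mult.assoc)
  have "inverse (c\<^sub>W * lam) * E ?s \<le> inverse (c\<^sub>W * lam) * ((C\<^sub>1 + 4 * \<omega>) * X)"
    using E1 E_mono[of ?s "R - 1"] cl by (intro mult_left_mono) auto
  \<comment> \<open>Here \<open>r \<ge> 1\<close> gives the energy term the same factor
    \<open>r * X\<close> as the superlevel term.\<close>
  also have "\<dots> \<le> inverse (c\<^sub>W * lam) * ((C\<^sub>1 + 4 * \<omega>) * X) * r"
    using mult_left_mono[of 1 r "inverse (c\<^sub>W * lam) * ((C\<^sub>1 + 4 * \<omega>) * X)"] r pos cl X(2) by simp
  finally have E2: "inverse (c\<^sub>W * lam) * E ?s \<le> inverse (c\<^sub>W * lam) * (C\<^sub>1 + 4 * \<omega>) * r * X"
    by (simp add: mult_ac)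
  have "\<Phi> ?s \<le> 9/4 * V ?s + inverse (c\<^sub>W * lam) * E ?s" using R by (intro \<Phi>_le) simp
  also have "\<dots> \<le> 9/4 * K\<^sub>2 * (K\<^sub>1 * (C\<^sub>1 + 4 * \<omega>) + K\<^sub>3) * r * X + inverse (c\<^sub>W * lam) * (C\<^sub>1 + 4 * \<omega>) * r * X"
    using V1 E2 by (rule add_mono)
  also have "\<dots> = (9/4 * K\<^sub>2 * (K\<^sub>1 * (C\<^sub>1 + 4 * \<omega>) + K\<^sub>3) + inverse (c\<^sub>W * lam) * (C\<^sub>1 + 4 * \<omega>)) * r * X"
    by (simp only: distrib_right)
  finally show ?thesis by (simp add: X_def \<Delta>_def)
qed

end

text \<open>In \<open>ereal\<close> the inverse of 0 is infinite and the inverse of \<infinity> is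
  0. A vanishing norm therefore makes the condition on \<open>R\<close> void and permits
  \<open>M = 0\<close>, whereas infinite or negative values of \<open>L\<close> contradict
  \<open>R \<ge> 1\<close>.\<close>

lemma ereal_bound_from_inverse:
  assumes "1 \<le> R" "0 < C" "ereal R \<le> ereal C * inverse L"
  shows "\<exists>M\<ge>0. L \<le> ereal M \<and> M * R \<le> C"
proof (cases L)
  case (real x)
  consider "x = 0" | "x > 0" | "x < 0" by linarith
  then show ?thesis
  proof cases
    case 1
    then show ?thesis using real assms by (intro exI[of _ 0]) simp
  next
    case 2
    then have "R \<le> C * inverse x" using real assms(3) by simp
    then show ?thesis using 2 real by (intro exI[of _ x]) (simp add: field_simps)
  next
    case 3
    then have "R \<le> C * inverse x" using real assms(3) by simp
    moreover have "C * inverse x < 0" using 3 assms(2) by (simp add: mult_pos_neg)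
    ultimately show ?thesis using assms(1) by linarith
  qed
qed (use assms in auto)

section \<open>Choice of the constants and conclusion\<close>

theorem corollaryA3:
  fixes f :: "real \<Rightarrow> real" and \<gamma> lam \<beta> N m :: real
  assumes n: "CARD('n::finite) \<ge> 2"
    and \<gamma>: "0 < \<gamma>" "\<gamma> \<le> 1"
    and f: "C1_holder_loc \<gamma> f" "f 0 = 0" "f 1 = 0" "deriv f 0 < 0" "deriv f 1 < 0"
    and W: "potential f 0 = 0" "potential f 1 = 0"
      "\<And>s. s \<noteq> 0 \<Longrightarrow> s \<noteq> 1 \<Longrightarrow> potential f s > 0"
      "Liminf at_infinity (\<lambda>s. ereal (potential f s)) > 0"
    and lam: "lam > 0"
    and \<beta>: "0 < \<beta>" "\<beta> < 1"
    and m: "m > 0"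
  shows "\<exists>C>0. \<exists>C'>0.
    \<forall>(\<rho>::real) (a :: real^'n \<Rightarrow> real^'n^'n) (b :: real^'n \<Rightarrow> real)
      (G :: real^'n \<Rightarrow> real \<Rightarrow> real) (u :: real^'n \<Rightarrow> real).
      \<rho> > 2 \<and>
      in_W1inf (ball 0 \<rho>) a \<and> W1inf_norm (ball 0 \<rho>) a = ereal N \<and>
      (\<forall>x\<in>ball 0 \<rho>. transpose (a x) = a x) \<and>
      in_Linf (ball 0 \<rho>) b \<and>
      caratheodory (ball 0 \<rho>) G \<and>
      (\<forall>x\<in>ball 0 \<rho>. lam \<le> b x \<and> b x \<le> inverse lam) \<and>
      (\<forall>x\<in>ball 0 \<rho>. \<forall>\<xi>. lam * (norm \<xi>)\<^sup>2 \<le> (a x *v \<xi>) \<bullet> \<xi> \<and>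
                          (a x *v \<xi>) \<bullet> \<xi> \<le> inverse lam * (norm \<xi>)\<^sup>2) \<and>
      is_minimizer (ball 0 \<rho>) f a b G u \<and>
      Linf_norm (ball 0 \<rho>) (\<lambda>x. u x - 1/2) \<le> 1 \<and>
      superlevel_measure u \<beta> 1 = m
      \<longrightarrow> (\<forall>R. 1 \<le> R \<and> R \<le> \<rho> \<and>
             ereal R \<le> ereal C' * inverse (Linf_norm (ball 0 \<rho> \<times> {-1/2<..<3/2}) (\<lambda>(x, s). G x s))
             \<longrightarrow> superlevel_measure u \<beta> R \<ge> C * R ^ CARD('n))"
proof -
  have fd: "f differentiable (at x)" for x using f(1) by (simp add: C1_holder_loc_def)
  have fc: "continuous_on UNIV f"
    using fd by (auto simp: continuous_on_eq_continuous_at differentiable_imp_continuous_within)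
  have Wc: "continuous_on UNIV (potential f)"
    using potential_deriv[OF fc] DERIV_isCont by (auto simp: continuous_on_eq_continuous_at)
  have W0: "0 \<le> potential f s" for s using W(1,2) W(3)[of s] by (cases "s = 0 \<or> s = 1") auto
  obtain c\<^sub>W K\<^sub>W where cK: "0 < c\<^sub>W" "0 < K\<^sub>W" "\<And>s. \<bar>s\<bar> \<le> \<beta> \<Longrightarrow> c\<^sub>W * s\<^sup>2 \<le> potential f s"
    "\<And>s. \<bar>s\<bar> \<le> 3/2 \<Longrightarrow> potential f s \<le> K\<^sub>W * s\<^sup>2"
    using potential_bounds[OF fd f(2,4) W(1,3) \<beta>] by blast
  obtain Cc :: real where Cc: "Cc > 0" and cut: "\<And>s. s > 0 \<Longrightarrow> \<exists>\<zeta>::real^'n \<Rightarrow> real. radial_cutoff Cc s \<zeta>"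
    using ex_radial_cutoff[where ?'n = 'n] by blast
  define n where "n = CARD('n)"
  define \<omega> where "\<omega> = unit_ball_vol (real n)"
  define C\<^sub>1 where "C\<^sub>1 = 2 * (inverse lam * (12 * Cc\<^sup>2 + K\<^sub>W))"
  define K\<^sub>1 where "K\<^sub>1 = 16 * inverse (c\<^sub>W * lam) + inverse lam"
  define K\<^sub>4 where "K\<^sub>4 = inverse (c\<^sub>W * lam)"
  \<comment> \<open>This is the factor in \<open>\<Phi>_step\<close>. It is built from
    \<open>lam\<close>, \<open>\<beta>\<close>, the two constants of the potential, the cutoff
    constant and the volume of the unit ball.\<close>
  define K where "K = 9/4 * (4 / (\<beta>\<^sup>2)\<^sup>2) * (K\<^sub>1 * (C\<^sub>1 + 4 * \<omega>) + 4 * \<beta>\<^sup>2 * Cc) + K\<^sub>4 * (C\<^sub>1 + 4 * \<omega>)"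
  have n1: "n \<ge> 1" using assms(1) by (simp add: n_def)
  have \<omega>: "\<omega> > 0" by (simp add: \<omega>_def)
  have C1: "C\<^sub>1 > 0" using lam cK(2) by (simp add: C\<^sub>1_def add_nonneg_pos)
  have K14: "K\<^sub>1 > 0" "K\<^sub>4 > 0" using lam cK(1) by (auto simp: K\<^sub>1_def K\<^sub>4_def add_pos_pos)
  have K: "K > 0" unfolding K_def
    by (intro add_pos_pos mult_pos_pos) (use \<omega> C1 K14 \<beta> Cc in auto)
  have \<kappa>: "\<beta>\<^sup>2 * \<omega> / 16 > 0" and m': "\<beta>\<^sup>2 * m > 0" using \<beta> \<omega> m by auto
  obtain c c' where c: "c > 0" "c' > 0" and iter: "\<forall>(\<Phi>::real \<Rightarrow> real) \<rho> M. mono \<Phi> \<longrightarrow> \<beta>\<^sup>2 * m \<le> \<Phi> 1 \<longrightarrow> 0 \<le> M \<longrightarrow>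
     (\<forall>R r. 3 \<le> R \<longrightarrow> R \<le> \<rho> \<longrightarrow> 1 \<le> r \<longrightarrow> \<Phi> R \<le> \<beta>\<^sup>2 * \<omega> / 16 * r ^ n \<longrightarrow>
        \<Phi> (R - 2) \<le> K * r * (\<Phi> R - \<Phi> (R - 2) + M * R ^ n)) \<longrightarrow>
     (\<forall>R. 1 \<le> R \<longrightarrow> R \<le> \<rho> \<longrightarrow> M * R \<le> c' \<longrightarrow> c * R ^ n \<le> \<Phi> R)"
    using growth_iteration[OF n1 K \<kappa> m'] by (elim exE conjE)
  \<comment> \<open>By the second energy estimate \<open>E (R - 2) \<le> D * R ^ (n - 1)\<close>
    whenever \<open>M * R \<le> c'\<close>.\<close>
  define D where "D = 9/4 * C\<^sub>1 * \<omega> * real n + 4 * \<omega> * c'"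
  have D: "D > 0" using C1 \<omega> n1 c by (simp add: D_def add_pos_pos)
  \<comment> \<open>From this radius on, the energy term is at most half of the lower bound
    \<open>c * R ^ n / 3 ^ n\<close> for \<open>\<Phi> (R - 2)\<close>.\<close>
  define R\<^sub>0 where "R\<^sub>0 = max 3 (2 * K\<^sub>4 * D * 3 ^ n / c)"
  \<comment> \<open>For large radii the remaining half is divided by the factor 9/4 of
    \<open>\<Phi>_le\<close>, whence 2/9; for radii below \<open>R\<^sub>0\<close> the monotonicity
    of \<open>V\<close> and the value \<open>m\<close> at radius 1 suffice.\<close>
  define C where "C = min (2/9 * c / 3 ^ n) (m / R\<^sub>0 ^ n)"
  have R0: "R\<^sub>0 \<ge> 3" by (simp add: R\<^sub>0_def)
  have C: "C > 0" using c m R0 by (simp add: C_def)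
  show ?thesis
  proof (rule exI[of _ C], rule conjI[OF C], rule exI[of _ c'], rule conjI[OF c(2)],
      intro allI impI, elim conjE)
    fix \<rho> :: real and a :: "real^'n \<Rightarrow> real^'n^'n" and b :: "real^'n \<Rightarrow> real"
      and G :: "real^'n \<Rightarrow> real \<Rightarrow> real" and u :: "real^'n \<Rightarrow> real" and R :: real
    assume h: "in_W1inf (ball 0 \<rho>) a" "\<forall>x\<in>ball 0 \<rho>. transpose (a x) = a x" "in_Linf (ball 0 \<rho>) b"
      "caratheodory (ball 0 \<rho>) G" "\<forall>x\<in>ball 0 \<rho>. lam \<le> b x \<and> b x \<le> inverse lam"
      "\<forall>x\<in>ball 0 \<rho>. \<forall>\<xi>. lam * (norm \<xi>)\<^sup>2 \<le> (a x *v \<xi>) \<bullet> \<xi> \<and> (a x *v \<xi>) \<bullet> \<xi> \<le> inverse lam * (norm \<xi>)\<^sup>2"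
      "is_minimizer (ball 0 \<rho>) f a b G u" "Linf_norm (ball 0 \<rho>) (\<lambda>x. u x - 1/2) \<le> 1"
      and um: "superlevel_measure u \<beta> 1 = m" and R: "1 \<le> R" "R \<le> \<rho>"
      and RG: "ereal R \<le> ereal c' * inverse (Linf_norm (ball 0 \<rho> \<times> {-1/2<..<3/2}) (\<lambda>(x, s). G x s))"
    obtain M where MG: "M \<ge> 0" "Linf_norm (ball 0 \<rho> \<times> {-1/2<..<3/2}) (\<lambda>(x, s). G x s) \<le> ereal M" "M * R \<le> c'"
      using ereal_bound_from_inverse[OF R(1) c(2) RG] by blast
    interpret bounded_minimizer \<rho> lam M c\<^sub>W K\<^sub>W \<beta> f a b G u
    proof
      show "AE x in lebesgue_on (ball 0 \<rho>). \<forall>s\<in>{-1/2..3/2}. \<bar>G x s\<bar> \<le> M"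
        by (rule caratheodory_bound[OF h(4) open_ball _ MG(2)]) simp
      show "AE x in lebesgue_on (ball 0 \<rho>). \<bar>u x - 1/2\<bar> \<le> 1"
        by (rule Linf_norm_nonneg_bound) (use h(8) in \<open>simp add: one_ereal_def\<close>)
    qed (use h(1-7) lam MG(1) \<beta> Wc W(1) W0 cK in \<open>auto simp: in_W1inf_def in_Linf_def\<close>)
    have \<rho>1: "1 \<le> \<rho>" using R by simp
    have V1: "V 1 = m" using V_eq_superlevel_measure[OF \<rho>1] um by simp
    have \<Phi>1: "\<beta>\<^sup>2 * m \<le> \<Phi> 1" using V_le_\<Phi>[OF \<rho>1] V1 by simp
    \<comment> \<open>The bound is used at \<open>R - 2\<close> below, so it is proved at all radii
      up to \<open>R\<close>; the smallness condition is inherited from \<open>R\<close> because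
      \<open>M\<close> is nonnegative.\<close>
    have \<Phi>R: "c * R' ^ n \<le> \<Phi> R'" if "1 \<le> R'" "R' \<le> R" for R'
    proof (rule iter[rule_format, where \<rho> = \<rho> and M = M])
      show "mono \<Phi>" by (rule monoI) (rule \<Phi>_mono)
      show "\<Phi> (R - 2) \<le> K * r * (\<Phi> R - \<Phi> (R - 2) + M * R ^ n)"
        if "3 \<le> R" "R \<le> \<rho>" "1 \<le> r" "\<Phi> R \<le> \<beta>\<^sup>2 * \<omega> / 16 * r ^ n" for R r
        using \<Phi>_step[OF cut Cc that(1,2,3)] that(4)
        by (simp add: K_def K\<^sub>1_def K\<^sub>4_def C\<^sub>1_def \<omega>_def n_def)
      show "M * R' \<le> c'" using mult_left_mono[OF that(2) MG(1)] MG(3) by linarith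
    qed (use that R \<Phi>1 MG in auto)
    have "C * R ^ n \<le> V R"
    proof (cases "R < R\<^sub>0")
      case True
      have "C * R ^ n \<le> m / R\<^sub>0 ^ n * R\<^sub>0 ^ n"
        using True R m R0 by (intro mult_mono power_mono) (auto simp: C_def)
      also have "\<dots> = m" using R0 by simp
      also have "\<dots> \<le> V R" using V_mono[OF R] V1 by simp
      finally show ?thesis .
    next
      case False
      then have R3: "R \<ge> 3" using R0 by simp
      obtain j where j: "n = Suc j" using n1 by (cases n) auto
      have MR: "M * (R - 1) \<le> c'" using mult_left_mono[of "R - 1" R M] MG by simp
      have "E (R - 2) \<le> (9/4 * C\<^sub>1 * \<omega> * real n + 4 * \<omega> * (M * (R - 1))) * (R - 1) ^ (n - 1)"
        using E_estimates(2)[OF cut, of "R - 2"] R3 R(2) by (simp add: C\<^sub>1_def \<omega>_def n_def)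
      also have "\<dots> \<le> D * R ^ (n - 1)"
        unfolding D_def using MR \<omega> C1 R3 MG(1) c(2)
        by (intro mult_mono add_mono power_mono) auto
      finally have "K\<^sub>4 * E (R - 2) \<le> K\<^sub>4 * (D * R ^ j)" using K14 by (simp add: j)
      moreover have "K\<^sub>4 * (D * R ^ j) \<le> c * R ^ n / 3 ^ n / 2"
      proof -
        have "2 * K\<^sub>4 * D * 3 ^ n / c \<le> R" using False by (simp add: R\<^sub>0_def)
        then have "2 * K\<^sub>4 * D * 3 ^ n \<le> c * R" using c by (simp add: field_simps)
        then have "2 * K\<^sub>4 * D * 3 ^ n * R ^ j \<le> c * R * R ^ j" using R3 by (intro mult_right_mono) auto
        then show ?thesis by (simp add: j field_simps)
      qed
      moreover have "c * R ^ n / 3 ^ n \<le> \<Phi> (R - 2)"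
      proof -
        have "c * (R ^ n / 3 ^ n) \<le> c * (R - 2) ^ n"
          using power_third_le[OF R3] c by (intro mult_left_mono) auto
        also have "\<dots> \<le> \<Phi> (R - 2)" using R3 by (intro \<Phi>R) auto
        finally show ?thesis by simp
      qed
      moreover have "\<Phi> (R - 2) \<le> 9/4 * V (R - 2) + K\<^sub>4 * E (R - 2)"
        using \<Phi>_le[of "R - 2"] R by (simp add: K\<^sub>4_def)
      moreover have "V (R - 2) \<le> V R" using R by (intro V_mono) auto
      ultimately have "2/9 * (c * R ^ n / 3 ^ n) \<le> V R" by argo
      moreover have "C * R ^ n \<le> 2/9 * c / 3 ^ n * R ^ n"
        using R by (intro mult_right_mono) (auto simp: C_def)
      ultimately show ?thesis by simp
    qed
    then show "C * R ^ CARD('n) \<le> superlevel_measure u \<beta> R"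
      using V_eq_superlevel_measure[OF R(2)] by (simp add: n_def)
  qed
qed

end
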